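(* To each pair $(g,m)$ of integers with $g\ge0$, $m\ge1$ and $(g,m)\notin\{(0,1),(0,2)\}$ there corresponds a polynomial $\vec P_g$ in $m$ variables such that $$\frac{|\mathrm{Aut}\,\alpha|}{|\alpha|!}\vec H_g(\alpha)=\left(\prod_{i=1}^m\binom{2\alpha_i}{\alpha_i}\right)\vec P_g(\alpha_1,\dots,\alpha_m)$$ for all partitions $\alpha=(\alpha_1,\dots,\alpha_m)$ with $\ell(\alpha)=m$.
   Context: For a partition $\alpha$ of $d=|\alpha|\ge 1$ with $\ell(\alpha)$ parts and an integer $g\ge 0$, $\vec H_g(\alpha)$ is the number of $(r+1)$-tuples $(\sigma,\tau_1,\dots,\tau_r)$ of permutations in the symmetric group on $\{1,\dots,d\}$, with $r=2g-2+\ell(\alpha)+d$, such that: $\sigma$ has cycle type $\alpha$ and the $\tau_i$ are transpositions; $\sigma\tau_1\cdots\tau_r$ is the identity; the group $\langle\sigma,\tau_1,\dots,\tau_r\rangle$ acts transitively on $\{1,\dots,d\}$; and, writing $\tau_i=(s_i\ t_i)$ with $s_i<t_i$, one has $t_1\le\dots\le t_r$. $|\mathrm{Aut}\,\alpha|=\prod_{k\ge1}m_k!$ where $m_k$ is the number of parts of $\alpha$ equal to $k$. *)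

theory Defs
  imports
    "HOL-Algebra.Sym_Groups"
    "HOL-Combinatorics.Orbits"
    "HOL-Library.Poly_Mapping"
    "HOL-Library.Multiset"
    Complex_Main
begin

definition is_partition :: "nat list \<Rightarrow> bool" where
  "is_partition \<alpha> \<longleftrightarrow> sorted_wrt (\<ge>) \<alpha> \<and> (\<forall>a\<in>set \<alpha>. a \<ge> 1)"

definition aut_card :: "nat list \<Rightarrow> nat" where
  "aut_card \<alpha> = (\<Prod>k\<in>set \<alpha>. fact (count_list \<alpha> k))"

text \<open>The lengths of the cycles of \<open>\<sigma>\<close> on \<open>{1..d}\<close>; fixed points contribute cycles of
  length \<open>1\<close>.\<close>

definition cycle_type :: "nat \<Rightarrow> (nat \<Rightarrow> nat) \<Rightarrow> nat multiset" where
  "cycle_type d \<sigma> = image_mset card (mset_set (Orbits.orbit \<sigma> ` {1..d}))"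

definition generates_transitive :: "nat \<Rightarrow> (nat \<Rightarrow> nat) set \<Rightarrow> bool" where
  "generates_transitive d S \<longleftrightarrow>
     (\<forall>x\<in>{1..d}. \<forall>y\<in>{1..d}. \<exists>p\<in>generate (sym_group d) S. p x = y)"

definition monotone_transpositions :: "nat \<Rightarrow> (nat \<Rightarrow> nat) list \<Rightarrow> bool" where
  "monotone_transpositions d \<tau>s \<longleftrightarrow>
     (\<exists>s t. (\<forall>i<length \<tau>s. 1 \<le> s i \<and> s i < t i \<and> t i \<le> d \<and> \<tau>s ! i = transpose (s i) (t i)) \<and>
            (\<forall>i j. i \<le> j \<and> j < length \<tau>s \<longrightarrow> t i \<le> t j))"

text \<open>The number of transpositions is \<open>2g - 2 + \<ell>(\<alpha>) + d\<close>; for nonempty partitions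
  \<open>\<ell>(\<alpha>) + d \<ge> 2\<close>, so the subtraction below does not truncate. Products are composed as functions
  (rightmost factor first); inverting \<open>\<sigma>\<tau>\<^sub>1\<dots>\<tau>\<^sub>r = id\<close> shows that the opposite convention yields
  the same number of tuples.\<close>

definition monotone_factorizations ::
  "nat \<Rightarrow> nat list \<Rightarrow> ((nat \<Rightarrow> nat) \<times> (nat \<Rightarrow> nat) list) set" where
  "monotone_factorizations g \<alpha> = {(\<sigma>, \<tau>s).
     \<sigma> permutes {1..sum_list \<alpha>} \<and>
     cycle_type (sum_list \<alpha>) \<sigma> = mset \<alpha> \<and>
     length \<tau>s = 2 * g + length \<alpha> + sum_list \<alpha> - 2 \<and>
     monotone_transpositions (sum_list \<alpha>) \<tau>s \<and>
     \<sigma> \<circ> foldr (\<circ>) \<tau>s id = id \<and>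
     generates_transitive (sum_list \<alpha>) (insert \<sigma> (set \<tau>s))}"

definition monotone_hurwitz :: "nat \<Rightarrow> nat list \<Rightarrow> nat" where
  "monotone_hurwitz g \<alpha> = card (monotone_factorizations g \<alpha>)"

text \<open>Multivariate polynomials are finitely supported maps from monomials to coefficients, a
  monomial being the finitely supported map from variable indices to exponents.\<close>

definition poly_vars :: "((nat \<Rightarrow>\<^sub>0 nat) \<Rightarrow>\<^sub>0 'a::zero) \<Rightarrow> nat set" where
  "poly_vars P = (\<Union>k\<in>Poly_Mapping.keys P. Poly_Mapping.keys k)"

definition poly_eval ::
  "((nat \<Rightarrow>\<^sub>0 nat) \<Rightarrow>\<^sub>0 'a::comm_semiring_1) \<Rightarrow> (nat \<Rightarrow> 'a) \<Rightarrow> 'a" where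
  "poly_eval P x = (\<Sum>k\<in>Poly_Mapping.keys P. Poly_Mapping.lookup P k *
                     (\<Prod>i\<in>Poly_Mapping.keys k. x i ^ Poly_Mapping.lookup k i))"

end

theory Submission
  imports Defs "HOL-Computational_Algebra.Computational_Algebra"
    "HOL-Combinatorics.Multiset_Permutations" "HOL-Library.Nat_Bijection"
begin

text \<open>The number of connected monotone words with a given product depends only on the cycle type of
  the product, since the transpositions with a fixed larger entry sum to commuting Jucys-Murphy
  elements and the words are enumerated by complete homogeneous, hence symmetric, polynomials in
  these. Removing the largest transposition therefore gives a cut-and-join recursion. Sorted by genus
  and summed over one part \<open>k\<close> with weight \<open>k x\<^sup>k\<close>, it becomes a quadratic recursion
  for power series in \<open>x\<close>, in which the series of genus \<open>0\<close> with one part is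
  \<open>c = (1 - sqrt (1 - 4 x)) / 2\<close>; moving its contributions to the left-hand side amounts
  to a multiplication by \<open>Y = 1 / sqrt (1 - 4 x)\<close>, the generating series of the central binomial
  coefficients. The odd powers of \<open>Y\<close> span series whose coefficients are \<open>2 n choose n\<close> times
  a polynomial in \<open>n\<close>. The operations of the recursion, applied in all variables at once, preserve
  this span, and the cases \<open>(g, m) = (1, 1)\<close> and \<open>(0, 3)\<close>, which involve
  \<open>(g, m) = (0, 2)\<close>, lie in it by explicit computation.\<close>

text \<open>The obstacle is that the unstable series do not have the claimed form: with two parts in
  genus 0 the normalized counts have the sum of the two parts as a denominator
  (\<open>G_nth\<close>). Above the base cases these series enter only beside a shift of another
  series, and the combination of the two, \<open>join\<close>, is free of the denominator. This
  cancellation is proved for the odd powers of \<open>Y\<close> in \<open>join_power\<close> and for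
  the two-part series themselves in \<open>three_point\<close>. Parity is the other point. A product
  of two odd powers of \<open>Y\<close> is even; moving the terms with \<open>c\<close> to the left
  multiplies it by \<open>Y = 1 / (1 - 2 c)\<close>, which makes it odd again. The induction runs
  over \<open>2 g + card T\<close>, where \<open>T\<close> indexes the parts other than
  \<open>k\<close>, so that \<open>card T = m - 1\<close>. The excluded pairs are those with value 0
  or 1, the two explicit cases are those with value 2.\<close>

section \<open>Sums over monotone words\<close>

text \<open>The letters of a word are pairs \<open>(i, t)\<close> with \<open>i\<close> occurring after \<open>t\<close> in the list \<open>L\<close>,
  and the second components run through \<open>L\<close> in order. The sum ranges over all such words of
  length \<open>r\<close>, each letter acting on the state \<open>s\<close>, the first letter first.\<close>

fun mono_sum :: "('a \<Rightarrow> 'a \<Rightarrow> 's \<Rightarrow> 's) \<Rightarrow> 'a list \<Rightarrow> nat \<Rightarrow> ('s \<Rightarrow> int) \<Rightarrow> 's \<Rightarrow> int" where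
  "mono_sum act [] 0 f s = f s"
| "mono_sum act [] (Suc r) f s = 0"
| "mono_sum act (t # ts) 0 f s = f s"
| "mono_sum act (t # ts) (Suc r) f s =
     (\<Sum>i\<in>set ts. mono_sum act (t # ts) r f (act i t s)) + mono_sum act ts (Suc r) f s"

lemma mono_sum_0 [simp]: "mono_sum act L 0 f s = f s"
  by (cases L) auto

text \<open>Two runs of the same word, on states linked by \<open>R\<close> and with letters renamed
  by \<open>h\<close>, are compared letter by letter; injectivity makes the renaming a reindexing of
  each sum. With \<open>h = id\<close> this serves to enlarge a state by further data or to carry an
  invariant.\<close>

lemma mono_sum_sim:
  assumes "R s s'"
    and "\<And>i t s s'. i \<in> set L \<Longrightarrow> t \<in> set L \<Longrightarrow> R s s' \<Longrightarrow> R (act i t s) (act' (h i) (h t) s')"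
    and "\<And>s s'. R s s' \<Longrightarrow> f s = f' s'"
    and "inj_on h (set L)"
  shows "mono_sum act L r f s = mono_sum act' (map h L) r f' s'"
  using assms
proof (induction act L r f s arbitrary: s' rule: mono_sum.induct)
  case (1 act f s)
  then show ?case by simp
next
  case (2 act r f s)
  then show ?case by simp
next
  case (3 act t ts f s)
  then show ?case by simp
next
  case (4 act t ts r f s)
  have inj: "inj_on h (set ts)" using 4(6) by simp
  have "(\<Sum>i\<in>set ts. mono_sum act (t # ts) r f (act i t s))
    = (\<Sum>i\<in>set ts. mono_sum act' (map h (t # ts)) r f' (act' (h i) (h t) s'))"
  proof (rule sum.cong[OF refl])
    fix i assume i: "i \<in> set ts"
    show "mono_sum act (t # ts) r f (act i t s) = mono_sum act' (map h (t # ts)) r f' (act' (h i) (h t) s')"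
      by (rule 4(1)[OF i]) (use i 4(3-6) in auto)
  qed
  also have "\<dots> = (\<Sum>i\<in>set (map h ts). mono_sum act' (map h (t # ts)) r f' (act' i (h t) s'))"
    unfolding set_map by (subst sum.reindex[OF inj]) simp
  finally have a: "(\<Sum>i\<in>set ts. mono_sum act (t # ts) r f (act i t s))
    = (\<Sum>i\<in>set (map h ts). mono_sum act' (map h (t # ts)) r f' (act' i (h t) s'))" .
  have "mono_sum act ts (Suc r) f s = mono_sum act' (map h ts) (Suc r) f' s'"
    by (rule 4(2)) (use 4(3-5) inj in auto)
  with a show ?case by simp
qed

lemma mono_sum_cong_inv:
  assumes "P s"
    and "\<And>i t s. i \<in> set L \<Longrightarrow> t \<in> set L \<Longrightarrow> P s \<Longrightarrow> P (act i t s)"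
    and "\<And>s. P s \<Longrightarrow> f s = f' s"
  shows "mono_sum act L r f s = mono_sum act L r f' s"
proof -
  have "mono_sum act L r f s = mono_sum act (map id L) r f' s"
    by (rule mono_sum_sim[where R = "\<lambda>s s'. s = s' \<and> P s"]) (use assms in auto)
  then show ?thesis by simp
qed

lemma mono_sum_zero [simp]: "mono_sum act L r (\<lambda>s. 0) s = 0"
  by (induction act L r "\<lambda>s::'b. 0::int" s rule: mono_sum.induct) auto

lemma mono_sum_add:
  "mono_sum act L r (\<lambda>s. f s + g s) s = mono_sum act L r f s + mono_sum act L r g s"
  by (induction act L r f s rule: mono_sum.induct) (auto simp: sum.distrib)

lemma mono_sum_sum:
  "mono_sum act L r (\<lambda>s. \<Sum>b\<in>X. f b s) s = (\<Sum>b\<in>X. mono_sum act L r (f b) s)"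
  by (induction X rule: infinite_finite_induct) (auto simp: mono_sum_add)

text \<open>If no letter is mixed, each second component belongs to one side of \<open>B\<close>. As
  the second components run through \<open>L\<close> in order, the word is the only monotone merge
  of its subwords inside and outside \<open>B\<close>, so the lengths are convolved without shuffle
  multiplicities. \<open>Z\<close> describes dead states: mixed letters lead into it, no letter
  leads out of it, and \<open>f\<close> vanishes there.\<close>

lemma mono_sum_split:
  assumes "R s s1 s2"
    and "\<And>s s1 s2. R s s1 s2 \<Longrightarrow> f s = f1 s1 * f2 s2"
    and "\<And>i t s s1 s2. i \<in> set L \<Longrightarrow> t \<in> set L \<Longrightarrow> i \<in> B \<Longrightarrow> t \<in> B \<Longrightarrow> R s s1 s2 \<Longrightarrow>
      R (act i t s) (act i t s1) s2"
    and "\<And>i t s s1 s2. i \<in> set L \<Longrightarrow> t \<in> set L \<Longrightarrow> i \<notin> B \<Longrightarrow> t \<notin> B \<Longrightarrow> R s s1 s2 \<Longrightarrow>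
      R (act i t s) s1 (act i t s2)"
    and "\<And>i t s. i \<in> set L \<Longrightarrow> t \<in> set L \<Longrightarrow> (i \<in> B) \<noteq> (t \<in> B) \<Longrightarrow> Z (act i t s)"
    and "\<And>i t s. i \<in> set L \<Longrightarrow> t \<in> set L \<Longrightarrow> Z s \<Longrightarrow> Z (act i t s)"
    and "\<And>s. Z s \<Longrightarrow> f s = 0"
  shows "mono_sum act L r f s = (\<Sum>q\<le>r. mono_sum act (filter (\<lambda>x. x \<in> B) L) q f1 s1 *
    mono_sum act (filter (\<lambda>x. x \<notin> B) L) (r - q) f2 s2)"
  using assms
proof (induction act L r f s arbitrary: s1 s2 rule: mono_sum.induct)
  case (1 act f s)
  then show ?case by simp
next
  case (2 act r f s)
  have "mono_sum act [] q f1 s1 * mono_sum act [] (Suc r - q) f2 s2 = 0" if "q \<le> Suc r" for q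
    using that by (cases q) auto
  then have "(\<Sum>q\<le>Suc r. mono_sum act [] q f1 s1 * mono_sum act [] (Suc r - q) f2 s2) = 0"
    by (intro sum.neutral) auto
  then show ?case by simp
next
  case (3 act t ts f s)
  then show ?case by simp
next
  case (4 act t ts r f s)
  let ?H = "\<lambda>L q f s. mono_sum act L q f s"
  let ?B = "filter (\<lambda>x. x \<in> B) ts" and ?N = "filter (\<lambda>x. x \<notin> B) ts"
  have tail: "?H ts (Suc r) f s = (\<Sum>q\<le>Suc r. ?H ?B q f1 s1 * ?H ?N (Suc r - q) f2 s2)"
    by (rule 4(2)) (blast intro: 4(3-9) list.set_intros)+
  have dead: "?H (t # ts) r f (act i t s) = 0" if i: "i \<in> set ts" "(i \<in> B) \<noteq> (t \<in> B)" for i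
  proof -
    have "?H (t # ts) r f (act i t s) = ?H (t # ts) r (\<lambda>s. 0) (act i t s)"
      by (rule mono_sum_cong_inv[where P = Z]) (use i in \<open>blast intro: 4(7-9) list.set_intros\<close>)+
    then show ?thesis by simp
  qed
  have bs: "set ?B = set ts \<inter> B" "set ?N = set ts - B" by auto
  show ?case
  proof (cases "t \<in> B")
    case True
    have live: "?H (t # ts) r f (act i t s) = (\<Sum>q\<le>r. ?H (t # ?B) q f1 (act i t s1) * ?H ?N (r - q) f2 s2)"
      if i: "i \<in> set ts" "i \<in> B" for i
    proof -
      have "?H (t # ts) r f (act i t s) = (\<Sum>q\<le>r. ?H (filter (\<lambda>x. x \<in> B) (t # ts)) q f1 (act i t s1)
        * ?H (filter (\<lambda>x. x \<notin> B) (t # ts)) (r - q) f2 s2)"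
        by (rule 4(1)[OF i(1)]) (use i True in \<open>blast intro: 4(3-9) list.set_intros\<close>)+
      then show ?thesis using True by simp
    qed
    have "(\<Sum>i\<in>set ts. ?H (t # ts) r f (act i t s)) = (\<Sum>i\<in>set ts \<inter> B. ?H (t # ts) r f (act i t s))"
      by (rule sum.mono_neutral_right) (use dead True in auto)
    also have "\<dots> = (\<Sum>i\<in>set ts \<inter> B. \<Sum>q\<le>r. ?H (t # ?B) q f1 (act i t s1) * ?H ?N (r - q) f2 s2)"
      by (rule sum.cong) (use live in auto)
    also have "\<dots> = (\<Sum>q\<le>r. \<Sum>i\<in>set ts \<inter> B. ?H (t # ?B) q f1 (act i t s1) * ?H ?N (r - q) f2 s2)"
      by (rule sum.swap)
    finally have 1: "(\<Sum>i\<in>set ts. ?H (t # ts) r f (act i t s))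
      = (\<Sum>q\<le>r. \<Sum>i\<in>set ts \<inter> B. ?H (t # ?B) q f1 (act i t s1) * ?H ?N (r - q) f2 s2)" .
    have "(\<Sum>q\<le>Suc r. ?H (t # ?B) q f1 s1 * ?H ?N (Suc r - q) f2 s2)
      = f1 s1 * ?H ?N (Suc r) f2 s2 + (\<Sum>q\<le>r. ?H (t # ?B) (Suc q) f1 s1 * ?H ?N (r - q) f2 s2)"
      by (subst sum.atMost_Suc_shift) simp
    also have "\<dots> = f1 s1 * ?H ?N (Suc r) f2 s2
      + (\<Sum>q\<le>r. (\<Sum>i\<in>set ts \<inter> B. ?H (t # ?B) q f1 (act i t s1) * ?H ?N (r - q) f2 s2)
           + ?H ?B (Suc q) f1 s1 * ?H ?N (r - q) f2 s2)"
      by (simp add: distrib_right sum_distrib_right bs del: set_filter)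
    also have "\<dots> = (\<Sum>i\<in>set ts. ?H (t # ts) r f (act i t s)) + ?H ts (Suc r) f s"
      unfolding 1 tail by (subst sum.atMost_Suc_shift) (simp add: sum.distrib)
    finally show ?thesis using True by simp
  next
    case False
    have live: "?H (t # ts) r f (act i t s) = (\<Sum>q\<le>r. ?H ?B q f1 s1 * ?H (t # ?N) (r - q) f2 (act i t s2))"
      if i: "i \<in> set ts" "i \<notin> B" for i
    proof -
      have "?H (t # ts) r f (act i t s) = (\<Sum>q\<le>r. ?H (filter (\<lambda>x. x \<in> B) (t # ts)) q f1 s1
        * ?H (filter (\<lambda>x. x \<notin> B) (t # ts)) (r - q) f2 (act i t s2))"
        by (rule 4(1)[OF i(1)]) (use i False in \<open>blast intro: 4(3-9) list.set_intros\<close>)+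
      then show ?thesis using False by simp
    qed
    have "(\<Sum>i\<in>set ts. ?H (t # ts) r f (act i t s)) = (\<Sum>i\<in>set ts - B. ?H (t # ts) r f (act i t s))"
      by (rule sum.mono_neutral_right) (use dead False in auto)
    also have "\<dots> = (\<Sum>i\<in>set ts - B. \<Sum>q\<le>r. ?H ?B q f1 s1 * ?H (t # ?N) (r - q) f2 (act i t s2))"
      by (rule sum.cong) (use live in auto)
    also have "\<dots> = (\<Sum>q\<le>r. \<Sum>i\<in>set ts - B. ?H ?B q f1 s1 * ?H (t # ?N) (r - q) f2 (act i t s2))"
      by (rule sum.swap)
    finally have 1: "(\<Sum>i\<in>set ts. ?H (t # ts) r f (act i t s))
      = (\<Sum>q\<le>r. \<Sum>i\<in>set ts - B. ?H ?B q f1 s1 * ?H (t # ?N) (r - q) f2 (act i t s2))" .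
    have "(\<Sum>q\<le>Suc r. ?H ?B q f1 s1 * ?H (t # ?N) (Suc r - q) f2 s2)
      = (\<Sum>q\<le>r. ?H ?B q f1 s1 * ?H (t # ?N) (Suc (r - q)) f2 s2) + ?H ?B (Suc r) f1 s1 * f2 s2"
      by (simp add: Suc_diff_le)
    also have "\<dots> = (\<Sum>q\<le>r. (\<Sum>i\<in>set ts - B. ?H ?B q f1 s1 * ?H (t # ?N) (r - q) f2 (act i t s2))
           + ?H ?B q f1 s1 * ?H ?N (Suc r - q) f2 s2) + ?H ?B (Suc r) f1 s1 * f2 s2"
      by (simp add: distrib_left sum_distrib_left bs Suc_diff_le del: set_filter)
    also have "\<dots> = (\<Sum>i\<in>set ts. ?H (t # ts) r f (act i t s)) + ?H ts (Suc r) f s"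
      unfolding 1 tail by (simp add: sum.distrib)
    finally show ?thesis using False by simp
  qed
qed

text \<open>The laws do not say that a letter squares to the identity. The states used below also
  remember a family of sets that can only shrink, so a letter read twice need not restore the
  state.\<close>

locale transposition_action =
  fixes act :: "'a \<Rightarrow> 'a \<Rightarrow> 's \<Rightarrow> 's"
  assumes act_sym: "act i j s = act j i s"
    and act_disjoint: "distinct [i, j, k, l] \<Longrightarrow> act i j (act k l s) = act k l (act i j s)"
    and act_triangle: "distinct [i, j, k] \<Longrightarrow> act i j (act j k s) = act j k (act k i s)"
begin

text \<open>The product of the Jucys-Murphy operators of \<open>x\<close> and \<open>y\<close> over
  \<open>R\<close> is invariant under exchanging \<open>x\<close> and \<open>y\<close>. Letters with
  \<open>i \<noteq> j\<close> commute. For \<open>i = j\<close> the triangle law turns the letters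
  \<open>(i, y)\<close>, \<open>(i, x)\<close> into \<open>(i, x)\<close>, \<open>(x, y)\<close>, so
  the diagonal on each side is the single sum on the other.\<close>

lemma double_sum_swap:
  fixes f :: "'s \<Rightarrow> int"
  assumes "finite R" "x \<notin> R" "y \<notin> R" "x \<noteq> y"
  shows "(\<Sum>i\<in>R. \<Sum>j\<in>R. f (act j x (act i y s))) + (\<Sum>i\<in>R. f (act y x (act i y s)))
       = (\<Sum>i\<in>R. \<Sum>j\<in>R. f (act j y (act i x s))) + (\<Sum>i\<in>R. f (act x y (act i x s)))"
proof -
  have diag: "act i x (act i y s) = act x y (act i x s)" if "i \<in> R" for i
    using act_triangle[of x i y s] act_triangle[of i y x s] act_sym[of x i] act_sym[of x y] that assms
    by (cases "i = x"; cases "i = y"; auto)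
  have diag': "act i y (act i x s) = act y x (act i y s)" if "i \<in> R" for i
    using act_triangle[of y i x s] act_triangle[of i x y s] act_sym[of y i] act_sym[of x y] that assms
    by (cases "i = x"; cases "i = y"; auto)
  have off: "act j x (act i y s) = act i y (act j x s)" if "i \<in> R" "j \<in> R" "j \<noteq> i" for i j
    using act_disjoint[of j x i y s] that assms by auto
  have sep: "(\<Sum>i\<in>R. \<Sum>j\<in>R. g i j) = (\<Sum>i\<in>R. \<Sum>j\<in>R-{i}. g i j) + (\<Sum>i\<in>R. g i i)" for g :: "'a \<Rightarrow> 'a \<Rightarrow> int"
    by (simp add: sum.remove[OF assms(1)] sum.distrib)
  have a: "(\<Sum>i\<in>R. \<Sum>j\<in>R-{i}. f (act j x (act i y s))) = (\<Sum>i\<in>R. \<Sum>j\<in>R-{i}. f (act i y (act j x s)))"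
    by (intro sum.cong refl) (use off in auto)
  have "(\<Sum>i\<in>R. \<Sum>j\<in>R-{i}. f (act i y (act j x s))) + (\<Sum>i\<in>R. f (act i y (act i x s)))
      = (\<Sum>i\<in>R. \<Sum>j\<in>R. f (act i y (act j x s)))"
    using sep[of "\<lambda>i j. f (act i y (act j x s))"] by simp
  also have "\<dots> = (\<Sum>j\<in>R. \<Sum>i\<in>R. f (act i y (act j x s)))"
    by (rule sum.swap)
  finally have b: "(\<Sum>i\<in>R. \<Sum>j\<in>R-{i}. f (act i y (act j x s))) + (\<Sum>i\<in>R. f (act i y (act i x s)))
     = (\<Sum>j\<in>R. \<Sum>i\<in>R. f (act i y (act j x s)))" .
  show ?thesis
    unfolding sep[of "\<lambda>i j. f (act j x (act i y s))"] a b[symmetric]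
    by (simp add: diag diag')
qed

text \<open>Writing \<open>X\<close> and \<open>Y\<close> for the operators of the two largest elements, a sum over words is the
  complete homogeneous polynomial in \<open>X\<close> and \<open>Y\<close> up to the contribution of the other elements;
  it is therefore determined by \<open>X + Y\<close> and \<open>Y X\<close>, which do not change under the swap.\<close>

lemma mono_sum_Cons2:
  "mono_sum act (x # y # ts) (Suc (Suc r)) f s
   = (\<Sum>i\<in>set ts. mono_sum act (x # y # ts) (Suc r) f (act i x s))
   + (\<Sum>i\<in>set ts. mono_sum act (x # y # ts) (Suc r) f (act i y s))
   + (\<Sum>i\<in>set (y # ts). mono_sum act (x # y # ts) (Suc r) f (act i x s))
   - (\<Sum>i\<in>set ts. mono_sum act (x # y # ts) (Suc r) f (act i x s))
   - (\<Sum>i\<in>set ts. \<Sum>j\<in>set (y # ts). mono_sum act (x # y # ts) r f (act j x (act i y s)))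
   + mono_sum act ts (Suc (Suc r)) f s"
proof -
  \<comment> \<open>The recursion solved for its tail, that is,
    \<open>h_(r+1)(Y, ...) = h_(r+1)(X, Y, ...) - X h_r(X, Y, ...)\<close>. After this substitution
    no sum over words in \<open>y # ts\<close> is left.\<close>
  have k: "mono_sum act (y # ts) (Suc r) f s' = mono_sum act (x # y # ts) (Suc r) f s'
      - (\<Sum>i\<in>set (y # ts). mono_sum act (x # y # ts) r f (act i x s'))" for s'
    by simp
  have "mono_sum act (x # y # ts) (Suc (Suc r)) f s
    = (\<Sum>i\<in>set (y # ts). mono_sum act (x # y # ts) (Suc r) f (act i x s))
      + ((\<Sum>i\<in>set ts. mono_sum act (y # ts) (Suc r) f (act i y s)) + mono_sum act ts (Suc (Suc r)) f s)"
    by simp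
  then show ?thesis
    unfolding k by (simp only: sum_subtractf)
qed

lemma mono_sum_swap:
  assumes "distinct (x # y # ts)"
  shows "mono_sum act (x # y # ts) r f s = mono_sum act (y # x # ts) r f s"
proof (induction r arbitrary: s rule: less_induct)
  case (less r)
  have ne: "x \<notin> set ts" "y \<notin> set ts" "x \<noteq> y" using assms by auto
  consider "r = 0" | "r = 1" | r' where "r = Suc (Suc r')"
    by (metis One_nat_def not0_implies_Suc)
  then show ?case
  proof cases
    case 1
    then show ?thesis by simp
  next
    case 2
    then show ?thesis using ne act_sym[of x y] by (simp add: algebra_simps)
  next
    case 3
    have IH1: "mono_sum act (y # x # ts) (Suc r') f s' = mono_sum act (x # y # ts) (Suc r') f s'" for s'
      using less[of "Suc r'"] 3 by simp
    have IH0: "mono_sum act (y # x # ts) r' f s' = mono_sum act (x # y # ts) r' f s'" for s'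
      using less[of "r'"] 3 by simp
    have ins: "(\<Sum>i\<in>set (y # ts). g i) = g y + (\<Sum>i\<in>set ts. g i)"
      "(\<Sum>i\<in>set (x # ts). g i) = g x + (\<Sum>i\<in>set ts. g i)" for g :: "'a \<Rightarrow> int"
      using ne by auto
    have ds: "(\<Sum>i\<in>set ts. \<Sum>j\<in>set (y # ts). mono_sum act (x # y # ts) r' f (act j x (act i y s)))
      = (\<Sum>i\<in>set ts. \<Sum>j\<in>set (x # ts). mono_sum act (x # y # ts) r' f (act j y (act i x s)))"
      unfolding ins sum.distrib
      using double_sum_swap[OF finite_set ne, where f = "mono_sum act (x # y # ts) r' f" and s = s]
      by linarith
    show ?thesis
      unfolding 3 mono_sum_Cons2[of x y] mono_sum_Cons2[of y x] IH0 IH1 ds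
      unfolding ins using act_sym[of x y s] by simp
  qed
qed

lemma mono_sum_Cons_cong:
  assumes "\<And>r s. mono_sum act L r f s = mono_sum act L' r f s" "set L = set L'"
  shows "mono_sum act (t # L) r f s = mono_sum act (t # L') r f s"
  using assms by (induction r arbitrary: s) auto

lemma mono_sum_move_front:
  "distinct L \<Longrightarrow> x \<in> set L \<Longrightarrow> mono_sum act L r f s = mono_sum act (x # remove1 x L) r f s"
proof (induction L arbitrary: r s)
  case (Cons y L)
  show ?case
  proof (cases "x = y")
    case False
    then have x: "x \<in> set L" using Cons.prems by auto
    have "mono_sum act (y # L) r f s = mono_sum act (y # x # remove1 x L) r f s"
      by (rule mono_sum_Cons_cong) (use Cons x in auto)
    also have "\<dots> = mono_sum act (x # y # remove1 x L) r f s"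
      by (rule mono_sum_swap) (use Cons.prems False in auto)
    finally show ?thesis using False by simp
  qed simp
qed simp

lemma mono_sum_set_cong:
  "distinct L \<Longrightarrow> distinct L' \<Longrightarrow> set L = set L' \<Longrightarrow> mono_sum act L r f s = mono_sum act L' r f s"
proof (induction L arbitrary: L' r s)
  case (Cons x L)
  have "mono_sum act L' r f s = mono_sum act (x # remove1 x L') r f s"
    by (rule mono_sum_move_front) (use Cons.prems in auto)
  also have "\<dots> = mono_sum act (x # L) r f s"
  proof (rule mono_sum_Cons_cong)
    have "set (remove1 x L') = set L"
      using Cons.prems by (auto simp: set_remove1_eq)
    moreover from this show "set (remove1 x L') = set L" .
    ultimately show "mono_sum act (remove1 x L') r f s = mono_sum act L r f s" for r s
      using Cons.IH[of "remove1 x L'"] Cons.prems by simp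
  qed
  finally show ?case by simp
qed simp

end

section \<open>Connected monotone words\<close>

text \<open>Connectedness is recorded as one condition per letter. The conditions commute, and those
  of \<open>(i, j)\<close> and \<open>(j, k)\<close> together say the same as those of
  \<open>(j, k)\<close> and \<open>(k, i)\<close>. Hence connected words obey the laws of
  \<open>transposition_action\<close> just as all words do.\<close>

definition cut_act :: "'a \<Rightarrow> 'a \<Rightarrow> ('a \<Rightarrow> 'a) \<times> 'a set set \<Rightarrow> ('a \<Rightarrow> 'a) \<times> 'a set set" where
  "cut_act i t s = (transpose i t \<circ> fst s, {B \<in> snd s. i \<in> B \<longleftrightarrow> t \<in> B})"

interpretation cut: transposition_action cut_act
proof
  show "cut_act i j s = cut_act j i s" for i j :: 'a and s
    by (auto simp: cut_act_def transpose_commute)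
  show "cut_act i j (cut_act k l s) = cut_act k l (cut_act i j s)" if "distinct [i, j, k, l]" for i j k l :: 'a and s
    using that by (auto simp: cut_act_def fun_eq_iff transpose_def)
  show "cut_act i j (cut_act j k s) = cut_act j k (cut_act k i s)" if "distinct [i, j, k]" for i j k :: 'a and s
    using that by (auto simp: cut_act_def fun_eq_iff transpose_def)
qed

definition indecomposable :: "'a set \<Rightarrow> 'a set set \<Rightarrow> bool" where
  "indecomposable A \<B> \<longleftrightarrow> (\<forall>B\<in>\<B>. A \<subseteq> B \<or> A \<inter> B = {})"

text \<open>The set component of a state collects the sets that are invariant under the letters read so
  far, so the following is the indicator function of the end states of connected words.\<close>

definition final_state :: "'a set \<Rightarrow> ('a \<Rightarrow> 'a) \<times> 'a set set \<Rightarrow> int" where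
  "final_state A s = of_bool ((\<forall>x\<in>A. fst s x = x) \<and> indecomposable A (snd s))"

definition word_count :: "'a list \<Rightarrow> nat \<Rightarrow> ('a \<Rightarrow> 'a) \<Rightarrow> int" where
  "word_count L r p = mono_sum cut_act L r (final_state (set L)) (p, UNIV)"

lemma word_count_set_cong:
  "distinct L \<Longrightarrow> distinct L' \<Longrightarrow> set L = set L' \<Longrightarrow> word_count L r p = word_count L' r p"
  unfolding word_count_def by (metis cut.mono_sum_set_cong)

text \<open>Both families of sets start as \<open>UNIV\<close>, possibly over different types, and
  \<open>h\<close> is controlled only on \<open>set L\<close>. Sets are therefore matched by their
  traces on \<open>set L\<close>, which is all that the letters and the end condition can
  see.\<close>

lemma word_count_conj:
  assumes h: "inj_on h (set L)"
    and p: "\<And>x. x \<in> set L \<Longrightarrow> p x \<in> set L \<and> h (p x) = q (h x)"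
  shows "word_count L r p = word_count (map h L) r q"
proof -
  let ?R = "\<lambda>s s'. (\<forall>x\<in>set L. fst s x \<in> set L \<and> h (fst s x) = fst s' (h x))
     \<and> (\<forall>B\<in>snd s. \<exists>B'\<in>snd s'. \<forall>x\<in>set L. x \<in> B \<longleftrightarrow> h x \<in> B')
     \<and> (\<forall>B'\<in>snd s'. \<exists>B\<in>snd s. \<forall>x\<in>set L. x \<in> B \<longleftrightarrow> h x \<in> B')"
  show ?thesis
    unfolding word_count_def
  proof (rule mono_sum_sim[where R = ?R])
    have "\<exists>B'. \<forall>x\<in>set L. x \<in> B \<longleftrightarrow> h x \<in> B'" for B
      by (rule exI[of _ "h ` (B \<inter> set L)"]) (use h in \<open>auto simp: inj_on_def\<close>)
    moreover have "\<exists>B. \<forall>x\<in>set L. x \<in> B \<longleftrightarrow> h x \<in> B'" for B'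
      by (rule exI[of _ "{x. h x \<in> B'}"]) auto
    ultimately show "?R (p, UNIV) (q, UNIV)"
      using p by simp
  next
    fix i t s and s' :: "('b \<Rightarrow> 'b) \<times> 'b set set"
    assume it: "i \<in> set L" "t \<in> set L"
      and R: "?R s s'"
    note R1 = R[THEN conjunct1] and R2 = R[THEN conjunct2, THEN conjunct1] and R3 = R[THEN conjunct2, THEN conjunct2]
    have tr: "transpose i t x \<in> set L" "h (transpose i t x) = transpose (h i) (h t) (h x)" if "x \<in> set L" for x
      using that it h by (auto simp: transpose_def inj_on_def)
    have 1: "\<forall>x\<in>set L. fst (cut_act i t s) x \<in> set L \<and> h (fst (cut_act i t s) x) = fst (cut_act (h i) (h t) s') (h x)"
      using R1 by (simp add: cut_act_def tr)
    have 2: "\<forall>B\<in>snd (cut_act i t s). \<exists>B'\<in>snd (cut_act (h i) (h t) s'). \<forall>x\<in>set L. x \<in> B \<longleftrightarrow> h x \<in> B'"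
    proof
      fix B assume B: "B \<in> snd (cut_act i t s)"
      then have "B \<in> snd s" "i \<in> B \<longleftrightarrow> t \<in> B" by (auto simp: cut_act_def)
      moreover obtain B' where "B' \<in> snd s'" "\<forall>x\<in>set L. x \<in> B \<longleftrightarrow> h x \<in> B'" 
        using bspec[OF R2 \<open>B \<in> snd s\<close>] by (elim bexE)
      ultimately show "\<exists>B'\<in>snd (cut_act (h i) (h t) s'). \<forall>x\<in>set L. x \<in> B \<longleftrightarrow> h x \<in> B'"
        using it by (intro bexI[of _ B']) (auto simp: cut_act_def)
    qed
    have 3: "\<forall>B'\<in>snd (cut_act (h i) (h t) s'). \<exists>B\<in>snd (cut_act i t s). \<forall>x\<in>set L. x \<in> B \<longleftrightarrow> h x \<in> B'"
    proof
      fix B' assume B: "B' \<in> snd (cut_act (h i) (h t) s')"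
      then have "B' \<in> snd s'" "h i \<in> B' \<longleftrightarrow> h t \<in> B'" by (auto simp: cut_act_def)
      moreover obtain B where "B \<in> snd s" "\<forall>x\<in>set L. x \<in> B \<longleftrightarrow> h x \<in> B'"
        using bspec[OF R3 \<open>B' \<in> snd s'\<close>] by (elim bexE)
      ultimately show "\<exists>B\<in>snd (cut_act i t s). \<forall>x\<in>set L. x \<in> B \<longleftrightarrow> h x \<in> B'"
        using it by (intro bexI[of _ B]) (auto simp: cut_act_def)
    qed
    show "?R (cut_act i t s) (cut_act (h i) (h t) s')"
      by (intro conjI 1 2 3)
  next
    fix s and s' :: "('b \<Rightarrow> 'b) \<times> 'b set set"
    assume R: "?R s s'"
    note R1 = R[THEN conjunct1] and R2 = R[THEN conjunct2, THEN conjunct1] and R3 = R[THEN conjunct2, THEN conjunct2]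
    have "fst s x = x \<longleftrightarrow> fst s' (h x) = h x" if "x \<in> set L" for x
      using R1 h that by (metis inj_on_def)
    then have "(\<forall>x\<in>set L. fst s x = x) \<longleftrightarrow> (\<forall>x\<in>h ` set L. fst s' x = x)"
      by auto
    moreover have "indecomposable (set L) (snd s) \<longleftrightarrow> indecomposable (h ` set L) (snd s')"
    proof
      assume l: "indecomposable (set L) (snd s)"
      show "indecomposable (h ` set L) (snd s')"
        unfolding indecomposable_def
      proof
        fix B' assume "B' \<in> snd s'"
        from bspec[OF R3 this] obtain B where "B \<in> snd s" "\<forall>x\<in>set L. x \<in> B \<longleftrightarrow> h x \<in> B'"
          by (elim bexE)
        moreover from bspec[OF l[unfolded indecomposable_def] \<open>B \<in> snd s\<close>] have "set L \<subseteq> B \<or> set L \<inter> B = {}" .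
        ultimately show "h ` set L \<subseteq> B' \<or> h ` set L \<inter> B' = {}" by blast
      qed
    next
      assume l: "indecomposable (h ` set L) (snd s')"
      show "indecomposable (set L) (snd s)"
        unfolding indecomposable_def
      proof
        fix B assume "B \<in> snd s"
        from bspec[OF R2 this] obtain B' where "B' \<in> snd s'" "\<forall>x\<in>set L. x \<in> B \<longleftrightarrow> h x \<in> B'"
          by (elim bexE)
        moreover from bspec[OF l[unfolded indecomposable_def] \<open>B' \<in> snd s'\<close>] have "h ` set L \<subseteq> B' \<or> h ` set L \<inter> B' = {}" .
        ultimately show "set L \<subseteq> B \<or> set L \<inter> B = {}" by blast
      qed
    qed
    ultimately show "final_state (set L) s = final_state (set (map h L)) s'"
      by (simp add: final_state_def)
  qed (rule h)
qed

section \<open>Words that split along an invariant set\<close>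

definition separated :: "'a set \<Rightarrow> 'a set \<Rightarrow> ('a \<Rightarrow> 'a) \<times> 'a set set \<Rightarrow> int" where
  "separated A B s = of_bool (B \<in> snd s) * final_state B s * final_state (A - B) s"

text \<open>In the relation \<open>?R\<close> the run on each side reads only its own letters and so
  keeps more sets than the full run; intersecting such a set with the side yields a set that the
  full run keeps as well. Indecomposability of a side is thus the same in both runs.\<close>

lemma mono_sum_separated:
  assumes p: "p ` B \<subseteq> B" "p ` (set L - B) \<subseteq> set L - B" and B: "B \<subseteq> set L"
  shows "mono_sum cut_act L r (separated (set L) B) (p, UNIV)
    = (\<Sum>q\<le>r. word_count (filter (\<lambda>x. x \<in> B) L) q p * word_count (filter (\<lambda>x. x \<notin> B) L) (r - q) p)"
proof -
  let ?A = "set L"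
  let ?R = "\<lambda>s s1 s2. B \<in> snd s \<and> (\<forall>x\<in>B. fst s x = fst s1 x \<and> fst s1 x \<in> B)
     \<and> (\<forall>x\<in>?A - B. fst s x = fst s2 x \<and> fst s2 x \<in> ?A - B)
     \<and> snd s \<subseteq> snd s1 \<and> snd s \<subseteq> snd s2 \<and> (\<forall>C\<in>snd s1. C \<inter> B \<in> snd s) \<and> (\<forall>C\<in>snd s2. C \<inter> (?A - B) \<in> snd s)"
  have fs: "set (filter (\<lambda>x. x \<in> B) L) = B" "set (filter (\<lambda>x. x \<notin> B) L) = ?A - B"
    using B by auto
  show ?thesis unfolding word_count_def fs
  proof (rule mono_sum_split[where R = ?R and Z = "\<lambda>s. B \<notin> snd s"])
    show "?R (p, UNIV) (p, UNIV) (p, UNIV)" using p by auto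
  next
    fix s s1 s2 :: "('a \<Rightarrow> 'a) \<times> 'a set set" assume R: "?R s s1 s2"
    have sub: "snd s \<subseteq> snd s1" "snd s \<subseteq> snd s2" and Bs: "B \<in> snd s" using R by simp_all
    have 1: "(\<forall>x\<in>B. fst s x = x) = (\<forall>x\<in>B. fst s1 x = x)" "(\<forall>x\<in>?A-B. fst s x = x) = (\<forall>x\<in>?A-B. fst s2 x = x)"
      using R by auto
    have "indecomposable B (snd s1)" if i: "indecomposable B (snd s)"
      unfolding indecomposable_def
    proof
      fix C assume "C \<in> snd s1"
      with R have "C \<inter> B \<in> snd s" by simp
      from bspec[OF i[unfolded indecomposable_def] this] show "B \<subseteq> C \<or> B \<inter> C = {}" by blast
    qed
    moreover have "indecomposable B (snd s)" if i: "indecomposable B (snd s1)"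
      using i sub unfolding indecomposable_def by blast
    moreover have "indecomposable (?A-B) (snd s2)" if i: "indecomposable (?A-B) (snd s)"
      unfolding indecomposable_def
    proof
      fix C assume "C \<in> snd s2"
      with R have "C \<inter> (?A-B) \<in> snd s" by simp
      from bspec[OF i[unfolded indecomposable_def] this] show "(?A-B) \<subseteq> C \<or> (?A-B) \<inter> C = {}" by blast
    qed
    moreover have "indecomposable (?A-B) (snd s)" if i: "indecomposable (?A-B) (snd s2)"
      using i sub unfolding indecomposable_def by blast
    ultimately show "separated ?A B s = final_state B s1 * final_state (?A - B) s2"
      using 1 Bs unfolding separated_def final_state_def by (simp add: of_bool_def)
  next
    fix i t and s s1 s2 :: "('a \<Rightarrow> 'a) \<times> 'a set set" assume it: "i \<in> B" "t \<in> B" and R: "?R s s1 s2"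
    have "transpose i t x \<in> B" if "x \<in> B" for x
      using that it by (auto simp: transpose_def)
    moreover have "transpose i t x = x" if "x \<in> ?A - B" for x
      using that it by (auto simp: transpose_def)
    ultimately show "?R (cut_act i t s) (cut_act i t s1) s2"
      using R it unfolding cut_act_def by auto
  next
    fix i t and s s1 s2 :: "('a \<Rightarrow> 'a) \<times> 'a set set" assume it: "i \<in> ?A" "t \<in> ?A" "i \<notin> B" "t \<notin> B" and R: "?R s s1 s2"
    have "transpose i t x \<in> ?A - B" if "x \<in> ?A - B" for x
      using that it by (auto simp: transpose_def)
    moreover have "transpose i t x = x" if "x \<in> B" for x
      using that it by (auto simp: transpose_def)
    ultimately show "?R (cut_act i t s) s1 (cut_act i t s2)"
      using R it unfolding cut_act_def by auto
  next
    fix i t and s :: "('a \<Rightarrow> 'a) \<times> 'a set set" assume "(i \<in> B) \<noteq> (t \<in> B)"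
    then show "B \<notin> snd (cut_act i t s)" by (auto simp: cut_act_def)
  next
    fix i t and s :: "('a \<Rightarrow> 'a) \<times> 'a set set" assume "B \<notin> snd s"
    then show "B \<notin> snd (cut_act i t s)" by (auto simp: cut_act_def)
  next
    fix s :: "('a \<Rightarrow> 'a) \<times> 'a set set" assume "B \<notin> snd s"
    then show "separated ?A B s = 0" by (simp add: separated_def)
  qed
qed

text \<open>Letters that respect \<open>B\<close> cannot bring back a point that the permutation
  moves out of \<open>B\<close>, whereas a counted end state fixes \<open>B\<close>
  pointwise.\<close>

lemma mono_sum_separated_eq_0:
  assumes "\<not> p ` B \<subseteq> B" "B \<subseteq> set L"
  shows "mono_sum cut_act L r (separated (set L) B) (p, \<B>) = 0"
proof -
  have "mono_sum cut_act L r (separated (set L) B) (p, \<B>) = mono_sum cut_act L r (\<lambda>s. 0) (p, \<B>)"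
  proof (rule mono_sum_cong_inv[where P = "\<lambda>s. B \<in> snd s \<longrightarrow> \<not> fst s ` B \<subseteq> B"])
    fix i t :: 'a and s
    assume s: "B \<in> snd s \<longrightarrow> \<not> fst s ` B \<subseteq> B"
    show "B \<in> snd (cut_act i t s) \<longrightarrow> \<not> fst (cut_act i t s) ` B \<subseteq> B"
    proof
      assume "B \<in> snd (cut_act i t s)"
      then have "B \<in> snd s" "i \<in> B \<longleftrightarrow> t \<in> B" by (auto simp: cut_act_def)
      moreover from this s obtain x where "x \<in> B" "fst s x \<notin> B" by blast
      ultimately have "fst (cut_act i t s) x \<notin> B"
        by (cases "fst s x = i"; cases "fst s x = t") (simp_all add: cut_act_def)
      then show "\<not> fst (cut_act i t s) ` B \<subseteq> B" using \<open>x \<in> B\<close> by blast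
    qed
  next
    fix s assume s: "B \<in> snd s \<longrightarrow> \<not> fst s ` B \<subseteq> B"
    show "separated (set L) B s = 0"
    proof (rule ccontr)
      assume "separated (set L) B s \<noteq> 0"
      then have "B \<in> snd s" "\<forall>x\<in>B. fst s x = x" by (auto simp: separated_def final_state_def split: if_splits)
      with s show False by force
    qed
  qed (use assms in auto)
  then show ?thesis by simp
qed

text \<open>If a letter joining \<open>d\<close> and \<open>y\<close> is removed from a connected word, then either the rest is
  still connected or there is exactly one way to split it into two connected parts.\<close>

lemma indecomposable_cut:
  assumes alg: "\<And>B C. B \<in> \<B> \<Longrightarrow> C \<in> \<B> \<Longrightarrow> B \<inter> C \<in> \<B>" "\<And>B. B \<in> \<B> \<Longrightarrow> - B \<in> \<B>" "A \<in> \<B>"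
    and dy: "d \<in> A" "y \<in> A" "finite A"
  shows "(of_bool (indecomposable A {B \<in> \<B>. d \<in> B \<longleftrightarrow> y \<in> B}) :: int)
    = of_bool (indecomposable A \<B>)
    + (\<Sum>B\<in>{B. B \<subseteq> A \<and> d \<in> B \<and> y \<notin> B}. of_bool (B \<in> \<B> \<and> indecomposable B \<B> \<and> indecomposable (A - B) \<B>))"
proof -
  let ?X = "{B. B \<subseteq> A \<and> d \<in> B \<and> y \<notin> B}"
  let ?Q = "\<lambda>B. B \<in> \<B> \<and> indecomposable B \<B> \<and> indecomposable (A - B) \<B>"
  let ?T = "{B \<in> \<B>. d \<in> B \<longleftrightarrow> y \<in> B}"
  have finX: "finite ?X" by (rule finite_subset[of _ "Pow A"]) (use dy in auto)
  have diff: "B - C \<in> \<B>" if "B \<in> \<B>" "C \<in> \<B>" for B C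
    using alg(1)[OF that(1) alg(2)[OF that(2)]] by (simp add: Diff_eq)
  have uniq: "B = B'" if "B \<in> ?X" "B' \<in> ?X" "?Q B" "?Q B'" for B B'
  proof -
    have "B \<subseteq> B' \<or> B \<inter> B' = {}" "B' \<subseteq> B \<or> B' \<inter> B = {}"
      using that(3,4) by (auto simp: indecomposable_def)
    then show ?thesis using that(1,2) by blast
  qed
  have sum_le: "(\<Sum>B\<in>?X. of_bool (?Q B)) = (1::int)" if "B \<in> ?X" "?Q B" for B
  proof -
    have "(\<Sum>B\<in>?X. of_bool (?Q B)) = (\<Sum>C\<in>?X. if C = B then (1::int) else 0)"
      by (rule sum.cong) (use uniq that in auto)
    also have "\<dots> = 1" using finX that by simp
    finally show ?thesis .
  qed
  have sum_0: "(\<Sum>B\<in>?X. of_bool (?Q B)) = (0::int)" if "\<And>B. B \<in> ?X \<Longrightarrow> \<not> ?Q B"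
    by (rule sum.neutral) (use that in auto)
  consider (conn) "indecomposable A \<B>" | (cut) "\<not> indecomposable A \<B>" "indecomposable A ?T"
    | (none) "\<not> indecomposable A \<B>" "\<not> indecomposable A ?T" by blast
  then show ?thesis
  proof cases
    case conn
    then have "indecomposable A ?T" by (auto simp: indecomposable_def)
    moreover have "\<not> ?Q B" if "B \<in> ?X" for B
    proof
      assume "?Q B"
      then have "A \<subseteq> B \<or> A \<inter> B = {}" using conn by (auto simp: indecomposable_def)
      then show False using that dy by blast
    qed
    ultimately show ?thesis using conn sum_0 by simp
  next
    case cut
    then obtain C where C: "C \<in> \<B>" "\<not> A \<subseteq> C" "A \<inter> C \<noteq> {}" unfolding indecomposable_def by blast
    then have ne: "(d \<in> C) \<noteq> (y \<in> C)" using cut(2) unfolding indecomposable_def by blast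
    \<comment> \<open>The component of \<open>d\<close>: the half of the splitting set
      \<open>C\<close> that contains \<open>d\<close>.\<close>
    define B where "B = A \<inter> (if d \<in> C then C else - C)"
    have B: "B \<in> ?X" "B \<in> \<B>" using ne dy alg C(1) by (auto simp: B_def)
    \<comment> \<open>A member of the family inside \<open>A\<close> that does not separate
      \<open>d\<close> from \<open>y\<close> is trivial. For the side of \<open>d\<close> it is
      applied to whichever of \<open>B - D\<close> and \<open>B \<inter> D\<close> misses
      \<open>d\<close>; both miss \<open>y\<close>, so this set must be empty. The side of
      \<open>y\<close> is symmetric.\<close>
    have tri: "D = {} \<or> A \<subseteq> D" if "D \<in> \<B>" "d \<in> D \<longleftrightarrow> y \<in> D" "D \<subseteq> A" for D
    proof -
      have "A \<subseteq> D \<or> A \<inter> D = {}" using cut(2) that(1,2) by (auto simp: indecomposable_def)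
      then show ?thesis using that(3) by blast
    qed
    have "indecomposable B \<B>"
      unfolding indecomposable_def
    proof
      fix D assume D: "D \<in> \<B>"
      show "B \<subseteq> D \<or> B \<inter> D = {}"
      proof (cases "d \<in> D")
        case True
        then have "B - D = {} \<or> A \<subseteq> B - D" using diff[OF B(2) D] B(1) by (intro tri) auto
        then show ?thesis using B(1) dy by blast
      next
        case False
        then have "B \<inter> D = {} \<or> A \<subseteq> B \<inter> D" using alg(1)[OF B(2) D] B(1) by (intro tri) auto
        then show ?thesis using B(1) dy by blast
      qed
    qed
    moreover have "indecomposable (A - B) \<B>"
      unfolding indecomposable_def
    proof
      fix D assume D: "D \<in> \<B>"
      have AB: "A - B \<in> \<B>" using diff[OF alg(3) B(2)] .
      show "A - B \<subseteq> D \<or> (A - B) \<inter> D = {}"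
      proof (cases "y \<in> D")
        case True
        then have "A - B - D = {} \<or> A \<subseteq> A - B - D" using diff[OF AB D] B(1) by (intro tri) auto
        then show ?thesis using B(1) dy by blast
      next
        case False
        then have "(A - B) \<inter> D = {} \<or> A \<subseteq> (A - B) \<inter> D" using alg(1)[OF AB D] B(1) by (intro tri) auto
        then show ?thesis using B(1) dy by blast
      qed
    qed
    ultimately have "?Q B" using B by blast
    then show ?thesis using cut sum_le[OF B(1)] by simp
  next
    case none
    then obtain C where C: "C \<in> \<B>" "d \<in> C \<longleftrightarrow> y \<in> C" "\<not> A \<subseteq> C" "A \<inter> C \<noteq> {}" unfolding indecomposable_def by blast
    have "\<not> ?Q B" if B: "B \<in> ?X" for B
    proof
      assume Q: "?Q B"
      then have "B \<subseteq> C \<or> B \<inter> C = {}" "A - B \<subseteq> C \<or> (A - B) \<inter> C = {}"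
        using C(1) by (auto simp: indecomposable_def)
      with B C dy show False by blast
    qed
    then show ?thesis using none sum_0 by simp
  qed
qed

text \<open>The run that starts after a letter joining \<open>d\<close> and \<open>y\<close> is
  accompanied by the run without that restriction. The family of the latter stays closed under
  intersections and complements and contains \<open>set L\<close>, as
  \<open>indecomposable_cut\<close> requires.\<close>

lemma mono_sum_cut:
  assumes "d \<in> set L" "y \<in> set L"
  shows "mono_sum cut_act L r (final_state (set L)) (p, {B. d \<in> B \<longleftrightarrow> y \<in> B})
    = word_count L r p + (\<Sum>B\<in>{B. B \<subseteq> set L \<and> d \<in> B \<and> y \<notin> B}. mono_sum cut_act L r (separated (set L) B) (p, UNIV))"
proof -
  let ?A = "set L"
  let ?X = "{B. B \<subseteq> ?A \<and> d \<in> B \<and> y \<notin> B}"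
  let ?R = "\<lambda>s s'. fst s = fst s' \<and> snd s = {B \<in> snd s'. d \<in> B \<longleftrightarrow> y \<in> B} \<and> ?A \<in> snd s'
    \<and> (\<forall>B\<in>snd s'. \<forall>C\<in>snd s'. B \<inter> C \<in> snd s') \<and> (\<forall>B\<in>snd s'. - B \<in> snd s')"
  have "mono_sum cut_act L r (final_state ?A) (p, {B. d \<in> B \<longleftrightarrow> y \<in> B})
    = mono_sum cut_act (map id L) r (\<lambda>s. final_state ?A s + (\<Sum>B\<in>?X. separated ?A B s)) (p, UNIV)"
  proof (rule mono_sum_sim[where R = ?R])
    fix i t s and s' :: "('a \<Rightarrow> 'a) \<times> 'a set set"
    assume "i \<in> ?A" "t \<in> ?A" "?R s s'"
    then show "?R (cut_act i t s) (cut_act (id i) (id t) s')"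
      unfolding cut_act_def by auto
  next
    fix s and s' :: "('a \<Rightarrow> 'a) \<times> 'a set set"
    assume R: "?R s s'"
    have c: "(of_bool (indecomposable ?A (snd s)) :: int) = of_bool (indecomposable ?A (snd s'))
      + (\<Sum>B\<in>?X. of_bool (B \<in> snd s' \<and> indecomposable B (snd s') \<and> indecomposable (?A - B) (snd s')))"
      using indecomposable_cut[of "snd s'" ?A d y] R assms by simp
    have sep: "separated ?A B s' = of_bool (\<forall>x\<in>?A. fst s' x = x) *
      of_bool (B \<in> snd s' \<and> indecomposable B (snd s') \<and> indecomposable (?A - B) (snd s'))" if "B \<in> ?X" for B
      using that unfolding separated_def final_state_def by auto
    have "final_state ?A s = of_bool (\<forall>x\<in>?A. fst s' x = x) * of_bool (indecomposable ?A (snd s))"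
      using R by (simp add: final_state_def)
    also have "\<dots> = final_state ?A s' + (\<Sum>B\<in>?X. separated ?A B s')"
      unfolding c by (simp add: distrib_left sum_distrib_left sep final_state_def)
    finally show "final_state ?A s = final_state ?A s' + (\<Sum>B\<in>?X. separated ?A B s')" .
  qed auto
  then show ?thesis
    by (simp add: mono_sum_add mono_sum_sum word_count_def)
qed

text \<open>No letter involves \<open>d\<close>, so the singleton \<open>{d}\<close> stays invariant
  and the word is not connected.\<close>

lemma mono_sum_fresh_eq_0:
  assumes "d \<notin> set L" "set L \<noteq> {}" "A = insert d (set L)" 
  shows "mono_sum cut_act L r (final_state A) (p, UNIV) = 0"
proof -
  have "mono_sum cut_act L r (final_state A) (p, UNIV) = mono_sum cut_act L r (\<lambda>s. 0) (p, UNIV)"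
  proof (rule mono_sum_cong_inv[where P = "\<lambda>s. {d} \<in> snd s"])
    show "{d} \<in> snd (cut_act i t s)" if "i \<in> set L" "t \<in> set L" "{d} \<in> snd s" for i t s
    proof -
      have "i \<noteq> d" "t \<noteq> d" using that assms(1) by auto
      then show ?thesis using that(3) by (simp add: cut_act_def)
    qed
    show "final_state A s = 0" if "{d} \<in> snd s" for s
    proof -
      have "\<not> A \<subseteq> {d}" using assms by (cases L) auto
      moreover have "A \<inter> {d} \<noteq> {}" using assms(3) by simp
      ultimately have "\<not> indecomposable A (snd s)"
        using bspec[OF _ that, of "\<lambda>B. A \<subseteq> B \<or> A \<inter> B = {}"] by (simp only: indecomposable_def) argo
      then show ?thesis by (simp add: final_state_def)
    qed
  qed simp
  then show ?thesis by simp
qed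

text \<open>A connected word has to begin with a letter at \<open>d\<close>: a word that starts in
  the tail never meets \<open>d\<close> again. Removing this letter leaves a connected word or a
  pair of connected words.\<close>

lemma word_count_Cons_Suc:
  assumes "distinct (d # ts)"
  shows "word_count (d # ts) (Suc r) p = (\<Sum>y\<in>set ts. word_count (d # ts) r (transpose y d \<circ> p)
     + (\<Sum>B\<in>{B. B \<subseteq> set (d # ts) \<and> d \<in> B \<and> y \<notin> B}.
         mono_sum cut_act (d # ts) r (separated (set (d # ts)) B) (transpose y d \<circ> p, UNIV)))"
proof -
  let ?L = "d # ts"
  have tail: "mono_sum cut_act ts (Suc r) (final_state (set ?L)) (p, UNIV) = 0"
  proof (cases ts)
    case (Cons a list)
    then show ?thesis using assms by (intro mono_sum_fresh_eq_0[of d]) auto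
  qed simp
  have "word_count ?L (Suc r) p
    = (\<Sum>y\<in>set ts. mono_sum cut_act ?L r (final_state (set ?L)) (cut_act y d (p, UNIV)))"
    unfolding word_count_def by (simp add: tail del: set_simps)
  also have "\<dots> = (\<Sum>y\<in>set ts. mono_sum cut_act ?L r (final_state (set ?L)) (transpose y d \<circ> p, {B. d \<in> B \<longleftrightarrow> y \<in> B}))"
    by (intro sum.cong refl) (auto simp: cut_act_def intro!: arg_cong[of _ _ "mono_sum _ _ _ _"])
  also have "\<dots> = (\<Sum>y\<in>set ts. word_count ?L r (transpose y d \<circ> p)
     + (\<Sum>B\<in>{B. B \<subseteq> set ?L \<and> d \<in> B \<and> y \<notin> B}.
         mono_sum cut_act ?L r (separated (set ?L) B) (transpose y d \<circ> p, UNIV)))"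
    by (intro sum.cong refl mono_sum_cut) auto
  finally show ?thesis .
qed

section \<open>Cycles and the cut-and-join recursion\<close>

definition is_cycle :: "('a \<Rightarrow> 'a) \<Rightarrow> 'a list \<Rightarrow> bool" where
  "is_cycle p c \<longleftrightarrow> c \<noteq> [] \<and> distinct c \<and> map p c = rotate1 c"

lemma is_cycle_rotate: "is_cycle p c \<Longrightarrow> is_cycle p (rotate n c)"
  unfolding is_cycle_def by (simp add: rotate_map[symmetric]) (metis rotate1_rotate_swap)

lemma is_cycle_nth: "is_cycle p c \<Longrightarrow> j < length c \<Longrightarrow> p (c ! j) = c ! (Suc j mod length c)"
  unfolding is_cycle_def by (metis nth_map nth_rotate1)

lemma is_cycle_closed: "is_cycle p c \<Longrightarrow> x \<in> set c \<Longrightarrow> p x \<in> set c"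
  unfolding is_cycle_def by (metis image_eqI list.set_map set_rotate1)

lemma is_cycle_rotate_to:
  assumes "is_cycle p c" "x \<in> set c"
  obtains v where "is_cycle p (x # v)" "set (x # v) = set c" "length (x # v) = length c"
proof -
  obtain a b where c: "c = a @ x # b" using assms(2) by (meson split_list)
  have "rotate (length a) c = x # b @ a" unfolding c by (simp add: rotate_append)
  then show thesis using that[of "b @ a"] is_cycle_rotate[OF assms(1), of "length a"] unfolding c by auto
qed

lemma is_cycle_subset:
  assumes "is_cycle p c" "x \<in> set c" "x \<in> B" "p ` B \<subseteq> B"
  shows "set c \<subseteq> B"
proof -
  obtain v where v: "is_cycle p (x # v)" "set (x # v) = set c"
    using is_cycle_rotate_to[OF assms(1,2)] by metis
  have "(x # v) ! j \<in> B" if "j < length (x # v)" for j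
    using that
  proof (induction j)
    case (Suc j)
    then have "(x # v) ! Suc j = p ((x # v) ! j)"
      using is_cycle_nth[OF v(1), of j] by simp
    with Suc assms(4) show ?case by auto
  qed (use assms in simp)
  then show ?thesis using v(2) by (metis in_set_conv_nth subsetI)
qed

lemma map_transpose_id: "x \<notin> set c \<Longrightarrow> y \<notin> set c \<Longrightarrow> map (transpose x y) c = c"
  by (rule map_idI) (auto simp: transpose_def)

lemma is_cycle_transpose_other:
  assumes "is_cycle p c" "d \<notin> set c" "y \<notin> set c"
  shows "is_cycle (transpose y d \<circ> p) c"
proof -
  have "map (transpose y d \<circ> p) c = map (transpose y d) (rotate1 c)"
    using assms(1) by (simp add: is_cycle_def flip: map_map)
  then show ?thesis using assms by (simp add: map_transpose_id is_cycle_def)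
qed

lemma is_cycle_join:
  assumes "is_cycle p (d # u)" "is_cycle p (y # v)" "set (d # u) \<inter> set (y # v) = {}"
  shows "is_cycle (transpose y d \<circ> p) (d # u @ y # v)"
proof -
  have "map p (d # u) = u @ [d]" "map p (y # v) = v @ [y]"
    using assms(1,2) by (simp_all add: is_cycle_def)
  then have "map p (d # u @ y # v) = u @ [d] @ v @ [y]" by simp
  then have "map (transpose y d \<circ> p) (d # u @ y # v) = map (transpose y d) (u @ [d] @ v @ [y])"
    by (metis map_map)
  also have "\<dots> = u @ [y] @ v @ [d]"
    using assms by (auto simp: is_cycle_def map_transpose_id)
  finally show ?thesis using assms by (auto simp: is_cycle_def)
qed

lemma is_cycle_cut:
  assumes "is_cycle p (d # u @ y # v)"
  shows "is_cycle (transpose y d \<circ> p) (d # u)" "is_cycle (transpose y d \<circ> p) (y # v)"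
proof -
  have "map p (d # u) @ map p (y # v) = (u @ [y]) @ (v @ [d])"
    using assms by (simp add: is_cycle_def)
  then have "map p (d # u) = u @ [y]" "map p (y # v) = v @ [d]"
    by (subst (asm) append_eq_append_conv; simp)+
  then have "map (transpose y d \<circ> p) (d # u) = map (transpose y d) (u @ [y])"
    "map (transpose y d \<circ> p) (y # v) = map (transpose y d) (v @ [d])"
    by (metis map_map)+
  moreover have "d \<notin> set u" "d \<notin> set v" "y \<notin> set u" "y \<notin> set v" "d \<noteq> y"
    using assms by (auto simp: is_cycle_def)
  ultimately show "is_cycle (transpose y d \<circ> p) (d # u)" "is_cycle (transpose y d \<circ> p) (y # v)"
    using assms unfolding is_cycle_def by (simp_all add: map_transpose_id)
qed

section \<open>Families of disjoint cycles and the dependence on the cycle type alone\<close>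

definition cycle_family :: "('a \<Rightarrow> 'a) \<Rightarrow> 'i set \<Rightarrow> ('i \<Rightarrow> 'a list) \<Rightarrow> bool" where
  "cycle_family p S c \<longleftrightarrow> finite S \<and> (\<forall>i\<in>S. is_cycle p (c i)) \<and>
     (\<forall>i\<in>S. \<forall>j\<in>S. i \<noteq> j \<longrightarrow> set (c i) \<inter> set (c j) = {})"

abbreviation parts :: "('i \<Rightarrow> nat) \<Rightarrow> 'i set \<Rightarrow> nat multiset" where
  "parts x S \<equiv> image_mset x (mset_set S)"

lemma parts_cong: "(\<And>i. i \<in> S \<Longrightarrow> x i = y i) \<Longrightarrow> parts x S = parts y S"
  by (cases "finite S") (auto intro: image_mset_cong)

lemma cycle_family_subset: "cycle_family p S c \<Longrightarrow> J \<subseteq> S \<Longrightarrow> cycle_family p J c"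
  unfolding cycle_family_def by (meson finite_subset subsetD)

lemma cycle_family_closed:
  "cycle_family p S c \<Longrightarrow> p ` (\<Union>i\<in>S. set (c i)) \<subseteq> (\<Union>i\<in>S. set (c i))"
  unfolding cycle_family_def using is_cycle_closed by fast

lemma image_mset_eq_bij:
  assumes "finite S" "finite T" "image_mset f (mset_set S) = image_mset g (mset_set T)"
  obtains h where "bij_betw h S T" "\<And>i. i \<in> S \<Longrightarrow> g (h i) = f i"
proof -
  have "\<exists>h. bij_betw h S T \<and> (\<forall>i\<in>S. g (h i) = f i)"
    using assms
  proof (induction S arbitrary: T rule: finite_induct)
    case empty
    then have "T = {}" by (simp add: mset_set_empty_iff)
    then show ?case by (auto simp: bij_betw_def)
  next
    case (insert i S)
    have "f i \<in># image_mset g (mset_set T)" using insert.prems insert.hyps by (metis add_mset_remove_trivial_eq image_mset_add_mset insert_noteq_member mset_set.insert union_single_eq_member)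
    then obtain j where j: "j \<in> T" "g j = f i" using insert.prems by auto
    have "image_mset f (mset_set S) = image_mset g (mset_set (T - {j}))"
    proof -
      have "mset_set T = add_mset j (mset_set (T - {j}))"
        using insert.prems(1) j(1) by (rule mset_set.remove)
      then have "add_mset (f i) (image_mset f (mset_set S)) = add_mset (f i) (image_mset g (mset_set (T - {j})))"
        using insert.prems(2) insert.hyps j(2) by simp
      then show ?thesis by simp
    qed
    from insert.IH[OF _ this] insert.prems(1) obtain h
      where h: "bij_betw h S (T - {j})" "\<forall>i\<in>S. g (h i) = f i" by auto
    have "bij_betw (h(i := j)) S (T - {j})"
      using h(1) insert.hyps by (subst bij_betw_cong[of _ _ h]) auto
    then have "bij_betw (h(i := j)) (insert i S) (insert j (T - {j}))"
      using insert.hyps notIn_Un_bij_betw[of i S "h(i := j)" "T - {j}"] by simp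
    moreover have "insert j (T - {j}) = T" using j by auto
    ultimately have "bij_betw (h(i := j)) (insert i S) T" by simp
    then show ?case
      by (rule exI[of _ "h(i := j)", OF conjI]) (use h(2) j insert.hyps in auto)
  qed
  then show thesis using that by blast
qed

text \<open>Cycles of equal length are matched and then identified entry by entry. This map
  intertwines the two permutations, so \<open>word_count_conj\<close> applies; it does not respect
  the order of the lists, which is harmless by the symmetry of the sums.\<close>

lemma word_count_cycle_family:
  fixes c :: "'i \<Rightarrow> 'a list" and c' :: "'j \<Rightarrow> 'b list"
  assumes "cycle_family p S c" "cycle_family q T c'"
    and len: "parts (\<lambda>i. length (c i)) S = parts (\<lambda>i. length (c' i)) T"
    and L: "distinct L" "set L = (\<Union>i\<in>S. set (c i))" and L': "distinct L'" "set L' = (\<Union>i\<in>T. set (c' i))"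
  shows "word_count L r p = word_count L' r q"
proof -
  have fin: "finite S" "finite T" using assms unfolding cycle_family_def by auto
  obtain \<pi> where \<pi>: "bij_betw \<pi> S T" and l: "\<And>i. i \<in> S \<Longrightarrow> length (c' (\<pi> i)) = length (c i)"
    using image_mset_eq_bij[OF fin len] by metis
  let ?A = "\<Union>i\<in>S. set (c i)" and ?B = "\<Union>i\<in>T. set (c' i)"
  let ?P = "\<lambda>x y. \<exists>i\<in>S. \<exists>j<length (c i). x = c i ! j \<and> y = c' (\<pi> i) ! j"
  have "\<forall>x\<in>?A. \<exists>y. ?P x y" by (auto simp: in_set_conv_nth) metis
  then obtain h where h: "\<And>x. x \<in> ?A \<Longrightarrow> ?P x (h x)" by (metis bchoice)
  have cyc: "\<And>i. i \<in> S \<Longrightarrow> is_cycle p (c i)" "\<And>i. i \<in> T \<Longrightarrow> is_cycle q (c' i)"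
    and dis: "\<And>i. i \<in> S \<Longrightarrow> distinct (c i)" "\<And>i. i \<in> T \<Longrightarrow> distinct (c' i)"
    using assms(1,2) by (auto simp: cycle_family_def is_cycle_def)
  have dj: "i = j" if "i \<in> S" "j \<in> S" "x \<in> set (c i)" "x \<in> set (c j)" for i j x
    using assms(1) that unfolding cycle_family_def by blast
  have dj': "i = j" if "i \<in> T" "j \<in> T" "x \<in> set (c' i)" "x \<in> set (c' j)" for i j x
    using assms(2) that unfolding cycle_family_def by blast
  have \<pi>T: "\<pi> i \<in> T" if "i \<in> S" for i using \<pi> that by (auto simp: bij_betw_def)
  have \<pi>inj: "i = j" if "\<pi> i = \<pi> j" "i \<in> S" "j \<in> S" for i j
    using \<pi> that by (auto simp: bij_betw_def inj_on_def)
  have hn: "h (c i ! j) = c' (\<pi> i) ! j" if i: "i \<in> S" "j < length (c i)" for i j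
  proof -
    have "c i ! j \<in> ?A" using i nth_mem[of j "c i"] by blast
    from h[OF this] obtain i' j' where ij: "i' \<in> S" "j' < length (c i')" "c i ! j = c i' ! j'" "h (c i ! j) = c' (\<pi> i') ! j'"
      by blast
    have "i = i'" using dj[of i i' "c i ! j"] i ij by (metis nth_mem)
    moreover have "j = j'" using ij i dis(1)[of i] \<open>i = i'\<close> by (simp add: nth_eq_iff_index_eq)
    ultimately show ?thesis using ij by simp
  qed
  have inj: "inj_on h ?A"
  proof (rule inj_onI)
    fix x y assume xy: "x \<in> ?A" "y \<in> ?A" "h x = h y"
    obtain i j where i: "i \<in> S" "j < length (c i)" "x = c i ! j" "h x = c' (\<pi> i) ! j" using h[OF xy(1)] by blast
    obtain i' j' where i': "i' \<in> S" "j' < length (c i')" "y = c i' ! j'" "h y = c' (\<pi> i') ! j'" using h[OF xy(2)] by blast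
    have "\<pi> i = \<pi> i'" using dj'[of "\<pi> i" "\<pi> i'" "h x"] i i' xy(3) l \<pi>T by (metis nth_mem)
    then have "i = i'" using \<pi>inj i i' by blast
    moreover have "j = j'" using i i' xy(3) \<open>i = i'\<close> dis(2)[of "\<pi> i"] l \<pi>T by (simp add: nth_eq_iff_index_eq)
    ultimately show "x = y" using i i' by simp
  qed
  have img: "h ` ?A = ?B"
  proof
    show "h ` ?A \<subseteq> ?B"
    proof
      fix y assume "y \<in> h ` ?A"
      then obtain x where x: "x \<in> ?A" "y = h x" by blast
      from h[OF x(1)] obtain i j where "i \<in> S" "j < length (c i)" "y = c' (\<pi> i) ! j" unfolding x(2) by blast
      then show "y \<in> ?B" using \<pi>T l by (metis UN_I nth_mem)
    qed
    show "?B \<subseteq> h ` ?A"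
    proof
      fix y assume "y \<in> ?B"
      then obtain t j where t: "t \<in> T" "j < length (c' t)" "y = c' t ! j" by (auto simp: in_set_conv_nth)
      then obtain i where i: "i \<in> S" "t = \<pi> i" using \<pi> by (auto simp: bij_betw_def)
      then have "j < length (c i)" using t l by simp
      then have "y = h (c i ! j)" using t i hn by simp
      moreover have "c i ! j \<in> ?A" using i \<open>j < length (c i)\<close> nth_mem[of j "c i"] by blast
      ultimately show "y \<in> h ` ?A" by blast
    qed
  qed
  have "word_count L r p = word_count (map h L) r q"
  proof (rule word_count_conj)
    show "inj_on h (set L)" using inj L by simp
    fix x assume "x \<in> set L"
    then obtain i j where i: "i \<in> S" "j < length (c i)" "x = c i ! j" using L by (auto simp: in_set_conv_nth)
    have "p x = c i ! (Suc j mod length (c i))" using is_cycle_nth[OF cyc(1)] i by simp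
    moreover have m: "Suc j mod length (c i) < length (c i)"
      using i(2) by (metis mod_less_divisor not_less_zero zero_less_iff_neq_zero)
    ultimately have "p x \<in> set (c i)" "h (p x) = c' (\<pi> i) ! (Suc j mod length (c i))"
      using hn[OF i(1) m] nth_mem[OF m] by simp_all
    moreover from this have "p x \<in> set L" using L(2) i(1) by blast
    moreover have "h x = c' (\<pi> i) ! j" using hn[OF i(1,2)] i(3) by simp
    then have "q (h x) = c' (\<pi> i) ! (Suc j mod length (c' (\<pi> i)))"
      using is_cycle_nth[OF cyc(2)[OF \<pi>T[OF i(1)]], of j] i(2) l[OF i(1)] by simp
    ultimately show "p x \<in> set L \<and> h (p x) = q (h x)" using l[OF i(1)] by simp
  qed
  also have "\<dots> = word_count L' r q"
    by (rule word_count_set_cong) (use inj img L L' in \<open>auto simp: distinct_map\<close>)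
  finally show ?thesis .
qed

text \<open>Well defined by \<open>word_count_cycle_family\<close>, but meaningless if \<open>0 \<in># M\<close>: the empty list
  is not a cycle.\<close>

definition cycle_count :: "nat \<Rightarrow> nat multiset \<Rightarrow> int" where
  "cycle_count r M = (SOME n. \<exists>(p :: nat \<Rightarrow> nat) S (c :: nat \<Rightarrow> nat list) L.
     cycle_family p S c \<and> distinct L \<and> set L = (\<Union>i\<in>S. set (c i)) \<and>
     parts (\<lambda>i. length (c i)) S = M \<and> n = word_count L r p)"

lemma cycle_count_eq:
  fixes p :: "nat \<Rightarrow> nat" and c :: "nat \<Rightarrow> nat list"
  assumes "cycle_family p S c" "distinct L" "set L = (\<Union>i\<in>S. set (c i))"
    "parts (\<lambda>i. length (c i)) S = M"
  shows "cycle_count r M = word_count L r p"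
  unfolding cycle_count_def
proof (rule some_equality)
  show "\<exists>(p' :: nat \<Rightarrow> nat) S' (c' :: nat \<Rightarrow> nat list) L'. cycle_family p' S' c' \<and> distinct L' \<and> set L' = (\<Union>i\<in>S'. set (c' i)) \<and>
     parts (\<lambda>i. length (c' i)) S' = M \<and> word_count L r p = word_count L' r p'"
    using assms by (intro exI[of _ p] exI[of _ S] exI[of _ c] exI[of _ L]) simp
next
  fix n assume "\<exists>(p' :: nat \<Rightarrow> nat) S' (c' :: nat \<Rightarrow> nat list) L'. cycle_family p' S' c' \<and> distinct L' \<and> set L' = (\<Union>i\<in>S'. set (c' i)) \<and>
     parts (\<lambda>i. length (c' i)) S' = M \<and> n = word_count L' r p'"
  then obtain p' :: "nat \<Rightarrow> nat" and S' and c' :: "nat \<Rightarrow> nat list" and L' where q: "cycle_family p' S' c'" "distinct L'" "set L' = (\<Union>i\<in>S'. set (c' i))"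
     and M: "parts (\<lambda>i. length (c' i)) S' = M" and n: "n = word_count L' r p'" by blast
  from word_count_cycle_family[OF assms(1) q(1) _ assms(2,3) q(2,3)] M n assms(4)
  show "n = word_count L r p" by simp
qed

text \<open>The cycle with index \<open>i\<close> consists of the codes of the pairs
  \<open>(i, j)\<close> with \<open>j < x i\<close>, so the cycles are disjoint because the coding
  of pairs is injective.\<close>

lemma ex_cycle_family:
  assumes "finite S" "\<And>i. i \<in> S \<Longrightarrow> 0 < x i"
  shows "\<exists>p (c :: nat \<Rightarrow> nat list). cycle_family p S c \<and> (\<forall>i. length (c i) = x i)"
proof -
  define c where "c = (\<lambda>i. map (\<lambda>j. prod_encode (i, j)) [0..<x i])"
  define p where "p n = (case prod_decode n of (i, j) \<Rightarrow> prod_encode (i, Suc j mod x i))" for n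
  have "map p (c i) = rotate1 (c i)" if "0 < x i" for i
    by (rule nth_equalityI) (use that in \<open>auto simp: c_def p_def nth_rotate1\<close>)
  then have "cycle_family p S c"
    using assms unfolding cycle_family_def is_cycle_def by (auto simp: c_def distinct_map inj_on_def)
  then show ?thesis by (intro exI[of _ p] exI[of _ c]) (simp add: c_def)
qed

lemma cycle_family_update_other:
  assumes "cycle_family p S c" "\<And>i. i \<in> S \<Longrightarrow> d \<notin> set (c i) \<and> y \<notin> set (c i)"
  shows "cycle_family (transpose y d \<circ> p) S c"
  using assms unfolding cycle_family_def by (auto intro: is_cycle_transpose_other)

lemma cycle_family_insert:
  assumes "cycle_family p S c" "is_cycle p v" "i \<notin> S" "\<And>j. j \<in> S \<Longrightarrow> set v \<inter> set (c j) = {}"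
  shows "cycle_family p (insert i S) (c(i := v))"
  using assms unfolding cycle_family_def by auto

text \<open>The letter joins the cycle of \<open>d\<close> with another one. The remaining word
  cannot split with \<open>d\<close> and \<open>y\<close> on different sides, because a side is a
  union of cycles of the new permutation and \<open>d\<close>, \<open>y\<close> share one.\<close>

lemma cycle_count_join_term:
  fixes c :: "nat \<Rightarrow> nat list"
  assumes fam: "cycle_family p (insert k0 S) c" and k0: "k0 \<notin> S" and ck: "c k0 = d # u"
    and i: "i \<in> S" "y \<in> set (c i)"
    and L: "distinct L" "set L = (\<Union>i\<in>insert k0 S. set (c i))"
  shows "word_count L r (transpose y d \<circ> p)
     = cycle_count r (add_mset (length (d # u) + length (c i)) (parts (\<lambda>i. length (c i)) (S - {i})))"
    and "B \<subseteq> set L \<Longrightarrow> d \<in> B \<Longrightarrow> y \<notin> B \<Longrightarrow>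
      mono_sum cut_act L r (separated (set L) B) (transpose y d \<circ> p, UNIV) = 0"
proof -
  let ?q = "transpose y d \<circ> p"
  have cyc: "\<And>i. i \<in> insert k0 S \<Longrightarrow> is_cycle p (c i)" using fam by (auto simp: cycle_family_def)
  have dis: "set (c i) \<inter> set (c j) = {}" if "i \<in> insert k0 S" "j \<in> insert k0 S" "i \<noteq> j" for i j
    using fam that unfolding cycle_family_def by blast
  have fin: "finite S" using fam by (simp add: cycle_family_def)
  obtain v where v: "is_cycle p (y # v)" "set (y # v) = set (c i)" "length (y # v) = length (c i)"
    using is_cycle_rotate_to[OF cyc i(2)] i(1) by blast
  have ik: "i \<noteq> k0" using i k0 by auto
  let ?w = "d # u @ y # v"
  have sw: "set ?w = set (c k0) \<union> set (c i)" using v(2) ck by auto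
  have w: "is_cycle ?q ?w"
    by (rule is_cycle_join) (use cyc[of k0] ck v dis[of k0 i] i ik in auto)
  have rest: "cycle_family ?q (S - {i}) c"
  proof (rule cycle_family_update_other)
    show "cycle_family p (S - {i}) c" by (rule cycle_family_subset[OF fam]) auto
    fix j assume j: "j \<in> S - {i}"
    have "d \<in> set (c k0)" using ck by simp
    moreover have "j \<noteq> k0" using j k0 by auto
    ultimately show "d \<notin> set (c j) \<and> y \<notin> set (c j)" using dis[of k0 j] dis[of i j] i j by blast
  qed
  have dw: "set ?w \<inter> set (c j) = {}" if "j \<in> S - {i}" for j
  proof -
    have "j \<noteq> k0" "j \<noteq> i" using that k0 by auto
    then show ?thesis unfolding sw using dis[of k0 j] dis[of i j] that i by blast
  qed
  have fam': "cycle_family ?q (insert k0 (S - {i})) (c(k0 := ?w))"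
    by (rule cycle_family_insert[OF rest w]) (use k0 dw in auto)
  have "set L = set (c k0) \<union> (\<Union>i\<in>S. set (c i))" using L(2) by simp
  also have "\<dots> = set ?w \<union> (\<Union>j\<in>S - {i}. set (c j))" unfolding sw using i(1) by blast
  also have "\<dots> = (\<Union>j\<in>insert k0 (S - {i}). set ((c(k0 := ?w)) j))"
  proof -
    have "(\<Union>j\<in>S - {i}. set ((c(k0 := ?w)) j)) = (\<Union>j\<in>S - {i}. set (c j))"
      using k0 by (intro SUP_cong) auto
    then show ?thesis by simp
  qed
  finally have sL: "set L = (\<Union>j\<in>insert k0 (S - {i}). set ((c(k0 := ?w)) j))" .
  have "parts (\<lambda>j. length ((c(k0 := ?w)) j)) (insert k0 (S - {i}))
    = add_mset (length ?w) (parts (\<lambda>j. length ((c(k0 := ?w)) j)) (S - {i}))"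
    using fin k0 by simp
  also have "parts (\<lambda>j. length ((c(k0 := ?w)) j)) (S - {i}) = parts (\<lambda>j. length (c j)) (S - {i})"
    by (rule parts_cong) (use k0 in auto)
  finally show "word_count L r ?q = cycle_count r (add_mset (length (d # u) + length (c i)) (parts (\<lambda>i. length (c i)) (S - {i})))"
    using cycle_count_eq[OF fam' L(1) sL refl, of r] v(3)[symmetric] by simp
  show "mono_sum cut_act L r (separated (set L) B) (?q, UNIV) = 0" if B: "B \<subseteq> set L" "d \<in> B" "y \<notin> B"
  proof (rule mono_sum_separated_eq_0[OF _ B(1)])
    show "\<not> ?q ` B \<subseteq> B"
    proof
      assume "?q ` B \<subseteq> B"
      from is_cycle_subset[OF w _ B(2) this] have "set ?w \<subseteq> B" by simp
      then show False using B(3) by simp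
    qed
  qed
qed

text \<open>The letter cuts the cycle of \<open>d\<close>. A set \<open>B\<close> contributes to the
  split words only if it is a union of cycles of the new permutation, so it is the piece of
  \<open>d\<close> together with the cycles of some \<open>I \<subseteq> S\<close>.\<close>

lemma cycle_count_cut_term:
  fixes c :: "nat \<Rightarrow> nat list"
  assumes fam: "cycle_family p (insert k0 S) c" and k0: "k0 \<notin> S" and ck: "c k0 = d # u @ y # v"
    and L: "distinct L" "set L = (\<Union>i\<in>insert k0 S. set (c i))"
  shows "word_count L r (transpose y d \<circ> p)
     = cycle_count r (add_mset (length (d # u)) (add_mset (length (y # v)) (parts (\<lambda>i. length (c i)) S)))"
    and "(\<Sum>B\<in>{B. B \<subseteq> set L \<and> d \<in> B \<and> y \<notin> B}.
        mono_sum cut_act L r (separated (set L) B) (transpose y d \<circ> p, UNIV))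
      = (\<Sum>I\<in>Pow S. \<Sum>q\<le>r. cycle_count q (add_mset (length (d # u)) (parts (\<lambda>i. length (c i)) I))
           * cycle_count (r - q) (add_mset (length (y # v)) (parts (\<lambda>i. length (c i)) (S - I))))"
proof -
  let ?q = "transpose y d \<circ> p"
  have cyc: "\<And>i. i \<in> insert k0 S \<Longrightarrow> is_cycle p (c i)" using fam by (auto simp: cycle_family_def)
  have dis: "set (c i) \<inter> set (c j) = {}" if "i \<in> insert k0 S" "j \<in> insert k0 S" "i \<noteq> j" for i j
    using fam that unfolding cycle_family_def by blast
  have fin: "finite S" using fam by (simp add: cycle_family_def)
  have ck': "set (c k0) = set (d # u) \<union> set (y # v)" "distinct (d # u @ y # v)"
    using cyc[of k0] ck by (auto simp: is_cycle_def)
  have cut: "is_cycle ?q (d # u)" "is_cycle ?q (y # v)"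
    using is_cycle_cut[of p d u y v] cyc[of k0] ck by auto
  have dk: "set (c k0) \<inter> set (c j) = {}" if "j \<in> S" for j
    using dis[of k0 j] that k0 by auto
  have fS: "cycle_family ?q S c"
  proof (rule cycle_family_update_other)
    show "cycle_family p S c" by (rule cycle_family_subset[OF fam]) auto
    show "d \<notin> set (c j) \<and> y \<notin> set (c j)" if "j \<in> S" for j
      using dk[OF that] ck' by auto
  qed
  \<comment> \<open>When both pieces belong to one family, \<open>k0\<close> is the index of the
    piece of \<open>d\<close> and the fresh \<open>e\<close> that of the piece of \<open>y\<close>.
    In a split word they lie in different families and can both use \<open>k0\<close>.\<close>
  obtain e where e: "e \<notin> insert k0 S" using fin by (metis ex_new_if_finite finite_insert infinite_UNIV_nat)
  let ?c1 = "c(k0 := d # u)" and ?c2 = "c(k0 := y # v)" and ?c = "c(k0 := d # u, e := y # v)"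
  have f1: "cycle_family ?q (insert k0 I) ?c1" if "I \<subseteq> S" for I
    by (rule cycle_family_insert[OF cycle_family_subset[OF fS that] cut(1)])
      (use that k0 dk ck' in auto)
  have f2: "cycle_family ?q (insert k0 I) ?c2" if "I \<subseteq> S" for I
    by (rule cycle_family_insert[OF cycle_family_subset[OF fS that] cut(2)])
      (use that k0 dk ck' in auto)
  have f: "cycle_family ?q (insert e (insert k0 S)) ?c"
  proof (rule cycle_family_insert[OF f1 cut(2) e])
    fix j assume "j \<in> insert k0 S"
    then show "set (y # v) \<inter> set (?c1 j) = {}"
    proof
      assume "j = k0" then show ?thesis using ck'(2) by auto
    next
      assume "j \<in> S" then show ?thesis using dk[of j] ck'(1) k0 by auto
    qed
  qed simp
  have pS: "parts (\<lambda>j. length (?c j)) S = parts (\<lambda>j. length (c j)) S"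
    by (rule parts_cong) (use k0 e in auto)
  have pI: "parts (\<lambda>j. length (?c1 j)) I = parts (\<lambda>j. length (c j)) I"
    "parts (\<lambda>j. length (?c2 j)) I = parts (\<lambda>j. length (c j)) I" if "I \<subseteq> S" for I
    by (rule parts_cong; use k0 that in auto)+
  have cS: "?c j = c j" if "j \<in> S" for j using that k0 e by auto
  have "(\<Union>j\<in>insert e (insert k0 S). set (?c j)) = set (y # v) \<union> (set (d # u) \<union> (\<Union>j\<in>S. set (c j)))"
    using e cS by simp
  also have "\<dots> = set L" unfolding L(2) using ck'(1) by auto
  finally have sL: "set L = (\<Union>j\<in>insert e (insert k0 S). set (?c j))" by simp
  have "parts (\<lambda>j. length (?c j)) (insert e (insert k0 S))
     = add_mset (length (y # v)) (add_mset (length (d # u)) (parts (\<lambda>j. length (?c j)) S))"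
    using fin k0 e by simp
  then show "word_count L r ?q = cycle_count r (add_mset (length (d # u)) (add_mset (length (y # v)) (parts (\<lambda>i. length (c i)) S)))"
    unfolding pS using cycle_count_eq[OF f L(1) sL refl, of r] by (simp add: add_mset_commute)
  let ?X = "{B. B \<subseteq> set L \<and> d \<in> B \<and> y \<notin> B}"
  let ?U = "\<lambda>I. \<Union>j\<in>I. set (c j)"
  let ?G = "\<lambda>I. set (d # u) \<union> ?U I"
  let ?F = "\<lambda>B. mono_sum cut_act L r (separated (set L) B) (?q, UNIV)"
  have Lk: "set L = set (d # u) \<union> set (y # v) \<union> ?U S" using L(2) ck'(1) by auto
  have G: "?G I \<in> ?X" if "I \<subseteq> S" for I
    using that Lk dk ck' by auto
  have comp: "set L - ?G I = set (y # v) \<union> ?U (S - I)" if I: "I \<subseteq> S" for I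
  proof -
    have "?U S - ?U I = ?U (S - I)" using I dis by blast
    moreover have "set (y # v) \<inter> ?U I = {}" "set (d # u) \<inter> ?U (S - I) = {}" "set (d # u) \<inter> set (y # v) = {}"
      using I dk ck' by auto
    moreover have "D \<union> Y \<union> V - (D \<union> W) = Y \<union> W'" if "V - W = W'" "Y \<inter> W = {}" "D \<inter> W' = {}" "D \<inter> Y = {}"
      for D Y V W W' :: "nat set" using that by blast
    ultimately show ?thesis unfolding Lk by presburger
  qed
  have inj: "inj_on ?G (Pow S)"
  proof (rule inj_onI)
    fix I J assume IJ: "I \<in> Pow S" "J \<in> Pow S" "?G I = ?G J"
    have "I' \<subseteq> J'" if I': "I' \<subseteq> S" "J' \<subseteq> S" "?G I' = ?G J'" for I' J'
    proof
      fix i assume i: "i \<in> I'"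
      then have "i \<in> S" using I' by auto
      then have "c i \<noteq> []" using cyc[of i] by (auto simp: is_cycle_def)
      then obtain x where x: "x \<in> set (c i)" by (cases "c i") auto
      then have "x \<in> ?G J'" using I'(3) i by blast
      moreover have "x \<notin> set (d # u)" using dk[OF \<open>i \<in> S\<close>] x ck' by auto
      ultimately obtain j where "j \<in> J'" "x \<in> set (c j)" by blast
      then have "i = j" using dis[of i j] x \<open>i \<in> S\<close> I'(2) by blast
      then show "i \<in> J'" using \<open>j \<in> J'\<close> by simp
    qed
    from this[OF _ _ IJ(3)] this[OF _ _ IJ(3)[symmetric]] show "I = J" using IJ(1,2) by blast
  qed
  have zero: "?F B = 0" if B: "B \<in> ?X - ?G ` Pow S" for B
  proof (rule mono_sum_separated_eq_0)
    show "B \<subseteq> set L" using B by auto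
    show "\<not> ?q ` B \<subseteq> B"
    proof
      assume inv: "?q ` B \<subseteq> B"
      define I where "I = {i \<in> S. set (c i) \<inter> B \<noteq> {}}"
      have qc: "is_cycle ?q (c i)" if "i \<in> S" for i using fS that by (auto simp: cycle_family_def)
      have 1: "set (d # u) \<subseteq> B" using is_cycle_subset[OF cut(1) _ _ inv, of d] B by auto
      have 2: "set (y # v) \<inter> B = {}"
      proof (rule ccontr)
        assume "set (y # v) \<inter> B \<noteq> {}"
        then obtain x where "x \<in> set (y # v)" "x \<in> B" by blast
        from is_cycle_subset[OF cut(2) this inv] B show False by auto
      qed
      have 3: "set (c i) \<subseteq> B" if iI: "i \<in> I" for i
      proof -
        have iS: "i \<in> S" using iI by (simp add: I_def)
        obtain x where x: "x \<in> set (c i)" "x \<in> B" using iI unfolding I_def by blast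
        from is_cycle_subset[OF qc[OF iS] x inv] show ?thesis .
      qed
      have "B = ?G I"
      proof
        show "?G I \<subseteq> B" by (intro Un_least UN_least 1 3)
        show "B \<subseteq> ?G I"
        proof
          fix x assume x: "x \<in> B"
          then have "x \<in> set L" using B by blast
          then consider "x \<in> set (d # u)" | "x \<in> set (y # v)" | i where "i \<in> S" "x \<in> set (c i)"
            unfolding Lk by blast
          then show "x \<in> ?G I"
          proof cases
            case 3
            then have "i \<in> I" using x unfolding I_def by blast
            then show ?thesis using 3 by blast
          qed (use x 2 in blast)+
        qed
      qed
      moreover have "I \<in> Pow S" by (auto simp: I_def)
      ultimately show False using B by blast
    qed
  qed
  have main: "?F (?G I) = (\<Sum>q\<le>r. cycle_count q (add_mset (length (d # u)) (parts (\<lambda>i. length (c i)) I))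
           * cycle_count (r - q) (add_mset (length (y # v)) (parts (\<lambda>i. length (c i)) (S - I))))" if I: "I \<subseteq> S" for I
  proof -
    have "(\<Union>j\<in>I. set (?c1 j)) = ?U I" "(\<Union>j\<in>S - I. set (?c2 j)) = ?U (S - I)"
      by (intro SUP_cong refl; use I k0 in auto)+
    then have u1: "?G I = (\<Union>j\<in>insert k0 I. set (?c1 j))"
      and u2: "set L - ?G I = (\<Union>j\<in>insert k0 (S - I). set (?c2 j))" unfolding comp[OF I] by simp_all
    have s1: "set (filter (\<lambda>x. x \<in> ?G I) L) = (\<Union>j\<in>insert k0 I. set (?c1 j))"
      unfolding u1[symmetric] using G[OF I] by auto
    have s2: "set (filter (\<lambda>x. x \<notin> ?G I) L) = (\<Union>j\<in>insert k0 (S - I). set (?c2 j))"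
      using u2 by (metis set_diff_eq set_filter)
    have finI: "finite I" "k0 \<notin> I" using I fin k0 by (auto intro: finite_subset)
    have p1: "parts (\<lambda>j. length (?c1 j)) (insert k0 I) = add_mset (length (d # u)) (parts (\<lambda>i. length (c i)) I)"
      using finI pI(1)[OF I] by simp
    have p2: "parts (\<lambda>j. length (?c2 j)) (insert k0 (S - I)) = add_mset (length (y # v)) (parts (\<lambda>i. length (c i)) (S - I))"
      using fin k0 pI(2)[of "S - I"] by simp
    have w1: "word_count (filter (\<lambda>x. x \<in> ?G I) L) q ?q = cycle_count q (add_mset (length (d # u)) (parts (\<lambda>i. length (c i)) I))" for q
      by (rule cycle_count_eq[symmetric, OF f1[OF I] _ s1 p1]) (use L in simp)
    have w2: "word_count (filter (\<lambda>x. x \<notin> ?G I) L) q ?q = cycle_count q (add_mset (length (y # v)) (parts (\<lambda>i. length (c i)) (S - I)))" for q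
      by (rule cycle_count_eq[symmetric, OF f2 _ s2 p2]) (use L in auto)
    have "?F (?G I) = (\<Sum>q\<le>r. word_count (filter (\<lambda>x. x \<in> ?G I) L) q ?q * word_count (filter (\<lambda>x. x \<notin> ?G I) L) (r - q) ?q)"
    proof (rule mono_sum_separated)
      show "?q ` ?G I \<subseteq> ?G I" unfolding u1 by (rule cycle_family_closed[OF f1[OF I]])
      show "?q ` (set L - ?G I) \<subseteq> set L - ?G I" unfolding u2 by (rule cycle_family_closed[OF f2]) auto
      show "?G I \<subseteq> set L" using G[OF I] by simp
    qed
    then show ?thesis unfolding w1 w2 .
  qed
  have finX: "finite ?X" by (rule finite_subset[of _ "Pow (set L)"]) auto
  have "(\<Sum>B\<in>?X. ?F B) = (\<Sum>B\<in>?G ` Pow S. ?F B)"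
  proof (rule sum.mono_neutral_right[OF finX])
    show "?G ` Pow S \<subseteq> ?X" by (rule image_subsetI, rule G) simp
    show "\<forall>B\<in>?X - ?G ` Pow S. ?F B = 0" using zero by (rule ballI)
  qed
  also have "\<dots> = (\<Sum>I\<in>Pow S. ?F (?G I))"
    by (subst sum.reindex[OF inj]) simp
  also have "\<dots> = (\<Sum>I\<in>Pow S. \<Sum>q\<le>r. cycle_count q (add_mset (length (d # u)) (parts (\<lambda>i. length (c i)) I))
           * cycle_count (r - q) (add_mset (length (y # v)) (parts (\<lambda>i. length (c i)) (S - I))))"
    by (rule sum.cong[OF refl], rule main) simp
  finally show "(\<Sum>B\<in>?X. ?F B) = (\<Sum>I\<in>Pow S. \<Sum>q\<le>r. cycle_count q (add_mset (length (d # u)) (parts (\<lambda>i. length (c i)) I))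
           * cycle_count (r - q) (add_mset (length (y # v)) (parts (\<lambda>i. length (c i)) (S - I))))" .
qed

text \<open>Since the count does not depend on the order of the list, \<open>d\<close> may be chosen
  in the cycle of length \<open>k\<close> and placed first. Its partner is either one of the
  \<open>x i\<close> entries of another cycle, or the entry of its own cycle at distance
  \<open>a\<close>, which cuts it into pieces of lengths \<open>a\<close> and
  \<open>k - a\<close>.\<close>

lemma cycle_count_Suc:
  fixes S :: "nat set"
  assumes S: "finite S" "\<And>i. i \<in> S \<Longrightarrow> 0 < x i" and k: "0 < k"
  shows "cycle_count (Suc r) (add_mset k (parts x S))
    = (\<Sum>i\<in>S. int (x i) * cycle_count r (add_mset (k + x i) (parts x (S - {i}))))
    + (\<Sum>a\<in>{1..<k}. cycle_count r (add_mset a (add_mset (k - a) (parts x S)))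
       + (\<Sum>I\<in>Pow S. \<Sum>q\<le>r. cycle_count q (add_mset a (parts x I)) * cycle_count (r - q) (add_mset (k - a) (parts x (S - I)))))"
proof -
  obtain k0 where k0: "k0 \<notin> S" using S(1) by (metis ex_new_if_finite infinite_UNIV_nat)
  have pos: "\<And>i. i \<in> insert k0 S \<Longrightarrow> 0 < (x(k0 := k)) i" using S(2) k by auto
  have "finite (insert k0 S)" using S(1) by simp
  then have "\<exists>p (c :: nat \<Rightarrow> nat list). cycle_family p (insert k0 S) c \<and> (\<forall>i. length (c i) = (x(k0 := k)) i)"
    by (rule ex_cycle_family) (rule pos)
  then   obtain p and c :: "nat \<Rightarrow> nat list" where fam: "cycle_family p (insert k0 S) c" and len: "\<forall>i. length (c i) = (x(k0 := k)) i"
    by (elim exE conjE) (rule that)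
  have lenS: "length (c i) = x i" if "i \<in> S" for i using len that k0 by auto
  have lk: "length (c k0) = k" using len by simp
  then obtain d u where ck: "c k0 = d # u" using k by (cases "c k0") auto
  have cyc: "\<And>i. i \<in> insert k0 S \<Longrightarrow> is_cycle p (c i)" using fam by (auto simp: cycle_family_def)
  have dis: "set (c i) \<inter> set (c j) = {}" if "i \<in> insert k0 S" "j \<in> insert k0 S" "i \<noteq> j" for i j
    using fam that unfolding cycle_family_def by blast
  have dk: "set (c k0) \<inter> set (c j) = {}" if "j \<in> S" for j
    using dis[of k0 j] that k0 by auto
  have du: "distinct (d # u)" using cyc[of k0] ck by (auto simp: is_cycle_def)
  let ?R = "\<Union>i\<in>S. set (c i)"
  define ts where "ts = u @ sorted_list_of_set ?R"
  let ?L = "d # ts"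
  have setR: "set (sorted_list_of_set ?R) = ?R" using S(1) by simp
  have ds: "set (d # u) \<inter> ?R = {}" using dk unfolding ck by blast
  have L: "distinct ?L" "set ?L = (\<Union>i\<in>insert k0 S. set (c i))"
    unfolding ts_def using du ds setR ck by auto
  have px: "parts (\<lambda>i. length (c i)) I = parts x I" if "I \<subseteq> S" for I
    by (rule parts_cong) (use lenS that in auto)
  have parts: "parts (\<lambda>i. length (c i)) (insert k0 S) = add_mset k (parts x S)"
    using S(1) k0 lk px[of S] by simp
  define T where "T y = word_count ?L r (transpose y d \<circ> p) + (\<Sum>B\<in>{B. B \<subseteq> set ?L \<and> d \<in> B \<and> y \<notin> B}.
      mono_sum cut_act ?L r (separated (set ?L) B) (transpose y d \<circ> p, UNIV))" for y
  define Q where "Q a = cycle_count r (add_mset a (add_mset (k - a) (parts x S)))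
       + (\<Sum>I\<in>Pow S. \<Sum>q\<le>r. cycle_count q (add_mset a (parts x I)) * cycle_count (r - q) (add_mset (k - a) (parts x (S - I))))" for a
  have join: "T y = cycle_count r (add_mset (k + x i) (parts x (S - {i})))" if "i \<in> S" "y \<in> set (c i)" for i y
  proof -
    have "(\<Sum>B\<in>{B. B \<subseteq> set ?L \<and> d \<in> B \<and> y \<notin> B}.
      mono_sum cut_act ?L r (separated (set ?L) B) (transpose y d \<circ> p, UNIV)) = 0"
      using cycle_count_join_term(2)[OF fam k0 ck that L] by (intro sum.neutral) auto
    then show ?thesis
      using cycle_count_join_term(1)[OF fam k0 ck that L, of r] lenS[OF that(1)] lk ck px[of "S - {i}"]
      unfolding T_def by auto
  qed
  have cut: "T (u ! j) = Q (Suc j)" if j: "j < length u" for j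
  proof -
    have "u = take j u @ u ! j # drop (Suc j) u" using j by (rule id_take_nth_drop)
    then have ck': "c k0 = d # take j u @ u ! j # drop (Suc j) u" using ck by simp
    have l: "length (d # take j u) = Suc j" "length (u ! j # drop (Suc j) u) = k - Suc j"
      using j lk ck by auto
    have "parts (\<lambda>i. length (c i)) (S - I) = parts x (S - I)" for I by (rule px) auto
    then show ?thesis
      unfolding T_def Q_def cycle_count_cut_term[OF fam k0 ck' L] l
      using px by (auto intro!: sum.cong)
  qed
  have "cycle_count (Suc r) (add_mset k (parts x S)) = word_count ?L (Suc r) p"
    by (rule cycle_count_eq[OF fam L parts])
  also have "\<dots> = (\<Sum>y\<in>set ts. T y)"
    unfolding T_def by (rule word_count_Cons_Suc[OF L(1)])
  also have "\<dots> = (\<Sum>y\<in>?R. T y) + (\<Sum>y\<in>set u. T y)"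
    unfolding ts_def set_append setR by (subst Un_commute, rule sum.union_disjoint) (use S(1) ds in auto)
  also have "(\<Sum>y\<in>?R. T y) = (\<Sum>i\<in>S. \<Sum>y\<in>set (c i). T y)"
    by (rule sum.UNION_disjoint) (use S(1) dis in auto)
  also have "\<dots> = (\<Sum>i\<in>S. int (x i) * cycle_count r (add_mset (k + x i) (parts x (S - {i}))))"
  proof (rule sum.cong[OF refl])
    fix i assume i: "i \<in> S"
    have "card (set (c i)) = x i" using cyc[of i] i lenS[OF i] by (simp add: is_cycle_def distinct_card)
    then show "(\<Sum>y\<in>set (c i). T y) = int (x i) * cycle_count r (add_mset (k + x i) (parts x (S - {i})))"
      using join[OF i] by simp
  qed
  also have "(\<Sum>y\<in>set u. T y) = (\<Sum>j<length u. T (u ! j))"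
    by (rule sum.reindex_bij_betw[symmetric], rule bij_betw_nth) (use du in auto)
  also have "\<dots> = (\<Sum>j<length u. Q (Suc j))"
    using cut by (intro sum.cong) auto
  also have "\<dots> = (\<Sum>a\<in>{1..<k}. Q a)"
  proof -
    have "k = Suc (length u)" using lk ck by simp
    then show ?thesis by (simp only: One_nat_def sum.shift_bounds_Suc_ivl lessThan_atLeast0)
  qed
  finally show ?thesis unfolding Q_def .
qed

text \<open>Before the first letter every set belongs to the family, in particular every singleton,
  so only a single point is connected.\<close>

lemma cycle_count_0:
  fixes S :: "nat set"
  assumes S: "finite S" "\<And>i. i \<in> S \<Longrightarrow> 0 < x i" and k: "0 < k"
  shows "cycle_count 0 (add_mset k (parts x S)) = of_bool (k = 1 \<and> S = {})"
proof -
  obtain k0 where k0: "k0 \<notin> S" using S(1) by (metis ex_new_if_finite infinite_UNIV_nat)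
  have pos: "\<And>i. i \<in> insert k0 S \<Longrightarrow> 0 < (x(k0 := k)) i" using S(2) k by auto
  have "finite (insert k0 S)" using S(1) by simp
  then have "\<exists>p (c :: nat \<Rightarrow> nat list). cycle_family p (insert k0 S) c \<and> (\<forall>i. length (c i) = (x(k0 := k)) i)"
    by (rule ex_cycle_family) (rule pos)
  then   obtain p and c :: "nat \<Rightarrow> nat list" where fam: "cycle_family p (insert k0 S) c" and len: "\<forall>i. length (c i) = (x(k0 := k)) i"
    by (elim exE conjE) (rule that)
  let ?A = "\<Union>i\<in>insert k0 S. set (c i)"
  have lenS: "length (c i) = x i" if "i \<in> S" for i using len that k0 by auto
  have lk: "length (c k0) = k" using len by simp
  have parts: "parts (\<lambda>i. length (c i)) (insert k0 S) = add_mset k (parts x S)"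
    using S(1) k0 lk parts_cong[of S "\<lambda>i. length (c i)" x] lenS by simp
  obtain L where L: "distinct L" "set L = ?A" using S(1) by (metis finite_UN finite_distinct_list finite_insert List.finite_set)
  have "cycle_count 0 (add_mset k (parts x S)) = word_count L 0 p"
    by (rule cycle_count_eq[OF fam L parts])
  also have "\<dots> = of_bool ((\<forall>x\<in>?A. p x = x) \<and> indecomposable ?A UNIV)"
    by (simp add: word_count_def final_state_def L(2))
  also have "((\<forall>x\<in>?A. p x = x) \<and> indecomposable ?A UNIV) \<longleftrightarrow> k = 1 \<and> S = {}"
  proof
    assume l: "(\<forall>x\<in>?A. p x = x) \<and> indecomposable ?A UNIV"
    obtain d u where ck: "c k0 = d # u" using lk k by (cases "c k0") auto
    have sub: "?A \<subseteq> {d}"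
    proof -
      from l have "indecomposable ?A UNIV" by (rule conjunct2)
      from bspec[OF this[unfolded indecomposable_def] UNIV_I, of "{d}"]
      have "?A \<subseteq> {d} \<or> ?A \<inter> {d} = {}" .
      moreover have "d \<in> ?A" using ck by auto
      ultimately show ?thesis by blast
    qed
    have "set (c k0) \<subseteq> {d}" "distinct (c k0)" using sub fam by (auto simp: cycle_family_def is_cycle_def)
    then have "u = []" using ck by (cases u) auto
    then have "k = 1" using lk ck by simp
    moreover have "S = {}"
    proof (rule ccontr)
      assume "S \<noteq> {}"
      then obtain i where i: "i \<in> S" by blast
      then obtain z where "z \<in> set (c i)" using S(2) lenS by (metis length_pos_if_in_set list.set_sel(1) length_greater_0_conv)
      then have "z = d" using sub i by blast
      have "i \<noteq> k0" using i k0 by auto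
      then have "set (c i) \<inter> set (c k0) = {}" using fam i by (simp add: cycle_family_def)
      then show False using \<open>z \<in> set (c i)\<close> \<open>z = d\<close> ck by simp
    qed
    ultimately show "k = 1 \<and> S = {}" by simp
  next
    assume r: "k = 1 \<and> S = {}"
    then obtain d where ck: "c k0 = [d]" using lk by (cases "c k0") auto
    have "p d = d" using fam ck by (simp add: cycle_family_def is_cycle_def)
    moreover have "?A = {d}" using r ck by simp
    moreover have "indecomposable {d} UNIV" by (simp add: indecomposable_def)
    ultimately show "(\<forall>x\<in>?A. p x = x) \<and> indecomposable ?A UNIV" by simp
  qed
  finally show ?thesis .
qed

section \<open>The number of permutations of a given cycle type\<close>

text \<open>\<open>cycle_type\<close> relative to an arbitrary set, so that cycles can be removed
  one at a time.\<close>

definition type_on :: "('a \<Rightarrow> 'a) \<Rightarrow> 'a set \<Rightarrow> nat multiset" where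
  "type_on p A = image_mset card (mset_set (Orbits.orbit p ` A))"

lemma orbit_closed_subset:
  assumes "x \<in> B" "p ` B \<subseteq> B"
  shows "Orbits.orbit p x \<subseteq> B"
proof
  fix y assume "y \<in> Orbits.orbit p x"
  then show "y \<in> B" by induction (use assms in auto)
qed

lemma orbit_is_cycle:
  assumes "permutation p" "is_cycle p c" "x \<in> set c"
  shows "Orbits.orbit p x = set c"
proof
  show "Orbits.orbit p x \<subseteq> set c"
    using orbit_closed_subset[OF assms(3)] is_cycle_closed[OF assms(2)] by blast
  show "set c \<subseteq> Orbits.orbit p x"
    by (rule is_cycle_subset[OF assms(2,3)])
      (use permutation_self_in_orbit[OF assms(1)] in \<open>auto intro: orbit.step\<close>)
qed

lemma is_cycle_support: "permutation p \<Longrightarrow> is_cycle p (support p x)"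
proof -
  assume p: "permutation p"
  let ?n = "least_power p x"
  have n: "(p ^^ ?n) x = x" "0 < ?n" using least_power_of_permutation[OF p] by auto
  have "map p (support p x) = rotate1 (support p x)"
  proof (rule nth_equalityI)
    fix i assume "i < length (map p (support p x))"
    then have i: "i < ?n" by simp
    have "(p ^^ Suc i) x = (p ^^ (Suc i mod ?n)) x"
    proof (cases "Suc i = ?n")
      case False
      then show ?thesis using i by simp
    next
      case True
      then show ?thesis using n(1) by (metis funpow_0 mod_self)
    qed
    then show "map p (support p x) ! i = rotate1 (support p x) ! i"
      using i n(2) by (simp add: nth_rotate1)
  qed simp
  then show ?thesis using cycle_of_permutation[OF p, of x] n(2) by (simp add: is_cycle_def)
qed

lemma is_cycle_nth_funpow:
  assumes "is_cycle p c" "j < length c"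
  shows "c ! j = (p ^^ j) (hd c)"
  using assms(2)
proof (induction j)
  case 0
  then show ?case using assms(1) by (simp add: is_cycle_def hd_conv_nth)
next
  case (Suc j)
  then show ?case using is_cycle_nth[OF assms(1), of j] by simp
qed

lemma is_cycle_unique:
  assumes "permutation p" "is_cycle p c" "is_cycle p c'" "hd c = hd c'"
  shows "c = c'"
proof (rule nth_equalityI)
  have "set c = set c'"
    using orbit_is_cycle[OF assms(1,2), of "hd c"] orbit_is_cycle[OF assms(1,3), of "hd c'"] assms
      hd_in_set[of c] hd_in_set[of c'] by (simp add: is_cycle_def)
  then show l: "length c = length c'"
    using assms(2,3) by (simp add: is_cycle_def distinct_card[symmetric])
  show "c ! i = c' ! i" if "i < length c" for i
    using is_cycle_nth_funpow[OF assms(2) that] is_cycle_nth_funpow[OF assms(3), of i] that l assms(4) by simp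
qed

lemma type_on_remove:
  assumes p: "permutation p" "finite A" "p ` A \<subseteq> A" and c: "is_cycle p c" "set c \<subseteq> A"
  shows "type_on p A = add_mset (length c) (type_on p (A - set c))"
proof -
  obtain x where x: "x \<in> set c" using c(1) by (metis is_cycle_def list.set_sel(1))
  have "Orbits.orbit p ` set c = {set c}"
    using orbit_is_cycle[OF p(1) c(1)] x by auto
  moreover have "A = set c \<union> (A - set c)" using c(2) by blast
  ultimately have "Orbits.orbit p ` A = insert (set c) (Orbits.orbit p ` (A - set c))"
    by (metis image_Un insert_is_Un)
  moreover have "set c \<notin> Orbits.orbit p ` (A - set c)"
  proof
    assume "set c \<in> Orbits.orbit p ` (A - set c)"
    then obtain y where "y \<notin> set c" "set c = Orbits.orbit p y" by blast
    then show False using permutation_self_in_orbit[OF p(1), of y] by simp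
  qed
  ultimately show ?thesis
    unfolding type_on_def using p(2) c(1) by (simp add: is_cycle_def distinct_card)
qed

lemma closed_minus_cycle:
  assumes p: "permutation p" "p ` A \<subseteq> A" and c: "is_cycle p c"
  shows "p ` (A - set c) \<subseteq> A - set c"
proof -
  have "p x \<notin> set c" if "x \<notin> set c" for x
  proof
    assume px: "p x \<in> set c"
    have "set c = Orbits.orbit p (p x)" using orbit_is_cycle[OF p(1) c px] by simp
    also have "\<dots> = Orbits.orbit p x"
      by (rule orbit_cyclic_eq3[OF cyclic_on_orbit'[OF p(1)] orbit.base])
    finally show False using that permutation_self_in_orbit[OF p(1), of x] by simp
  qed
  then show ?thesis using p(2) by blast
qed

text \<open>Each cycle comes with a first entry, and the cycles are listed in the order of
  \<open>\<alpha>\<close>. The \<open>aut_card \<alpha>\<close> arrangements of cycles of equal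
  length and the \<open>prod_list \<alpha>\<close> choices of first entries give the centralizer
  order as the number of these lists.\<close>

definition cycle_lists :: "('a \<Rightarrow> 'a) \<Rightarrow> 'a set \<Rightarrow> nat list \<Rightarrow> 'a list list set" where
  "cycle_lists p A \<alpha> = {cs. map length cs = \<alpha> \<and> distinct (concat cs) \<and> set (concat cs) = A \<and>
     (\<forall>c\<in>set cs. is_cycle p c)}"

lemma cycle_lists_Cons:
  "cycle_lists p A (a # \<alpha>) =
     (\<Union>c\<in>{c. is_cycle p c \<and> length c = a \<and> set c \<subseteq> A}. (#) c ` cycle_lists p (A - set c) \<alpha>)"
proof (intro Set.set_eqI iffI)
  fix cs assume "cs \<in> cycle_lists p A (a # \<alpha>)"
  then show "cs \<in> (\<Union>c\<in>{c. is_cycle p c \<and> length c = a \<and> set c \<subseteq> A}. (#) c ` cycle_lists p (A - set c) \<alpha>)"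
    by (cases cs) (auto simp: cycle_lists_def)
next
  fix cs assume "cs \<in> (\<Union>c\<in>{c. is_cycle p c \<and> length c = a \<and> set c \<subseteq> A}. (#) c ` cycle_lists p (A - set c) \<alpha>)"
  then obtain c cs' where c: "is_cycle p c" "length c = a" "set c \<subseteq> A" "cs = c # cs'"
    and cs': "cs' \<in> cycle_lists p (A - set c) \<alpha>" by blast
  have u: "set (concat cs') = A - set c" using cs' by (simp add: cycle_lists_def)
  then have "set (concat cs) = A" "set c \<inter> set (concat cs') = {}" using c by auto
  then show "cs \<in> cycle_lists p A (a # \<alpha>)"
    using c cs' by (simp add: cycle_lists_def is_cycle_def)
qed

lemma type_on_cycle_lists:
  assumes "permutation p"
  shows "finite A \<Longrightarrow> p ` A \<subseteq> A \<Longrightarrow> cs \<in> cycle_lists p A \<alpha> \<Longrightarrow> type_on p A = mset \<alpha>"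
proof (induction \<alpha> arbitrary: A cs)
  case Nil
  then have "A = {}" by (auto simp: cycle_lists_def)
  then show ?case by (simp add: type_on_def)
next
  case (Cons a \<alpha>)
  then obtain c cs' where c: "is_cycle p c" "length c = a" "set c \<subseteq> A" "cs' \<in> cycle_lists p (A - set c) \<alpha>"
    unfolding cycle_lists_Cons by blast
  have "type_on p (A - set c) = mset \<alpha>"
    by (rule Cons.IH[OF _ closed_minus_cycle[OF assms Cons.prems(2) c(1)] c(4)]) (use Cons.prems in auto)
  then show ?case using type_on_remove[OF assms Cons.prems(1,2) c(1,3)] c(2) by simp
qed

text \<open>A cycle of \<open>p\<close> is determined by its head, which can be any point of an
  orbit of size \<open>a\<close>; there are \<open>count (type_on p A) a\<close> such
  orbits.\<close>

lemma card_cycles: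
  assumes p: "permutation p" and A: "finite A" "p ` A \<subseteq> A"
  shows "finite {c. is_cycle p c \<and> length c = a \<and> set c \<subseteq> A}"
    and "card {c. is_cycle p c \<and> length c = a \<and> set c \<subseteq> A} = a * count (type_on p A) a"
proof -
  let ?C = "{c. is_cycle p c \<and> length c = a \<and> set c \<subseteq> A}"
  let ?X = "{x \<in> A. card (Orbits.orbit p x) = a}"
  let ?O = "{B \<in> Orbits.orbit p ` A. card B = a}"
  have "bij_betw hd ?C ?X"
    unfolding bij_betw_def
  proof
    show "inj_on hd ?C" using is_cycle_unique[OF p] by (auto intro!: inj_onI)
    show "hd ` ?C = ?X"
    proof (intro Set.set_eqI iffI)
      fix x assume "x \<in> hd ` ?C"
      then obtain c where c: "is_cycle p c" "length c = a" "set c \<subseteq> A" "x = hd c" by blast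
      then have x: "x \<in> set c" by (simp add: is_cycle_def)
      then have "card (Orbits.orbit p x) = a"
        using orbit_is_cycle[OF p c(1) x] c by (simp add: is_cycle_def distinct_card)
      then show "x \<in> ?X" using x c by blast
    next
      fix x assume x: "x \<in> ?X"
      let ?c = "support p x"
      have c: "is_cycle p ?c" by (rule is_cycle_support[OF p])
      have hd: "hd ?c = x" using c by (simp add: is_cycle_def hd_map)
      then have "x \<in> set ?c" using c by (metis is_cycle_def list.set_sel(1))
      then have o: "Orbits.orbit p x = set ?c" by (rule orbit_is_cycle[OF p c])
      have "set ?c \<subseteq> A" unfolding o[symmetric] by (rule orbit_closed_subset) (use x A in auto)
      moreover have "length ?c = a" using x o c by (metis (mono_tags, lifting) distinct_card is_cycle_def mem_Collect_eq)
      ultimately show "x \<in> hd ` ?C" using c hd by (intro image_eqI[of _ _ ?c]) auto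
    qed
  qed
  moreover have finX: "finite ?X" using A by simp
  ultimately have finC: "finite ?C" and cC: "card ?C = card ?X"
    using bij_betw_finite bij_betw_same_card by blast+
  from finC show "finite ?C" .
  have osub: "Orbits.orbit p x \<subseteq> A" if "x \<in> A" for x using orbit_closed_subset[OF that A(2)] .
  have oeq: "Orbits.orbit p y = Orbits.orbit p x" if "y \<in> Orbits.orbit p x" for x y
    by (rule orbit_cyclic_eq3[OF cyclic_on_orbit'[OF p] that])
  have X: "?X = \<Union>?O"
  proof (intro Set.set_eqI iffI)
    fix x assume "x \<in> ?X"
    then show "x \<in> \<Union>?O" using permutation_self_in_orbit[OF p] by blast
  next
    fix x assume "x \<in> \<Union>?O"
    then obtain z where z: "z \<in> A" "card (Orbits.orbit p z) = a" "x \<in> Orbits.orbit p z" by blast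
    then show "x \<in> ?X" using osub[OF z(1)] oeq[OF z(3)] by auto
  qed
  have "card (\<Union>?O) = (\<Sum>B\<in>?O. card B)"
  proof (rule card_Union_disjoint)
    show "pairwise disjnt ?O"
    proof (rule pairwiseI)
      fix B B' assume "B \<in> ?O" "B' \<in> ?O" "B \<noteq> B'"
      then obtain x y where xy: "B = Orbits.orbit p x" "B' = Orbits.orbit p y" "B \<noteq> B'" by blast
      have False if "z \<in> B" "z \<in> B'" for z
        using oeq[of z x] oeq[of z y] that xy by simp
      then show "disjnt B B'" unfolding disjnt_def by blast
    qed
    show "\<And>B. B \<in> ?O \<Longrightarrow> finite B" using osub A by (auto intro: finite_subset)
  qed
  also have "\<dots> = a * card ?O" by simp
  also have "card ?O = count (type_on p A) a"
  proof -
    have "count (type_on p A) a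
      = (\<Sum>B\<in>card -` {a} \<inter> Orbits.orbit p ` A. count (mset_set (Orbits.orbit p ` A)) B)"
      using A by (simp add: type_on_def count_image_mset)
    also have "\<dots> = (\<Sum>B\<in>card -` {a} \<inter> Orbits.orbit p ` A. 1)"
      by (rule sum.cong) (use A in auto)
    also have "\<dots> = card ?O" by (simp add: vimage_def Int_def conj_commute)
    finally show ?thesis by simp
  qed
  finally show "card ?C = a * count (type_on p A) a" unfolding cC X .
qed

lemma aut_card_Cons: "aut_card (a # \<alpha>) = Suc (count_list \<alpha> a) * aut_card \<alpha>"
proof -
  let ?f = "\<lambda>\<beta> k. fact (count_list \<beta> k) :: nat"
  have ext: "aut_card \<beta> = (\<Prod>k\<in>X. ?f \<beta> k)" if "set \<beta> \<subseteq> X" "finite X" for \<beta> X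
    unfolding aut_card_def using that by (intro prod.mono_neutral_left) (auto simp: count_list_0_iff)
  have "aut_card (a # \<alpha>) = (\<Prod>k\<in>insert a (set \<alpha>). ?f (a # \<alpha>) k)"
    by (rule ext) auto
  also have "\<dots> = ?f (a # \<alpha>) a * (\<Prod>k\<in>insert a (set \<alpha>) - {a}. ?f (a # \<alpha>) k)"
    by (rule prod.remove) auto
  also have "(\<Prod>k\<in>insert a (set \<alpha>) - {a}. ?f (a # \<alpha>) k) = (\<Prod>k\<in>insert a (set \<alpha>) - {a}. ?f \<alpha> k)"
    by (rule prod.cong) auto
  also have "?f (a # \<alpha>) a = Suc (count_list \<alpha> a) * ?f \<alpha> a" by simp
  also have "Suc (count_list \<alpha> a) * ?f \<alpha> a * (\<Prod>k\<in>insert a (set \<alpha>) - {a}. ?f \<alpha> k)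
    = Suc (count_list \<alpha> a) * (\<Prod>k\<in>insert a (set \<alpha>). ?f \<alpha> k)"
    by (subst (2) prod.remove[of _ a]) (simp_all add: algebra_simps)
  also have "(\<Prod>k\<in>insert a (set \<alpha>). ?f \<alpha> k) = aut_card \<alpha>" by (rule ext[symmetric]) auto
  finally show ?thesis .
qed

lemma card_cycle_lists:
  assumes "permutation p"
  shows "finite A \<Longrightarrow> p ` A \<subseteq> A \<Longrightarrow> type_on p A = mset \<alpha> \<Longrightarrow>
    finite (cycle_lists p A \<alpha>) \<and> card (cycle_lists p A \<alpha>) = aut_card \<alpha> * prod_list \<alpha>"
proof (induction \<alpha> arbitrary: A)
  case Nil
  then have "A = {}" by (auto simp: type_on_def mset_set_empty_iff)
  then have "cycle_lists p A [] = {[]}" by (auto simp: cycle_lists_def)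
  then show ?case by (simp add: aut_card_def)
next
  case (Cons a \<alpha>)
  let ?C = "{c. is_cycle p c \<and> length c = a \<and> set c \<subseteq> A}"
  have IH: "finite (cycle_lists p (A - set c) \<alpha>) \<and> card (cycle_lists p (A - set c) \<alpha>) = aut_card \<alpha> * prod_list \<alpha>"
    if "c \<in> ?C" for c
  proof (rule Cons.IH)
    show "p ` (A - set c) \<subseteq> A - set c"
      by (rule closed_minus_cycle[OF assms Cons.prems(2)]) (use that in auto)
    show "type_on p (A - set c) = mset \<alpha>"
      using type_on_remove[OF assms Cons.prems(1,2), of c] that Cons.prems(3) by simp
  qed (use Cons.prems in auto)
  have finC: "finite ?C" by (rule card_cycles[OF assms Cons.prems(1,2)])
  have "card (cycle_lists p A (a # \<alpha>)) = (\<Sum>c\<in>?C. card ((#) c ` cycle_lists p (A - set c) \<alpha>))"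
    unfolding cycle_lists_Cons by (rule card_UN_disjoint) (use finC IH in auto)
  also have "\<dots> = (\<Sum>c\<in>?C. aut_card \<alpha> * prod_list \<alpha>)"
    by (rule sum.cong[OF refl]) (use IH in \<open>auto simp: card_image\<close>)
  also have "\<dots> = aut_card (a # \<alpha>) * prod_list (a # \<alpha>)"
    using card_cycles(2)[OF assms Cons.prems(1,2), of a] Cons.prems(3)
    by (simp add: aut_card_Cons count_mset algebra_simps)
  finally have "card (cycle_lists p A (a # \<alpha>)) = aut_card (a # \<alpha>) * prod_list (a # \<alpha>)" .
  moreover have "finite (cycle_lists p A (a # \<alpha>))"
    unfolding cycle_lists_Cons using finC IH by auto
  ultimately show ?case by blast
qed

lemma ex_permutes_cycles:
  "distinct (concat cs) \<Longrightarrow> [] \<notin> set cs \<Longrightarrow> \<exists>p. p permutes set (concat cs) \<and> (\<forall>c\<in>set cs. is_cycle p c)"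
proof (induction cs)
  case Nil
  show ?case by (rule exI[of _ id]) (simp add: permutes_def)
next
  case (Cons c cs)
  then have "distinct (concat cs)" "[] \<notin> set cs" by auto
  from Cons.IH[OF this] obtain p where p: "p permutes set (concat cs)" "\<forall>c\<in>set cs. is_cycle p c" by blast
  let ?q = "cycle_of_list c \<circ> p"
  have dis: "set c \<inter> set (concat cs) = {}" and dc: "distinct c" using Cons.prems by auto
  have fix_c: "map p c = c"
    by (rule map_idI, rule permutes_not_in[OF p(1)]) (use dis in blast)
  have cc: "map (cycle_of_list c) c = rotate1 c"
    using cyclic_rotation[OF dc, of 1] by simp
  have "is_cycle ?q c"
    using Cons.prems fix_c cc by (auto simp: is_cycle_def simp flip: map_map)
  moreover have "is_cycle ?q c'" if c': "c' \<in> set cs" for c'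
  proof -
    have "map (cycle_of_list c) (rotate1 c') = rotate1 c'"
      by (rule map_idI, rule id_outside_supp) (use c' dis in auto)
    then show ?thesis using p(2) c' by (simp add: is_cycle_def flip: map_map)
  qed
  moreover have "?q permutes set (concat (c # cs))"
  proof (rule permutes_compose)
    show "p permutes set (concat (c # cs))" by (rule permutes_subset[OF p(1)]) auto
    show "cycle_of_list c permutes set (concat (c # cs))"
      by (rule permutes_subset[OF cycle_permutes]) auto
  qed
  ultimately have "?q permutes set (concat (c # cs)) \<and> (\<forall>c\<in>set (c # cs). is_cycle ?q c)"
    by (simp only: set_simps ball_simps) blast
  then show ?case by (rule exI[of _ ?q])
qed

lemma permutes_cycles_unique:
  assumes "p permutes A" "q permutes A" "set (concat cs) = A"
    "\<forall>c\<in>set cs. is_cycle p c" "\<forall>c\<in>set cs. is_cycle q c"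
  shows "p = q"
proof
  fix x
  show "p x = q x"
  proof (cases "x \<in> A")
    case True
    then obtain c where c: "c \<in> set cs" "x \<in> set c" using assms(3) by auto
    then have "map p c = map q c" using assms(4,5) by (simp add: is_cycle_def)
    then show ?thesis using c(2) by simp
  qed (use assms in \<open>auto simp: permutes_def\<close>)
qed

lemma ex_concat_lengths: "length xs = sum_list \<alpha> \<Longrightarrow> \<exists>cs. map length cs = \<alpha> \<and> concat cs = xs"
proof (induction \<alpha> arbitrary: xs)
  case (Cons a \<alpha>)
  then have "length (drop a xs) = sum_list \<alpha>" by simp
  from Cons.IH[OF this] obtain cs where "map length cs = \<alpha>" "concat cs = drop a xs" by blast
  then show ?case using Cons.prems by (intro exI[of _ "take a xs # cs"]) auto
qed simp

lemma card_concat_lists: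
  assumes "finite A" "card A = sum_list \<alpha>"
  shows "card {cs. map length cs = \<alpha> \<and> distinct (concat cs) \<and> set (concat cs) = A} = fact (card A)"
proof -
  let ?D = "{cs. map length cs = \<alpha> \<and> distinct (concat cs) \<and> set (concat cs) = A}"
  have "bij_betw concat ?D (permutations_of_set A)"
    unfolding bij_betw_def
  proof
    show "inj_on concat ?D"
    proof (rule inj_onI)
      fix cs cs' assume "cs \<in> ?D" "cs' \<in> ?D" "concat cs = concat cs'"
      then have len: "map length cs = map length cs'" and e: "concat cs = concat cs'" by auto
      have "length x = length y" if "(x, y) \<in> set (zip cs cs')" for x y
        using that len by (metis in_set_zip fst_conv snd_conv nth_map)
      then show "cs = cs'" using concat_injective[OF e] len by (auto dest: map_eq_imp_length_eq)
    qed
    show "concat ` ?D = permutations_of_set A"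
    proof (intro Set.set_eqI iffI)
      fix xs assume "xs \<in> permutations_of_set A"
      then have xs: "set xs = A" "distinct xs" by (auto simp: permutations_of_set_def)
      then have "length xs = sum_list \<alpha>" using assms distinct_card by metis
      then obtain cs where "map length cs = \<alpha>" "concat cs = xs" using ex_concat_lengths by blast
      then show "xs \<in> concat ` ?D" using xs by (intro image_eqI[of _ _ cs]) auto
    qed (auto simp: permutations_of_set_def)
  qed
  then show ?thesis using assms by (simp add: bij_betw_same_card)
qed

text \<open>Pairs of a permutation and one of its cycle lists are counted twice. The list alone
  determines the permutation, and since its block lengths are prescribed, forgetting the blocks
  identifies it with an ordering of \<open>A\<close>.\<close>

theorem card_perms_of_type:
  assumes A: "finite A" "card A = sum_list \<alpha>" and pos: "0 \<notin> set \<alpha>"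
  shows "card {p. p permutes A \<and> type_on p A = mset \<alpha>} * (aut_card \<alpha> * prod_list \<alpha>) = fact (card A)"
proof -
  let ?K = "{p. p permutes A \<and> type_on p A = mset \<alpha>}"
  let ?D = "{cs. map length cs = \<alpha> \<and> distinct (concat cs) \<and> set (concat cs) = A}"
  have perm: "permutation p" "p ` A \<subseteq> A" if "p permutes A" for p
    using that A(1) by (auto simp: permutation_permutes permutes_image)
  have cl: "finite (cycle_lists p A \<alpha>) \<and> card (cycle_lists p A \<alpha>) = aut_card \<alpha> * prod_list \<alpha>" if "p \<in> ?K" for p
    using that card_cycle_lists[OF perm(1) A(1) perm(2)] by blast
  have finK: "finite ?K" by (rule finite_subset[OF _ finite_permutations[OF A(1)]]) auto
  have "bij_betw snd (Sigma ?K (\<lambda>p. cycle_lists p A \<alpha>)) ?D"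
    unfolding bij_betw_def
  proof
    show "inj_on snd (Sigma ?K (\<lambda>p. cycle_lists p A \<alpha>))"
    proof (rule inj_onI)
      fix u v assume uv: "u \<in> Sigma ?K (\<lambda>p. cycle_lists p A \<alpha>)" "v \<in> Sigma ?K (\<lambda>p. cycle_lists p A \<alpha>)" "snd u = snd v"
      obtain p q cs where e: "u = (p, cs)" "v = (q, cs)" using uv(3) by (metis prod.collapse)
      have "p permutes A" "q permutes A" "cs \<in> cycle_lists p A \<alpha>" "cs \<in> cycle_lists q A \<alpha>"
        using uv(1,2) unfolding e by blast+
      then have "p = q" by (intro permutes_cycles_unique[of p A q cs]) (simp_all add: cycle_lists_def)
      then show "u = v" using e by simp
    qed
    show "snd ` Sigma ?K (\<lambda>p. cycle_lists p A \<alpha>) = ?D"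
    proof (intro Set.set_eqI iffI)
      fix cs assume cs: "cs \<in> ?D"
      then have "[] \<notin> set cs" using pos by (metis (mono_tags, lifting) image_eqI list.set_map list.size(3) mem_Collect_eq)
      moreover have "distinct (concat cs)" "set (concat cs) = A" using cs by blast+
      ultimately obtain p where p: "p permutes A" "\<forall>c\<in>set cs. is_cycle p c" using ex_permutes_cycles[of cs] by metis
      then have c: "cs \<in> cycle_lists p A \<alpha>" using cs by (simp add: cycle_lists_def)
      then have "type_on p A = mset \<alpha>"
        using type_on_cycle_lists[OF perm(1)[OF p(1)] A(1) perm(2)[OF p(1)]] by blast
      then show "cs \<in> snd ` Sigma ?K (\<lambda>p. cycle_lists p A \<alpha>)" using p c by (intro image_eqI[of _ _ "(p, cs)"]) auto
    qed (auto simp: cycle_lists_def)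
  qed
  from bij_betw_same_card[OF this] have "card (Sigma ?K (\<lambda>p. cycle_lists p A \<alpha>)) = fact (card A)"
    using card_concat_lists[OF A] by simp
  moreover have "card (Sigma ?K (\<lambda>p. cycle_lists p A \<alpha>)) = (\<Sum>p\<in>?K. card (cycle_lists p A \<alpha>))"
    by (rule card_SigmaI[OF finK]) (use cl in blast)
  moreover have "\<dots> = (\<Sum>p\<in>?K. aut_card \<alpha> * prod_list \<alpha>)"
    by (rule sum.cong[OF refl]) (use cl in blast)
  ultimately show ?thesis by simp
qed

lemma word_count_type_on:
  assumes p: "p permutes (A :: nat set)" "type_on p A = mset \<alpha>" and A: "finite A" and pos: "0 \<notin> set \<alpha>"
    and L: "distinct L" "set L = A"
  shows "word_count L r p = cycle_count r (mset \<alpha>)"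
proof -
  have perm: "permutation p" "p ` A \<subseteq> A" 
    using p A by (auto simp: permutation_permutes permutes_image)
  have "card (cycle_lists p A \<alpha>) = aut_card \<alpha> * prod_list \<alpha>"
    using card_cycle_lists[OF perm(1) A perm(2) p(2)] by simp
  moreover have "aut_card \<alpha> * prod_list \<alpha> \<noteq> 0" using pos by (simp add: aut_card_def prod_list_zero_iff)
  ultimately obtain cs where cs: "cs \<in> cycle_lists p A \<alpha>" by fastforce
  let ?S = "{..<length cs}"
  have cyc: "is_cycle p (cs ! i)" if "i \<in> ?S" for i using that cs by (simp add: cycle_lists_def)
  have ne: "removeAll [] cs = cs" using cs by (intro removeAll_id) (auto simp: cycle_lists_def is_cycle_def)
  have dis: "set (cs ! i) \<inter> set (cs ! j) = {}" if "i \<in> ?S" "j \<in> ?S" "i \<noteq> j" for i j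
  proof -
    have "distinct (concat cs)" using cs by (simp add: cycle_lists_def)
    then have "distinct cs" and d: "\<And>x y. x \<in> set cs \<Longrightarrow> y \<in> set cs \<Longrightarrow> x \<noteq> y \<Longrightarrow> set x \<inter> set y = {}"
      unfolding distinct_concat_iff ne by auto
    then show ?thesis using that by (intro d) (auto simp: nth_eq_iff_index_eq)
  qed
  have fam: "cycle_family p ?S (\<lambda>i. cs ! i)"
    unfolding cycle_family_def using cyc dis by blast
  have "set cs = (\<lambda>i. cs ! i) ` ?S" by (auto simp: set_conv_nth)
  then have "(\<Union>i\<in>?S. set (cs ! i)) = set (concat cs)" by simp
  then have "set L = (\<Union>i\<in>?S. set (cs ! i))" using L cs by (simp add: cycle_lists_def)
  moreover have "parts (\<lambda>i. length (cs ! i)) ?S = mset \<alpha>"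
  proof -
    have "map length cs = map (\<lambda>i. length (cs ! i)) [0..<length cs]"
      by (rule nth_equalityI) auto
    then have "mset \<alpha> = mset (map (\<lambda>i. length (cs ! i)) [0..<length cs])"
      using cs by (simp add: cycle_lists_def)
    also have "\<dots> = parts (\<lambda>i. length (cs ! i)) ?S" by (simp add: lessThan_atLeast0)
    finally show ?thesis by simp
  qed
  ultimately show ?thesis using cycle_count_eq[OF fam L(1)] by simp
qed

section \<open>Monotone factorizations as words\<close>

definition mono_words :: "nat \<Rightarrow> nat \<Rightarrow> (nat \<times> nat) list set" where
  "mono_words n r = {w. length w = r \<and> (\<forall>(i, t)\<in>set w. 1 \<le> i \<and> i < t \<and> t \<le> n) \<and>
     sorted_wrt (\<lambda>a b. snd b \<le> snd a) w}"

lemma mono_words_0: "mono_words n 0 = {[]}"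
  by (auto simp: mono_words_def)

lemma mono_words_empty: "mono_words 0 (Suc r) = {}"
  by (auto simp: mono_words_def length_Suc_conv)

text \<open>The same case distinction as in the recursion of \<open>mono_sum\<close>: the first
  letter uses the largest entry, or no letter does.\<close>

lemma mono_words_Suc:
  "mono_words (Suc n) (Suc r) = (\<Union>i\<in>{1..n}. (#) (i, Suc n) ` mono_words (Suc n) r) \<union> mono_words n (Suc r)"
proof (intro Set.set_eqI iffI)
  fix w assume "w \<in> mono_words (Suc n) (Suc r)"
  then obtain i t w' where w: "w = (i, t) # w'" and w': "length w' = r" "1 \<le> i" "i < t" "t \<le> Suc n"
    "\<forall>(i, t)\<in>set w'. 1 \<le> i \<and> i < t \<and> t \<le> Suc n" "\<forall>b\<in>set w'. snd b \<le> t" "sorted_wrt (\<lambda>a b. snd b \<le> snd a) w'"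
    by (auto simp: mono_words_def length_Suc_conv)
  show "w \<in> (\<Union>i\<in>{1..n}. (#) (i, Suc n) ` mono_words (Suc n) r) \<union> mono_words n (Suc r)"
  proof (cases "t = Suc n")
    case True
    have "w' \<in> mono_words (Suc n) r" using w' by (simp add: mono_words_def)
    moreover have "i \<in> {1..n}" using w' True by simp
    ultimately show ?thesis using w True by blast
  next
    case False
    then have "t \<le> n" using w' by simp
    then have "\<forall>(i, t)\<in>set w'. 1 \<le> i \<and> i < t \<and> t \<le> n" using w'(5,6) by fastforce
    then have "w \<in> mono_words n (Suc r)" using w w' \<open>t \<le> n\<close> by (simp add: mono_words_def)
    then show ?thesis by blast
  qed
next
  fix w assume "w \<in> (\<Union>i\<in>{1..n}. (#) (i, Suc n) ` mono_words (Suc n) r) \<union> mono_words n (Suc r)"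
  then show "w \<in> mono_words (Suc n) (Suc r)"
    by (fastforce simp: mono_words_def)
qed

lemma finite_mono_words: "finite (mono_words n r)"
proof (induction n arbitrary: r)
  case 0
  then show ?case by (cases r) (auto simp: mono_words_0 mono_words_empty)
next
  case (Suc n)
  show ?case by (induction r) (use Suc in \<open>auto simp: mono_words_0 mono_words_Suc\<close>)
qed

lemma mono_sum_eq_sum_words:
  "mono_sum act (rev [1..<Suc n]) r f s = (\<Sum>w\<in>mono_words n r. f (fold (\<lambda>(i, t). act i t) w s))"
proof (induction n arbitrary: r s)
  case 0
  show ?case by (cases r) (auto simp: mono_words_0 mono_words_empty)
next
  case (Suc n)
  have L: "rev [1..<Suc (Suc n)] = Suc n # rev [1..<Suc n]" by simp
  have sL: "set (rev [1..<Suc n]) = {1..n}" by auto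
  let ?g = "\<lambda>s w. f (fold (\<lambda>(i, t). act i t) w s)"
  show ?case
  proof (induction r arbitrary: s)
    case 0
    then show ?case by (simp add: mono_words_0)
  next
    case (Suc r)
    have "(\<Sum>w\<in>mono_words (Suc n) (Suc r). ?g s w)
      = (\<Sum>w\<in>(\<Union>i\<in>{1..n}. (#) (i, Suc n) ` mono_words (Suc n) r). ?g s w) + (\<Sum>w\<in>mono_words n (Suc r). ?g s w)"
      unfolding mono_words_Suc
    proof (rule sum.union_disjoint)
      show "(\<Union>i\<in>{1..n}. (#) (i, Suc n) ` mono_words (Suc n) r) \<inter> mono_words n (Suc r) = {}"
        by (auto simp: mono_words_def)
    qed (auto simp: finite_mono_words)
    also have "(\<Sum>w\<in>(\<Union>i\<in>{1..n}. (#) (i, Suc n) ` mono_words (Suc n) r). ?g s w)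
      = (\<Sum>i\<in>{1..n}. \<Sum>w\<in>(#) (i, Suc n) ` mono_words (Suc n) r. ?g s w)"
      by (rule sum.UNION_disjoint) (auto simp: finite_mono_words)
    also have "\<dots> = (\<Sum>i\<in>{1..n}. \<Sum>w\<in>mono_words (Suc n) r. ?g (act i (Suc n) s) w)"
      by (simp add: sum.reindex)
    also have "\<dots> = (\<Sum>i\<in>{1..n}. mono_sum act (rev [1..<Suc (Suc n)]) r f (act i (Suc n) s))"
      by (simp only: Suc.IH)
    also have "(\<Sum>w\<in>mono_words n (Suc r). ?g s w) = mono_sum act (rev [1..<Suc n]) (Suc r) f s"
      using \<open>\<And>r s. mono_sum act (rev [1..<Suc n]) r f s = (\<Sum>w\<in>mono_words n r. f (fold (\<lambda>(i, t). act i t) w s))\<close> by simp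
    finally show ?case unfolding L mono_sum.simps sL by simp
  qed
qed

text \<open>The letter read first acts first and so is the rightmost factor of the product. The
  reversal that this requires also turns the decreasing second components of a word into the
  increasing ones of a factorization.\<close>

definition swaps :: "(nat \<times> nat) list \<Rightarrow> (nat \<Rightarrow> nat) list" where
  "swaps w = rev (map (\<lambda>(i, t). transpose i t) w)"

lemma fold_cut_act:
  "fold (\<lambda>(i, t). cut_act i t) w (p, \<B>) = (foldr (\<circ>) (swaps w) id \<circ> p, {B \<in> \<B>. \<forall>(i, t)\<in>set w. i \<in> B \<longleftrightarrow> t \<in> B})"
proof (induction w arbitrary: p \<B>)
  case (Cons a w)
  obtain i t where a: "a = (i, t)" by (cases a)
  have "foldr (\<circ>) (xs @ [q]) id = foldr (\<circ>) xs id \<circ> q" for xs and q :: "nat \<Rightarrow> nat"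
    by (induction xs) (simp_all add: comp_assoc)
  then have e: "foldr (\<circ>) (swaps (a # w)) id = foldr (\<circ>) (swaps w) id \<circ> transpose i t"
    by (simp only: swaps_def a list.map rev.simps prod.case)
  have "fold (\<lambda>(i, t). cut_act i t) (a # w) (p, \<B>)
    = fold (\<lambda>(i, t). cut_act i t) w (transpose i t \<circ> p, {B \<in> \<B>. i \<in> B \<longleftrightarrow> t \<in> B})"
    by (simp add: a cut_act_def)
  then show ?case unfolding Cons.IH e by (auto simp: a comp_assoc)
qed (simp add: swaps_def)

lemma transpose_eq_iff:
  assumes "i < t" "j < (u :: nat)" "transpose i t = transpose j u"
  shows "i = j" "t = u"
proof -
  have "transpose j u i = t" "transpose j u t = i" using assms(3) by (metis transpose_apply_first transpose_apply_second)+
  then show "i = j" "t = u" using assms(1,2) by (auto simp: transpose_def split: if_splits)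
qed

lemma inj_on_swaps: "inj_on swaps (mono_words n r)"
proof (rule inj_onI)
  fix v w assume vw: "v \<in> mono_words n r" "w \<in> mono_words n r" "swaps v = swaps w"
  then have len: "length v = length w" and m: "map (\<lambda>(i, t). transpose i t) v = map (\<lambda>(i, t). transpose i t) w"
    by (auto simp: mono_words_def swaps_def)
  show "v = w"
  proof (rule nth_equalityI[OF len])
    fix k assume k: "k < length v"
    have "(\<lambda>(i, t). transpose i t) (v ! k) = (\<lambda>(i, t). transpose i t) (w ! k)"
      using m k len by (metis nth_map)
    moreover have "v ! k \<in> set v" "w ! k \<in> set w" using k len by simp_all
    then have "fst (v ! k) < snd (v ! k)" "fst (w ! k) < snd (w ! k)" using vw by (auto simp: mono_words_def)
    ultimately show "v ! k = w ! k"
      using transpose_eq_iff by (simp add: split_beta prod_eq_iff)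
  qed
qed

lemma monotone_transpositions_iff:
  "length \<tau>s = r \<and> monotone_transpositions d \<tau>s \<longleftrightarrow> \<tau>s \<in> swaps ` mono_words d r"
proof
  assume "length \<tau>s = r \<and> monotone_transpositions d \<tau>s"
  then obtain s t where st: "length \<tau>s = r" "\<And>i. i < r \<Longrightarrow> 1 \<le> s i \<and> s i < t i \<and> t i \<le> d \<and> \<tau>s ! i = transpose (s i) (t i)"
    "\<And>i j. i \<le> j \<and> j < r \<Longrightarrow> t i \<le> t j"
    unfolding monotone_transpositions_def by metis
  let ?w = "rev (map (\<lambda>i. (s i, t i)) [0..<r])"
  have "sorted_wrt (\<lambda>a b. snd b \<le> snd a) ?w"
    unfolding sorted_wrt_rev using st(3) by (simp add: sorted_wrt_iff_nth_less)
  then have "?w \<in> mono_words d r"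
    using st(2) by (auto simp: mono_words_def)
  moreover have "swaps ?w = \<tau>s"
    by (rule nth_equalityI) (use st in \<open>auto simp: swaps_def rev_map\<close>)
  ultimately show "\<tau>s \<in> swaps ` mono_words d r" by blast
next
  assume "\<tau>s \<in> swaps ` mono_words d r"
  then obtain w where w: "w \<in> mono_words d r" "\<tau>s = swaps w" by blast
  let ?u = "rev w"
  have len: "length \<tau>s = r" using w by (simp add: swaps_def mono_words_def)
  have sw: "\<tau>s = map (\<lambda>(i, t). transpose i t) ?u" using w by (simp add: swaps_def rev_map)
  have sorted: "sorted_wrt (\<lambda>a b. snd a \<le> snd b) ?u"
    using w by (simp add: mono_words_def sorted_wrt_rev)
  have lu: "length ?u = r" using w by (simp add: mono_words_def)
  have "1 \<le> fst (?u ! i) \<and> fst (?u ! i) < snd (?u ! i) \<and> snd (?u ! i) \<le> d \<and> \<tau>s ! i = transpose (fst (?u ! i)) (snd (?u ! i))"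
    if "i < r" for i
  proof -
    have "?u ! i \<in> set w" using that lu by (metis nth_mem set_rev)
    moreover have "\<tau>s ! i = transpose (fst (?u ! i)) (snd (?u ! i))" unfolding sw using that lu by (simp add: split_beta)
    ultimately show ?thesis using w by (auto simp: mono_words_def)
  qed
  moreover have "snd (?u ! i) \<le> snd (?u ! j)" if "i \<le> j" "j < r" for i j
    using sorted_wrt_nth_less[OF sorted, of i j] that lu by (cases "i = j") auto
  ultimately have "monotone_transpositions d \<tau>s"
    unfolding monotone_transpositions_def len
    by (intro exI[of _ "\<lambda>i. fst (?u ! i)"] exI[of _ "\<lambda>i. snd (?u ! i)"]) simp
  then show "length \<tau>s = r \<and> monotone_transpositions d \<tau>s" using len by simp
qed

lemma transpose_mem_iff: "(i \<in> B \<longleftrightarrow> t \<in> B) \<Longrightarrow> transpose i t x \<in> B \<longleftrightarrow> x \<in> B"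
  by (cases "x = i"; cases "x = t") simp_all

lemma swaps_preserve:
  assumes "\<forall>(i, t)\<in>set w. i \<in> B \<longleftrightarrow> t \<in> B"
  shows "foldr (\<circ>) (swaps w) id x \<in> B \<longleftrightarrow> x \<in> B"
proof -
  have "\<forall>q\<in>set ts. \<forall>x. q x \<in> B \<longleftrightarrow> x \<in> B \<Longrightarrow> foldr (\<circ>) ts id x \<in> B \<longleftrightarrow> x \<in> B" for ts :: "(nat \<Rightarrow> nat) list"
    by (induction ts) auto
  moreover have "\<forall>q\<in>set (swaps w). \<forall>x. q x \<in> B \<longleftrightarrow> x \<in> B"
    using assms by (auto simp: swaps_def transpose_mem_iff)
  ultimately show ?thesis by blast
qed

lemma swaps_permutes:
  assumes "w \<in> mono_words d r"
  shows "q \<in> set (swaps w) \<Longrightarrow> q permutes {1..d}" "foldr (\<circ>) (swaps w) id permutes {1..d}"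
proof -
  show 1: "q permutes {1..d}" if "q \<in> set (swaps w)" for q
    using that assms by (auto simp: swaps_def mono_words_def intro!: permutes_swap_id)
  have "\<forall>q\<in>set ts. q permutes {1..d} \<Longrightarrow> foldr (\<circ>) ts id permutes {1..d}" for ts :: "(nat \<Rightarrow> nat) list"
    by (induction ts) (auto simp: permutes_id intro: permutes_compose)
  then show "foldr (\<circ>) (swaps w) id permutes {1..d}" using 1 by blast
qed

text \<open>Being inverse to the product of the transpositions, \<open>p\<close> preserves every set
  that they preserve, so it does not add to connectedness. For the other direction, the orbit of a
  point under the generated group is itself preserved by all letters.\<close>

lemma generates_transitive_iff:
  assumes w: "w \<in> mono_words d r" and p: "p permutes {1..d}" "p \<circ> foldr (\<circ>) (swaps w) id = id"
  shows "generates_transitive d (insert p (set (swaps w)))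
    \<longleftrightarrow> indecomposable {1..d} {B. \<forall>(i, t)\<in>set w. i \<in> B \<longleftrightarrow> t \<in> B}"
proof
  let ?H = "insert p (set (swaps w))" and ?G = "sym_group d"
  have H: "h permutes {1..d}" if "h \<in> ?H" for h using that p(1) swaps_permutes[OF w] by auto
  {
    assume tr: "generates_transitive d ?H"
    show "indecomposable {1..d} {B. \<forall>(i, t)\<in>set w. i \<in> B \<longleftrightarrow> t \<in> B}"
      unfolding indecomposable_def
    proof
      fix B assume "B \<in> {B. \<forall>(i, t)\<in>set w. i \<in> B \<longleftrightarrow> t \<in> B}"
      then have B: "\<forall>(i, t)\<in>set w. i \<in> B \<longleftrightarrow> t \<in> B" by blast
      have comm: "foldr (\<circ>) (swaps w) id \<circ> p = id"
        using p swaps_permutes(2)[OF w] by (metis permutes_inv_o(2) fun.map_id0 inv_unique_comp permutes_inv_o(1) comp_assoc comp_id id_comp)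
      have Hp: "h x \<in> B \<longleftrightarrow> x \<in> B" if "h \<in> ?H" for h x
      proof (cases "h = p")
        case True
        have "foldr (\<circ>) (swaps w) id (p x) = x" using comm by (metis comp_apply id_apply)
        then show ?thesis using swaps_preserve[OF B, of "p x"] True by simp
      next
        case False
        then show ?thesis using that B by (auto simp: swaps_def transpose_mem_iff)
      qed
      have gen: "g permutes {1..d} \<and> (\<forall>x. g x \<in> B \<longleftrightarrow> x \<in> B)" if "g \<in> generate ?G ?H" for g
        using that
      proof induction
        case one
        show ?case using permutes_id[of "{1..d}"] by (simp add: sym_group_def id_def)
      next
        case (incl h)
        show ?case using H[OF incl] Hp[OF incl] by simp
      next
        case (inv h)
        have h: "h permutes {1..d}" using H[OF inv] .
        then have "inv\<^bsub>?G\<^esub> h = inv' h" by (intro sym_group_inv_equality) (simp add: sym_group_def)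
        moreover have "inv' h x \<in> B \<longleftrightarrow> x \<in> B" for x
          using Hp[OF inv, of "inv' h x"] permutes_inverses(1)[OF h, of x] by simp
        ultimately show ?case using permutes_inv[OF h] by simp
      next
        case (eng h1 h2)
        then show ?case using permutes_compose[of h2 "{1..d}" h1] by (simp add: sym_group_def comp_def)
      qed
      show "{1..d} \<subseteq> B \<or> {1..d} \<inter> B = {}"
      proof (rule ccontr)
        assume "\<not> ({1..d} \<subseteq> B \<or> {1..d} \<inter> B = {})"
        then have "\<exists>x\<in>{1..d}. x \<in> B" "\<exists>y\<in>{1..d}. y \<notin> B" by blast+
        then obtain x y where xy: "x \<in> {1..d}" "x \<in> B" "y \<in> {1..d}" "y \<notin> B" by blast
        then obtain g where "g \<in> generate ?G ?H" "g x = y" using tr[unfolded generates_transitive_def, rule_format, OF xy(1) xy(3)] by blast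
        then have "y \<in> B \<longleftrightarrow> x \<in> B" using gen[of g] by metis
        then show False using xy by simp
      qed
    qed
  }
  {
    assume ind: "indecomposable {1..d} {B. \<forall>(i, t)\<in>set w. i \<in> B \<longleftrightarrow> t \<in> B}"
    show "generates_transitive d ?H"
      unfolding generates_transitive_def
    proof (intro ballI)
      fix x y assume xy: "x \<in> {1..d}" "y \<in> {1..d}"
      define C where "C = {z. \<exists>g\<in>generate ?G ?H. g x = z}"
      have st: "transpose i t z \<in> C" if it: "(i, t) \<in> set w" and z: "z \<in> C" for i t z
      proof -
        obtain g where g: "g \<in> generate ?G ?H" "g x = z" using z unfolding C_def by blast
        have "transpose i t \<in> set (swaps w)" using it by (force simp: swaps_def)
        then have "transpose i t \<otimes>\<^bsub>?G\<^esub> g \<in> generate ?G ?H" 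
          by (intro generate.eng[OF generate.incl g(1)]) simp
        then have "transpose i t \<circ> g \<in> generate ?G ?H" by (simp add: sym_group_def)
        moreover have "(transpose i t \<circ> g) x = transpose i t z" using g(2) by simp
        ultimately show ?thesis unfolding C_def by blast
      qed
      have "i \<in> C \<longleftrightarrow> t \<in> C" if "(i, t) \<in> set w" for i t
        using st[OF that, of i] st[OF that, of t] by (metis transpose_apply_first transpose_apply_second)
      then have "C \<in> {B. \<forall>(i, t)\<in>set w. i \<in> B \<longleftrightarrow> t \<in> B}" by blast
      from bspec[OF ind[unfolded indecomposable_def] this] have C: "{1..d} \<subseteq> C \<or> {1..d} \<inter> C = {}" .
      have "id \<in> generate ?G ?H" using generate.one[of ?G ?H] by (simp add: sym_group_def)
      moreover have "id x = x" by simp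
      ultimately have "x \<in> C" unfolding C_def by blast
      then have "y \<in> C" using C xy by blast
      then show "\<exists>g\<in>generate ?G ?H. g x = y" unfolding C_def by blast
    qed
  }
qed

lemma card_factorizations:
  assumes p: "p permutes {1..d}"
  shows "int (card {\<tau>s. length \<tau>s = r \<and> monotone_transpositions d \<tau>s \<and> p \<circ> foldr (\<circ>) \<tau>s id = id \<and>
      generates_transitive d (insert p (set \<tau>s))}) = word_count (rev [1..<Suc d]) r p"
proof -
  let ?A = "{1..d}"
  let ?L = "rev [1..<Suc d]"
  let ?I = "\<lambda>w. indecomposable ?A {B. \<forall>(i, t)\<in>set w. i \<in> B \<longleftrightarrow> t \<in> B}"
  let ?P = "\<lambda>w. foldr (\<circ>) (swaps w) id"
  let ?W = "{w \<in> mono_words d r. p \<circ> ?P w = id \<and> ?I w}"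
  have sL: "set ?L = ?A" by auto
  have fs: "final_state ?A (fold (\<lambda>(i, t). cut_act i t) w (p, UNIV)) = of_bool (p \<circ> ?P w = id \<and> ?I w)"
    if w: "w \<in> mono_words d r" for w
  proof -
    have q: "?P w \<circ> p permutes ?A" using permutes_compose[OF p swaps_permutes(2)[OF w]] .
    have "(\<forall>x\<in>?A. (?P w \<circ> p) x = x) \<longleftrightarrow> ?P w \<circ> p = id"
      using q by (auto simp: fun_eq_iff permutes_def)
    \<comment> \<open>Words multiply on the left of \<open>p\<close>, factorizations on the right;
      either product is the identity exactly if the two permutations are inverse to each
      other.\<close>
    also have "\<dots> \<longleftrightarrow> p \<circ> ?P w = id"
      using inv_unique_comp[of p "?P w"] permutes_inv_o[OF p] permutes_inv_o[OF swaps_permutes(2)[OF w]]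
      by (metis comp_assoc comp_id id_comp)
    finally show ?thesis unfolding fold_cut_act final_state_def by simp
  qed
  have "word_count ?L r p = (\<Sum>w\<in>mono_words d r. final_state ?A (fold (\<lambda>(i, t). cut_act i t) w (p, UNIV)))"
    unfolding word_count_def sL mono_sum_eq_sum_words ..
  also have "\<dots> = (\<Sum>w\<in>mono_words d r. of_bool (p \<circ> ?P w = id \<and> ?I w))"
    by (rule sum.cong[OF refl]) (use fs in auto)
  also have "\<dots> = int (card ?W)"
    using finite_mono_words[of d r] by (simp add: sum.If_cases of_bool_def Int_def)
  also have "card ?W = card (swaps ` ?W)"
    by (rule card_image[symmetric], rule inj_on_subset[OF inj_on_swaps]) auto
  also have "swaps ` ?W = {\<tau>s. length \<tau>s = r \<and> monotone_transpositions d \<tau>s \<and> p \<circ> foldr (\<circ>) \<tau>s id = id \<and>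
      generates_transitive d (insert p (set \<tau>s))}" (is "_ = ?T")
  proof (intro Set.set_eqI iffI)
    fix \<tau>s assume "\<tau>s \<in> swaps ` ?W"
    then obtain w where w: "w \<in> mono_words d r" "p \<circ> ?P w = id" "?I w" "\<tau>s = swaps w" by blast
    then show "\<tau>s \<in> ?T"
      using generates_transitive_iff[OF w(1) p w(2)] monotone_transpositions_iff[of \<tau>s r d] by blast
  next
    fix \<tau>s assume T: "\<tau>s \<in> ?T"
    then obtain w where w: "w \<in> mono_words d r" "\<tau>s = swaps w"
      using monotone_transpositions_iff[of \<tau>s r d] by blast
    then have "w \<in> ?W" using generates_transitive_iff[OF w(1) p] T by blast
    then show "\<tau>s \<in> swaps ` ?W" using w by blast
  qed
  finally show ?thesis by simp
qed

text \<open>Every permutation of cycle type \<open>\<alpha>\<close> admits the same number of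
  connected words, so the count is that number times the size of the conjugacy class.\<close>

theorem monotone_hurwitz_cycle_count:
  assumes pos: "0 \<notin> set \<alpha>"
  shows "int (monotone_hurwitz g \<alpha>) * int (aut_card \<alpha> * prod_list \<alpha>)
    = fact (sum_list \<alpha>) * cycle_count (2 * g + length \<alpha> + sum_list \<alpha> - 2) (mset \<alpha>)"
proof -
  let ?d = "sum_list \<alpha>" and ?r = "2 * g + length \<alpha> + sum_list \<alpha> - 2"
  let ?K = "{p. p permutes {1..?d} \<and> type_on p {1..?d} = mset \<alpha>}"
  let ?T = "\<lambda>p. {\<tau>s. length \<tau>s = ?r \<and> monotone_transpositions ?d \<tau>s \<and> p \<circ> foldr (\<circ>) \<tau>s id = id \<and>
      generates_transitive ?d (insert p (set \<tau>s))}"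
  have finK: "finite ?K" by (rule finite_subset[OF _ finite_permutations[of "{1..?d}"]]) auto
  have finT: "finite (?T p)" for p
  proof (rule finite_subset)
    show "?T p \<subseteq> swaps ` mono_words ?d ?r" using monotone_transpositions_iff[of _ ?r ?d] by blast
    show "finite (swaps ` mono_words ?d ?r)" using finite_mono_words by blast
  qed
  have "monotone_factorizations g \<alpha> = Sigma ?K ?T"
    unfolding monotone_factorizations_def cycle_type_def type_on_def by auto
  then have "int (monotone_hurwitz g \<alpha>) = (\<Sum>p\<in>?K. int (card (?T p)))"
    unfolding monotone_hurwitz_def using card_SigmaI[OF finK, of ?T] finT by simp
  also have "\<dots> = (\<Sum>p\<in>?K. cycle_count ?r (mset \<alpha>))"
  proof (rule sum.cong[OF refl])
    fix p assume p: "p \<in> ?K"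
    then have "int (card (?T p)) = word_count (rev [1..<Suc ?d]) ?r p"
      using card_factorizations by blast
    also have "\<dots> = cycle_count ?r (mset \<alpha>)"
      by (rule word_count_type_on[of _ "{1..?d}"]) (use p pos in auto)
    finally show "int (card (?T p)) = cycle_count ?r (mset \<alpha>)" .
  qed
  finally have 1: "int (monotone_hurwitz g \<alpha>) = int (card ?K) * cycle_count ?r (mset \<alpha>)" by simp
  have 2: "int (card ?K) * int (aut_card \<alpha> * prod_list \<alpha>) = fact ?d"
    using card_perms_of_type[of "{1..?d}" \<alpha>] pos by (simp only: finite_atLeastAtMost card_atLeastAtMost flip: of_nat_mult) simp
  show ?thesis unfolding 1 2[symmetric] by (simp add: algebra_simps)
qed

section \<open>Odd powers of the central binomial series\<close>

definition cb :: "rat fps" where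
  "cb = Abs_fps (\<lambda>n. of_nat ((2 * n) choose n))"

text \<open>The inverse square of \<open>cb\<close>, by \<open>cb_square_U\<close>. Thus
  \<open>U * cb\<close> is the square root of \<open>1 - 4 X\<close> and the inverse of
  \<open>cb\<close>.\<close>

definition U :: "rat fps" where
  "U = 1 - fps_const 4 * fps_X"

lemma cb_nth: "cb $ n = of_nat ((2 * n) choose n)"
  by (simp add: cb_def)

lemma cb_nth_0 [simp]: "cb $ 0 = 1"
  by (simp add: cb_def)

lemma U_mult_nth_Suc: "(U * F) $ Suc n = F $ Suc n - 4 * F $ n"
  by (simp add: U_def left_diff_distrib mult.assoc)

lemma U_nth_0 [simp]: "U $ 0 = 1"
  by (simp add: U_def)

lemma U_mult_nth_0: "(U * F) $ 0 = F $ 0"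
  by simp

lemma cb_nth_Suc: "of_nat (Suc n) * cb $ Suc n = 2 * (2 * of_nat n + 1) * cb $ n"
proof -
  have "Suc n * ((2 * Suc n) choose Suc n) = Suc (Suc (2 * n)) * (Suc (2 * n) choose n)"
    using Suc_times_binomial[of n "Suc (2 * n)"] by simp
  also have "Suc (2 * n) choose n = Suc (2 * n) choose Suc n"
    by (subst binomial_symmetric) auto
  also have "Suc (Suc (2 * n)) * (Suc (2 * n) choose Suc n) = 2 * (Suc n * (Suc (2 * n) choose Suc n))"
    by simp
  also have "Suc n * (Suc (2 * n) choose Suc n) = Suc (2 * n) * ((2 * n) choose n)"
    by (rule Suc_times_binomial)
  finally have "Suc n * ((2 * Suc n) choose Suc n) = 2 * (Suc (2 * n) * ((2 * n) choose n))" .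
  then have "(of_nat (Suc n * ((2 * Suc n) choose Suc n)) :: rat) = of_nat (2 * (Suc (2 * n) * ((2 * n) choose n)))"
    by (rule arg_cong)
  then show ?thesis unfolding cb_nth by (simp only: of_nat_mult of_nat_Suc of_nat_numeral) (simp add: algebra_simps)
qed

lemma U_deriv_cb: "U * fps_deriv cb = 2 * cb"
proof (rule fps_ext)
  fix n
  show "(U * fps_deriv cb) $ n = (2 * cb) $ n"
  proof (cases n)
    case 0
    then show ?thesis using cb_nth_Suc[of 0] by (simp add: U_mult_nth_0 fps_numeral_fps_const)
  next
    case (Suc m)
    have "(U * fps_deriv cb) $ n = of_nat (Suc n) * cb $ Suc n - 4 * (of_nat n * cb $ n)"
      unfolding Suc by (simp add: U_mult_nth_Suc)
    also have "\<dots> = 2 * cb $ n" unfolding cb_nth_Suc by (simp add: algebra_simps)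
    finally show ?thesis by (simp add: fps_numeral_fps_const)
  qed
qed

text \<open>The differential equation \<open>U_deriv_cb\<close> makes the derivative of the
  left-hand side vanish; the constant coefficient is 1.\<close>

lemma cb_square_U: "cb ^ 2 * U = 1"
proof -
  have "fps_deriv (cb ^ 2 * U) = 2 * cb * (U * fps_deriv cb) + cb ^ 2 * fps_deriv U"
    by (simp add: fps_deriv_power algebra_simps power2_eq_square)
  also have "fps_deriv U = - 4"
    by (simp add: U_def fps_numeral_fps_const)
  finally have "fps_deriv (cb ^ 2 * U) = 0"
    unfolding U_deriv_cb by (simp add: power2_eq_square)
  then have "cb ^ 2 * U = fps_const ((cb ^ 2 * U) $ 0)" by (simp only: fps_deriv_eq_0_iff)
  also have "(cb ^ 2 * U) $ 0 = 1" by (simp add: U_def power2_eq_square)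
  finally show ?thesis by simp
qed

lemma U_cb_cb: "U * (cb * cb) = 1"
  using cb_square_U by (simp add: power2_eq_square mult.commute)

lemma cb_nonzero [simp]: "cb \<noteq> 0"
  using cb_nth_0 by force

lemma U_nonzero [simp]: "U \<noteq> 0"
  using U_cb_cb by auto

lemma U_power_cb: "U ^ j * cb ^ (2 * j + i) = cb ^ i"
proof -
  have "U ^ j * cb ^ (2 * j + i) = (cb ^ 2 * U) ^ j * cb ^ i"
    by (simp add: power_mult_distrib power_add power_mult)
  then show ?thesis by (simp add: cb_square_U)
qed

text \<open>This is \<open>X = (1 - U) / 4\<close> with \<open>U\<close> the inverse square of
  \<open>cb\<close>: a factor \<open>X\<close> lowers the exponent by at most 2.\<close>

lemma X_cb_power: "fps_X * cb ^ (j + 2) = fps_const (1 / 4) * (cb ^ (j + 2) - cb ^ j)"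
proof -
  have "fps_const 4 * fps_X = 1 - U" by (simp add: U_def)
  then have "fps_X = fps_const (1 / 4) * (1 - U)"
    by (metis (no_types, lifting) fps_const_mult fps_const_1_eq_1 mult.assoc mult_1 nonzero_divide_eq_eq one_neq_zero times_divide_eq_left zero_neq_numeral mult.commute)
  then have "fps_X * cb ^ (j + 2) = fps_const (1 / 4) * (1 - U) * cb ^ (j + 2)" by (rule arg_cong)
  moreover have "U * cb ^ (j + 2) = cb ^ j"
    using U_power_cb[of 1 j] by (simp add: add.commute)
  ultimately show ?thesis by (simp only: mult.assoc left_diff_distrib mult_1_left)
qed

section \<open>The Euler operator and the span of the odd powers\<close>

definition theta :: "rat fps \<Rightarrow> rat fps" where
  "theta F = fps_X * fps_deriv F"

lemma theta_nth: "theta F $ n = of_nat n * F $ n"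
  by (cases n) (auto simp: theta_def)

lemma theta_add: "theta (F + G) = theta F + theta G"
  and theta_const_mult: "theta (fps_const c * F) = fps_const c * theta F"
  and theta_0 [simp]: "theta 0 = 0"
  by (auto simp: theta_def algebra_simps)

lemma theta_cb: "theta cb = 2 * fps_X * cb ^ 3"
proof -
  have "U ^ 1 * cb ^ 3 = cb ^ 1"
    using U_power_cb[of 1 1] by (simp only: mult_1_right one_add_one numeral_plus_one semiring_norm)
  then have 3: "U * cb ^ 3 = cb" by (simp only: power_one_right)
  have "U * theta cb = fps_X * (U * fps_deriv cb)"
    unfolding theta_def by (rule mult.left_commute)
  also have "\<dots> = fps_X * (2 * (U * cb ^ 3))"
    unfolding U_deriv_cb 3 ..
  also have "\<dots> = U * (2 * fps_X * cb ^ 3)"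
    by (simp only: mult_ac)
  finally have "U * theta cb = U * (2 * fps_X * cb ^ 3)" .
  then show ?thesis by simp
qed

lemma theta_cb_power:
  "theta (cb ^ (2 * j + 1)) = fps_const (of_nat (2 * j + 1) / 2) * (cb ^ (2 * j + 3) - cb ^ (2 * j + 1))"
proof -
  have "theta (cb ^ (2 * j + 1)) = of_nat (2 * j + 1) * (cb ^ (2 * j) * theta cb)"
    by (simp only: theta_def fps_deriv_power add_diff_cancel_right' fps_of_nat mult_ac)
  also have "cb ^ (2 * j) * theta cb = 2 * (fps_X * cb ^ (2 * j + 3))"
    unfolding theta_cb by (simp add: power_add mult_ac)
  also have "fps_X * cb ^ (2 * j + 3) = fps_const (1 / 4) * (cb ^ (2 * j + 3) - cb ^ (2 * j + 1))"
    using X_cb_power[of "2 * j + 1"] by (simp add: eval_nat_numeral)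
  finally have "theta (cb ^ (2 * j + 1)) = fps_const (of_nat (2 * j + 1)) * (fps_const 2 * (fps_const (1 / 4) * (cb ^ (2 * j + 3) - cb ^ (2 * j + 1))))"
    by (simp only: fps_of_nat fps_numeral_fps_const mult.assoc)
  also have "\<dots> = (fps_const (of_nat (2 * j + 1)) * fps_const 2 * fps_const (1 / 4)) * (cb ^ (2 * j + 3) - cb ^ (2 * j + 1))"
    by (simp only: mult.assoc)
  also have "fps_const (of_nat (2 * j + 1)) * fps_const 2 * fps_const (1 / 4) = fps_const (of_nat (2 * j + 1) / 2 :: rat)"
    by (simp only: fps_const_mult) simp
  finally show ?thesis .
qed

inductive_set odd_span :: "rat fps set" where
  zero: "0 \<in> odd_span"
| step: "F \<in> odd_span \<Longrightarrow> fps_const a * cb ^ (2 * j + 1) + F \<in> odd_span"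

lemma odd_span_power: "cb ^ (2 * j + 1) \<in> odd_span"
  using odd_span.step[OF odd_span.zero, of 1 j] by simp

lemma odd_span_add: "F \<in> odd_span \<Longrightarrow> G \<in> odd_span \<Longrightarrow> F + G \<in> odd_span"
proof (induction rule: odd_span.induct)
  case (step F a j)
  then show ?case unfolding add.assoc by (intro odd_span.step)
qed simp

lemma odd_span_scale: "F \<in> odd_span \<Longrightarrow> fps_const c * F \<in> odd_span"
proof (induction rule: odd_span.induct)
  case (step F a j)
  have "fps_const c * (fps_const a * cb ^ (2 * j + 1) + F) = fps_const (c * a) * cb ^ (2 * j + 1) + fps_const c * F"
    by (simp only: distrib_left fps_const_mult[symmetric] mult.assoc)
  then show ?case using odd_span.step[OF step(2)] by simp
qed (simp add: odd_span.zero)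

lemma odd_span_uminus: "F \<in> odd_span \<Longrightarrow> - F \<in> odd_span"
  using odd_span_scale[of F "- 1"] by (simp flip: fps_const_neg)

lemma odd_span_diff: "F \<in> odd_span \<Longrightarrow> G \<in> odd_span \<Longrightarrow> F - G \<in> odd_span"
  using odd_span_add[of F "- G"] odd_span_uminus[of G] by simp

lemma odd_span_sum: "(\<And>i. i \<in> A \<Longrightarrow> F i \<in> odd_span) \<Longrightarrow> (\<Sum>i\<in>A. F i) \<in> odd_span"
  by (induction A rule: infinite_finite_induct) (auto intro: odd_span.zero odd_span_add)

lemma odd_span_linear:
  assumes "F \<in> odd_span" "\<And>j. h (cb ^ (2 * j + 1)) \<in> odd_span"
    "\<And>F G. h (F + G) = h F + h G" "\<And>c F. h (fps_const c * F) = fps_const c * h F" "h 0 = 0"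
  shows "h F \<in> odd_span"
  using assms(1)
proof (induction rule: odd_span.induct)
  case (step F a j)
  then show ?case unfolding assms(3,4) by (intro odd_span_add odd_span_scale assms(2))
qed (simp add: assms(5) odd_span.zero)

text \<open>Three odd exponents have an odd sum; two would leave the span. The third factor
  \<open>cb\<close> is the one supplied by \<open>cat_solve\<close> in each product of the
  recursion.\<close>

lemma odd_span_triple:
  assumes "F \<in> odd_span" "G \<in> odd_span"
  shows "cb * F * G \<in> odd_span"
proof (rule odd_span_linear[OF assms(1), where h = "\<lambda>F. cb * F * G"])
  fix i
  show "cb * cb ^ (2 * i + 1) * G \<in> odd_span"
  proof (rule odd_span_linear[OF assms(2), where h = "\<lambda>G. cb * cb ^ (2 * i + 1) * G"])
    fix j
    have "cb * cb ^ (2 * i + 1) * cb ^ (2 * j + 1) = cb ^ (2 * (i + j + 1) + 1)"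
      by (simp flip: power_Suc power_add add: algebra_simps)
    then show "cb * cb ^ (2 * i + 1) * cb ^ (2 * j + 1) \<in> odd_span"
      using odd_span_power by metis
  qed (simp_all add: algebra_simps)
qed (simp_all add: algebra_simps)

lemma odd_span_theta: "F \<in> odd_span \<Longrightarrow> theta F \<in> odd_span"
proof (rule odd_span_linear[where h = theta])
  fix j
  have "cb ^ (2 * j + 3) = cb ^ (2 * (j + 1) + 1)" by (simp add: eval_nat_numeral)
  then show "theta (cb ^ (2 * j + 1)) \<in> odd_span"
    unfolding theta_cb_power by (metis odd_span_scale odd_span_diff odd_span_power)
qed (simp_all only: theta_add theta_const_mult theta_0)

text \<open>Each of the \<open>s\<close> factors lowers the exponent by at most 2, and
  \<open>s \<le> j\<close> leaves an exponent of at least 1.\<close>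

lemma odd_span_X_power: "s \<le> j \<Longrightarrow> fps_X ^ s * cb ^ (2 * j + 1) \<in> odd_span"
proof (induction s arbitrary: j)
  case 0
  show ?case using odd_span_power[of j] by simp
next
  case (Suc s)
  then obtain i where j: "j = Suc i" by (cases j) auto
  have "fps_X ^ Suc s * cb ^ (2 * j + 1) = fps_X ^ s * (fps_X * cb ^ ((2 * i + 1) + 2))"
    unfolding j by (simp add: mult.assoc mult.left_commute)
  also have "\<dots> = fps_const (1 / 4) * (fps_X ^ s * cb ^ (2 * j + 1) - fps_X ^ s * cb ^ (2 * i + 1))"
    unfolding X_cb_power j by (simp add: algebra_simps)
  finally show ?case using Suc.IH[of j] Suc.IH[of i] Suc.prems j by (simp add: odd_span_scale odd_span_diff)
qed

text \<open>\<open>theta\<close> multiplies the coefficient of \<open>X^n\<close> by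
  \<open>n\<close>, and \<open>theta_cb_power\<close>, solved for the higher power, expresses it by
  the lower one and its image under \<open>theta\<close>. Each step thus multiplies the coefficient
  polynomial by a linear factor in \<open>n\<close>.\<close>

lemma odd_span_nth: "F \<in> odd_span \<Longrightarrow> \<exists>p :: rat poly. \<forall>n. F $ n = cb $ n * poly p (of_nat n)"
proof -
  have base: "\<exists>p :: rat poly. \<forall>n. (cb ^ (2 * j + 1)) $ n = cb $ n * poly p (of_nat n)" for j
  proof (induction j)
    case 0
    show ?case by (intro exI[of _ 1]) simp
  next
    case (Suc j)
    then obtain p where p: "\<forall>n. (cb ^ (2 * j + 1)) $ n = cb $ n * poly p (of_nat n)" by blast
    let ?c = "of_nat (2 * j + 1) / 2 :: rat"
    have c: "?c \<noteq> 0" by (simp del: of_nat_add of_nat_mult of_nat_Suc)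
    have "(cb ^ (2 * j + 3)) $ n = cb $ n * poly (p + smult (1 / ?c) ([:0, 1:] * p)) (of_nat n)" for n
    proof -
      have "of_nat n * (cb ^ (2 * j + 1)) $ n = ?c * ((cb ^ (2 * j + 3)) $ n - (cb ^ (2 * j + 1)) $ n)"
        using arg_cong[OF theta_cb_power[of j], of "\<lambda>F. F $ n"] unfolding theta_nth by (simp del: power_Suc)
      then have "(cb ^ (2 * j + 3)) $ n = (cb ^ (2 * j + 1)) $ n + of_nat n * (cb ^ (2 * j + 1)) $ n / ?c"
        using c by (simp add: field_simps del: of_nat_add of_nat_mult of_nat_Suc)
      then show ?thesis using p[rule_format, of n] by (simp add: algebra_simps)
    qed
    moreover have "2 * Suc j + 1 = 2 * j + 3" by simp
    ultimately show ?case by metis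
  qed
  show "F \<in> odd_span \<Longrightarrow> \<exists>p :: rat poly. \<forall>n. F $ n = cb $ n * poly p (of_nat n)"
  proof (induction rule: odd_span.induct)
    case zero
    show ?case by (intro exI[of _ 0]) simp
  next
    case (step F a j)
    then obtain p where p: "\<forall>n. F $ n = cb $ n * poly p (of_nat n)" by blast
    obtain q where q: "\<forall>n. (cb ^ (2 * j + 1)) $ n = cb $ n * poly q (of_nat n)" using base by blast
    show ?case
      by (intro exI[of _ "smult a q + p"]) (use p q in \<open>simp add: algebra_simps del: power_Suc\<close>)
  qed
qed

section \<open>The join operator\<close>

text \<open>The part of \<open>F / X^m\<close> of positive degree. Joining parts \<open>k\<close>
  and \<open>m\<close> reads off the coefficient at \<open>k + m\<close>, and \<open>k = 0\<close>
  is not a part.\<close>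

definition shift :: "nat \<Rightarrow> rat fps \<Rightarrow> rat fps" where
  "shift m F = Abs_fps (\<lambda>k. if k = 0 then 0 else F $ (k + m))"

definition cat :: "rat fps" where
  "cat = fps_const (1 / 2) * (1 - U * cb)"

text \<open>The series of genus 0 with a second part \<open>m\<close>, as
  \<open>gen_0_singleton\<close> shows.\<close>

definition G :: "nat \<Rightarrow> rat fps" where
  "G m = cb * shift m cat"

text \<open>The shift of the recursion, combined with the two products that contain a two-part
  series of genus 0, and multiplied by the \<open>cb\<close> of \<open>cat_solve\<close>.\<close>

definition join :: "nat \<Rightarrow> rat fps \<Rightarrow> rat fps" where
  "join m F = cb * (shift m F + 2 * G m * F)"

lemma X_power_shift: "fps_X ^ m * shift m F = F - fps_cutoff (Suc m) F"
  by (rule fps_ext) (auto simp: fps_X_power_mult_nth shift_def)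

lemma shift_add: "shift m (F + H) = shift m F + shift m H"
  and shift_const_mult: "shift m (fps_const c * F) = fps_const c * shift m F"
  and shift_0 [simp]: "shift m 0 = 0"
  by (auto simp: shift_def fps_eq_iff)

lemma join_add: "join m (F + H) = join m F + join m H"
  and join_const_mult: "join m (fps_const c * F) = fps_const c * join m F"
  and join_0 [simp]: "join m 0 = 0"
  unfolding join_def shift_add shift_const_mult by (simp_all add: algebra_simps)

text \<open>\<open>2 * cat\<close> is 1 minus the square root \<open>U * cb\<close>. Removing its
  low terms leaves the truncated square root minus the full one, and \<open>cb\<close> is the
  inverse of the latter.\<close>

lemma X_power_G: "fps_X ^ m * (2 * G m) = cb * fps_cutoff (Suc m) (U * cb) - 1"
proof -
  have c: "2 * cat = 1 - U * cb" by (simp add: cat_def fps_numeral_fps_const flip: mult.assoc)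
  have "fps_X ^ m * (2 * G m) = cb * (2 * (fps_X ^ m * shift m cat))"
    by (simp add: G_def algebra_simps)
  also have "2 * (fps_X ^ m * shift m cat) = 2 * cat - fps_cutoff (Suc m) (2 * cat)"
    unfolding X_power_shift by (rule fps_ext) (simp add: fps_numeral_fps_const)
  also have "fps_cutoff (Suc m) (2 * cat) = 1 - fps_cutoff (Suc m) (U * cb)"
    unfolding c by (rule fps_ext) auto
  also have "cb * (2 * cat - (1 - fps_cutoff (Suc m) (U * cb))) = cb * fps_cutoff (Suc m) (U * cb) - U * (cb * cb)"
    unfolding c by (simp add: algebra_simps)
  finally show ?thesis unfolding U_cb_cb .
qed

lemma U_power_nth_eq_0: "J < n \<Longrightarrow> (U ^ J) $ n = 0"
proof (induction J arbitrary: n)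
  case (Suc J)
  then obtain k where "n = Suc k" by (cases n) auto
  then show ?case using Suc by (simp add: U_mult_nth_Suc)
qed simp

text \<open>After multiplication by \<open>X\<^sup>m U\<^sup>j\<^sup>+\<^sup>1\<close> only the truncations of the series at \<open>X\<^sup>m\<close> survive.
  They differ by a polynomial that is divisible by \<open>X\<^sup>m\<^sup>+\<^sup>1\<close>.\<close>

lemma join_power:
  "join m (cb ^ (2 * j + 1)) = - (\<Sum>i\<in>{1..j + 1}.
     fps_const ((fps_shift i (U ^ (j + 1)) * cb ^ (2 * j + 1)) $ m) * (fps_X ^ i * cb ^ (2 * j + 3)))"
proof -
  let ?F = "cb ^ (2 * j + 1)" and ?T = "fps_cutoff (Suc m)" and ?c = "\<lambda>i. (fps_shift i (U ^ (j + 1)) * cb ^ (2 * j + 1)) $ m"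
  define R where "R = ?T (U * cb) - U ^ (j + 1) * ?T ?F"
  have UF: "U ^ (j + 1) * ?F = U * cb"
    using U_power_cb[of j 1] by (simp add: mult.assoc)
  have UF': "U ^ (j + 1) * cb * ?F = 1"
    using U_power_cb[of "j + 1" 0] by (simp add: mult.assoc)
  have low: "R $ n = 0" if "n \<le> m" for n
  proof -
    have "(U ^ (j + 1) * ?T ?F) $ n = (U ^ (j + 1) * ?F) $ n"
      unfolding fps_mult_nth by (rule sum.cong) (use that in auto)
    then show ?thesis using that unfolding R_def UF by simp
  qed
  \<comment> \<open>Above degree \<open>m\<close> the truncated square root vanishes, and the
    truncated power meets only the coefficients of \<open>U ^ (j + 1)\<close> with index at least
    \<open>i\<close>. What remains is the coefficient at \<open>m\<close> of a series that does not
    depend on \<open>m\<close>.\<close>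
  have high: "R $ (m + i) = - ?c i" if "1 \<le> i" for i
  proof -
    have "(U ^ (j + 1) * ?T ?F) $ (m + i) = (\<Sum>l=0..m + i. (U ^ (j + 1)) $ l * ?T ?F $ (m + i - l))"
      by (rule fps_mult_nth)
    also have "\<dots> = (\<Sum>l=i..m + i. (U ^ (j + 1)) $ l * ?T ?F $ (m + i - l))"
      by (rule sum.mono_neutral_right) (use that in auto)
    also have "\<dots> = (\<Sum>n=0..m. (U ^ (j + 1)) $ (n + i) * ?T ?F $ (m - n))"
      by (rule sum.reindex_bij_witness[of _ "\<lambda>n. n + i" "\<lambda>l. l - i"]) auto
    also have "\<dots> = (\<Sum>n=0..m. (U ^ (j + 1)) $ (n + i) * ?F $ (m - n))"
      by (rule sum.cong) auto
    also have "\<dots> = ?c i"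
      unfolding fps_mult_nth by simp
    finally show ?thesis using that unfolding R_def by simp
  qed
  have R: "R = - (fps_X ^ m * (\<Sum>i\<in>{1..j + 1}. fps_const (?c i) * fps_X ^ i))"
  proof (rule fps_ext)
    fix n
    have S: "(\<Sum>i\<in>{1..j + 1}. fps_const (?c i) * fps_X ^ i) $ k = (if 1 \<le> k \<and> k \<le> j + 1 then ?c k else 0)" for k
    proof -
      have "(\<Sum>i\<in>{1..j + 1}. fps_const (?c i) * fps_X ^ i) $ k = (\<Sum>i\<in>{1..j + 1}. if k = i then ?c i else 0)"
        unfolding fps_sum_nth by (rule sum.cong) (auto simp: fps_X_power_nth simp del: power_Suc)
      then show ?thesis by (subst (asm) sum.delta') auto
    qed
    show "R $ n = (- (fps_X ^ m * (\<Sum>i\<in>{1..j + 1}. fps_const (?c i) * fps_X ^ i))) $ n"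
    proof (cases "n \<le> m")
      case True
      then show ?thesis using low S[of 0] by (auto simp: fps_X_power_mult_nth simp del: power_Suc)
    next
      case False
      define i where "i = n - m"
      have i: "n = m + i" "1 \<le> i" using False by (auto simp: i_def)
      have "?c i = 0" if "\<not> i \<le> j + 1"
      proof -
        have "fps_shift i (U ^ (j + 1)) = 0"
          by (rule fps_ext) (use that in \<open>auto intro!: U_power_nth_eq_0 simp del: power_Suc\<close>)
        then show ?thesis by simp
      qed
      then show ?thesis unfolding i(1) high[OF i(2)] fps_neg_nth fps_X_power_mult_nth S using i(2) by auto
    qed
  qed
  have "fps_X ^ m * join m ?F = cb * (fps_X ^ m * shift m ?F + fps_X ^ m * (2 * G m) * ?F)"
    by (simp add: join_def algebra_simps)
  also have "\<dots> = cb * (?T (U * cb) * (cb * ?F) - ?T ?F)"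
    unfolding X_power_shift X_power_G by (simp add: algebra_simps)
  finally have "U ^ (j + 1) * (fps_X ^ m * join m ?F) = cb * (?T (U * cb) * (U ^ (j + 1) * cb * ?F) - U ^ (j + 1) * ?T ?F)"
    by (simp only: right_diff_distrib mult.left_commute[of "U ^ (j + 1)"] mult.assoc)
  then have "U ^ (j + 1) * (fps_X ^ m * join m ?F) = cb * R"
    unfolding UF' R_def by simp
  also have "cb * R = U ^ (j + 1) * (fps_X ^ m * - (\<Sum>i\<in>{1..j + 1}. fps_const (?c i) * (fps_X ^ i * cb ^ (2 * j + 3))))"
  proof -
    have "U ^ (j + 1) * cb ^ (2 * j + 3) = cb"
      using U_power_cb[of "j + 1" 1] by (simp add: eval_nat_numeral)
    then have "cb * R = U ^ (j + 1) * cb ^ (2 * j + 3) * R" by simp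
    moreover have "(\<Sum>i\<in>{1..j + 1}. fps_const (?c i) * (fps_X ^ i * cb ^ (2 * j + 3)))
      = (\<Sum>i\<in>{1..j + 1}. fps_const (?c i) * fps_X ^ i) * cb ^ (2 * j + 3)"
      by (simp only: sum_distrib_right mult.assoc)
    ultimately show ?thesis unfolding R by (simp only: mult_minus_right mult_minus_left mult_ac)
  qed
  finally show ?thesis by simp
qed

lemma odd_span_poly_mult:
  assumes "\<And>n. s < n \<Longrightarrow> P $ n = 0" "s \<le> j"
  shows "P * cb ^ (2 * j + 1) \<in> odd_span"
proof -
  have "P = (\<Sum>n\<in>{..s}. fps_const (P $ n) * fps_X ^ n)"
  proof (rule fps_ext)
    fix k
    show "P $ k = (\<Sum>n\<in>{..s}. fps_const (P $ n) * fps_X ^ n) $ k"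
      using assms(1)[of k] by (simp add: fps_sum_nth if_distrib[of "\<lambda>x. _ * x"] sum.delta' cong: if_cong)
  qed
  then have "P * cb ^ (2 * j + 1) = (\<Sum>n\<in>{..s}. fps_const (P $ n) * fps_X ^ n) * cb ^ (2 * j + 1)" by (rule arg_cong)
  also have "\<dots> = (\<Sum>n\<in>{..s}. fps_const (P $ n) * (fps_X ^ n * cb ^ (2 * j + 1)))"
    by (simp only: sum_distrib_right mult.assoc)
  also have "\<dots> \<in> odd_span"
    by (intro odd_span_sum odd_span_scale odd_span_X_power) (use assms(2) in auto)
  finally show ?thesis .
qed

text \<open>\<open>m\<close> enters only as the index of a coefficient of a series in the span. In
  this form \<open>join\<close> creates a new tensor factor in the variable
  \<open>m\<close>.\<close>

lemma join_odd_span: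
  assumes "F \<in> odd_span"
  shows "\<exists>cs. (\<forall>(c, w)\<in>set cs. c \<in> odd_span \<and> w \<in> odd_span) \<and>
    (\<forall>m. join m F = (\<Sum>(c, w)\<leftarrow>cs. fps_const (c $ m) * w))"
  using assms
proof (induction rule: odd_span.induct)
  case zero
  show ?case by (intro exI[of _ "[]"]) simp
next
  case (step F a j)
  then obtain cs where cs: "\<forall>(c, w)\<in>set cs. c \<in> odd_span \<and> w \<in> odd_span"
    "\<forall>m. join m F = (\<Sum>(c, w)\<leftarrow>cs. fps_const (c $ m) * w)" by blast
  let ?p = "\<lambda>i. (fps_shift i (U ^ (j + 1)) * cb ^ (2 * j + 1), fps_const (- a) * (fps_X ^ i * cb ^ (2 * j + 3)))"
  let ?ds = "map ?p [1..<j + 2]"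
  \<comment> \<open>The shift by \<open>i \<ge> 1\<close> leaves a polynomial of degree at most
    \<open>j + 1 - i \<le> j\<close>, low enough for \<open>cb ^ (2 * j + 1)\<close> to absorb
    it.\<close>
  have 1: "fps_shift i (U ^ (j + 1)) * cb ^ (2 * j + 1) \<in> odd_span" if "1 \<le> i" "i \<le> j + 1" for i
    by (rule odd_span_poly_mult[of "j + 1 - i"])
      (use that in \<open>auto intro!: U_power_nth_eq_0 simp del: power_Suc\<close>)
  have 2: "fps_const (- a) * (fps_X ^ i * cb ^ (2 * j + 3)) \<in> odd_span" if "i \<le> j + 1" for i
    using odd_span_scale[OF odd_span_X_power[OF that], of "- a"] by (simp add: eval_nat_numeral)
  have "join m (fps_const a * cb ^ (2 * j + 1)) = (\<Sum>(c, w)\<leftarrow>?ds. fps_const (c $ m) * w)" for m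
  proof -
    have "join m (fps_const a * cb ^ (2 * j + 1)) = (\<Sum>i\<in>{1..j + 1}. fps_const (fst (?p i) $ m) * snd (?p i))"
      unfolding join_const_mult join_power
      by (simp only: fst_conv snd_conv mult_minus_right sum_distrib_left sum_negf[symmetric] fps_const_neg[symmetric] mult_minus_left)
        (rule sum.cong; simp only: mult.left_commute)
    also have "\<dots> = (\<Sum>i\<leftarrow>[1..<j + 2]. fps_const (fst (?p i) $ m) * snd (?p i))"
      unfolding interv_sum_list_conv_sum_set_nat by (rule sum.cong) auto
    finally show ?thesis by (simp only: map_map comp_def split_beta)
  qed
  then have "\<forall>m. join m (fps_const a * cb ^ (2 * j + 1) + F) = (\<Sum>(c, w)\<leftarrow>?ds @ cs. fps_const (c $ m) * w)"
    unfolding join_add by (simp only: map_append sum_list_append cs(2)[rule_format]) simp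
  moreover have "\<forall>(c, w)\<in>set (?ds @ cs). c \<in> odd_span \<and> w \<in> odd_span"
    using cs(1) 1 2 by (auto simp del: power_Suc)
  ultimately show ?case by blast
qed

section \<open>Coefficients of the two-part series in genus 0 and the explicit base cases\<close>

lemma cat_nth_Suc: "cat $ Suc m = cb $ m / of_nat (Suc m)"
proof -
  have "cat $ Suc m = - (cb $ Suc m - 4 * cb $ m) / 2"
    by (simp add: cat_def U_mult_nth_Suc)
  moreover have "cb $ Suc m = 2 * (2 * of_nat m + 1) * cb $ m / of_nat (Suc m)"
    using cb_nth_Suc[of m] by (simp add: field_simps del: of_nat_Suc)
  ultimately show ?thesis by (simp add: field_simps)
qed

lemma cat_nth_0 [simp]: "cat $ 0 = 0"
  by (simp add: cat_def)

lemma G_nth_0 [simp]: "G m $ 0 = 0"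
  by (simp add: G_def shift_def)

text \<open>Induction on \<open>m\<close>: \<open>X * G (Suc m)\<close> differs from
  \<open>G m\<close> only by the coefficient of \<open>cat\<close> that the longer shift drops,
  multiplied by \<open>X * cb\<close>. The denominator \<open>k + m\<close> is what keeps the pair
  \<open>(0, 2)\<close> out of the theorem.\<close>

lemma G_nth: "0 < k \<Longrightarrow> G m $ k = of_nat k * cb $ k * cb $ m / (2 * of_nat (k + m))"
proof (induction m arbitrary: k)
  case 0
  have "shift 0 cat = cat" by (rule fps_ext) (auto simp: shift_def)
  then have "G 0 = cb * cat" by (simp add: G_def)
  also have "\<dots> = fps_const (1 / 2) * (cb - U * (cb * cb))"
    unfolding cat_def by (simp add: algebra_simps)
  also have "\<dots> = fps_const (1 / 2) * (cb - 1)" unfolding U_cb_cb ..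
  finally have "G 0 $ k = (fps_const (1 / 2) * (cb - 1)) $ k" by (rule arg_cong)
  then have "G 0 $ k = cb $ k / 2" using 0 by simp
  then show ?case using 0 by simp
next
  case (Suc m)
  have "fps_X * shift (Suc m) cat = shift m cat - fps_const (cat $ Suc m) * fps_X"
  proof (rule fps_ext)
    fix n
    show "(fps_X * shift (Suc m) cat) $ n = (shift m cat - fps_const (cat $ Suc m) * fps_X) $ n"
      by (cases "n = 0"; cases "n = 1") (auto simp: shift_def fps_X_nth)
  qed
  then have "cb * (fps_X * shift (Suc m) cat) = cb * (shift m cat - fps_const (cat $ Suc m) * fps_X)" by simp
  then have "fps_X * G (Suc m) = G m - fps_const (cat $ Suc m) * (fps_X * cb)"
    unfolding G_def by (simp only: right_diff_distrib mult_ac)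
  then have "(fps_X * G (Suc m)) $ Suc k = (G m - fps_const (cat $ Suc m) * (fps_X * cb)) $ Suc k"
    by (rule arg_cong)
  then have "G (Suc m) $ k = G m $ Suc k - cb $ m / of_nat (Suc m) * cb $ k"
    by (simp add: cat_nth_Suc del: of_nat_Suc)
  also have "G m $ Suc k = (of_nat (Suc k) * cb $ Suc k) * cb $ m / (2 * of_nat (Suc k + m))"
    by (rule Suc.IH) simp
  also have "of_nat (Suc k) * cb $ Suc k = 2 * (2 * of_nat k + 1) * cb $ k" by (rule cb_nth_Suc)
  finally have 1: "G (Suc m) $ k = 2 * (2 * of_nat k + 1) * cb $ k * cb $ m / (2 * of_nat (Suc k + m)) - cb $ m / of_nat (Suc m) * cb $ k" .
  have 2: "cb $ Suc m = 2 * (2 * of_nat m + 1) * cb $ m / of_nat (Suc m)"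
    using cb_nth_Suc[of m] by (simp add: field_simps del: of_nat_Suc)
  have "(1 + of_nat m :: rat) \<noteq> 0" "(1 + (of_nat k + of_nat m) :: rat) \<noteq> 0"
    by (metis of_nat_Suc of_nat_neq_0, metis of_nat_Suc of_nat_add of_nat_neq_0)
  then show ?case unfolding 1 2 by (simp add: divide_simps) (simp add: algebra_simps)
qed

lemma cutoff_mult_nth_eq_0: "m + n < k \<Longrightarrow> (fps_cutoff (Suc m) F * fps_cutoff (Suc n) H) $ k = (0 :: rat)"
  unfolding fps_mult_nth by (rule sum.neutral) auto

text \<open>Multiplied by \<open>X\<^sup>m\<^sup>+\<^sup>n U\<close>, the sum of the three terms becomes a polynomial of degree \<open>m + n + 1\<close>,
  so that only one coefficient has to be computed.\<close>

lemma three_point: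
  assumes "0 < m" "0 < n"
  shows "cb * (shift m (G n) + shift n (G m) + 2 * G m * G n) = fps_const (2 * cb $ m * cb $ n) * (fps_X * cb ^ 3)"
proof -
  let ?tot = "shift m (G n) + shift n (G m) + 2 * G m * G n"
  let ?T = "\<lambda>m. fps_cutoff (Suc m)"
  let ?t = "\<lambda>m. ?T m (U * cb)"
  \<comment> \<open>A polynomial of degree at most \<open>m + n\<close>, gathering what the
    truncations leave over besides the product of the two truncated square roots.\<close>
  define S where "S = 1 + 2 * (fps_X ^ n * ?T m (G n)) + 2 * (fps_X ^ m * ?T n (G m))"
  have "fps_X ^ (m + n) * (2 * ?tot)
    = 2 * fps_X ^ n * (fps_X ^ m * shift m (G n)) + 2 * fps_X ^ m * (fps_X ^ n * shift n (G m))
      + (fps_X ^ m * (2 * G m)) * (fps_X ^ n * (2 * G n))"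
    by (simp add: power_add algebra_simps)
  also have "\<dots> = fps_X ^ n * (2 * G n) - 2 * (fps_X ^ n * ?T m (G n)) + (fps_X ^ m * (2 * G m) - 2 * (fps_X ^ m * ?T n (G m)))
      + (fps_X ^ m * (2 * G m)) * (fps_X ^ n * (2 * G n))"
    unfolding X_power_shift by (simp add: algebra_simps)
  also have "\<dots> = cb * cb * (?t m * ?t n) - S"
    unfolding X_power_G S_def by (simp add: algebra_simps)
  finally have "U * (fps_X ^ (m + n) * (2 * ?tot)) = U * (cb * cb * (?t m * ?t n) - S)" by (rule arg_cong)
  also have "\<dots> = (U * (cb * cb)) * (?t m * ?t n) - U * S"
    by (simp only: right_diff_distrib mult.assoc)
  also have "\<dots> = ?t m * ?t n - U * S" unfolding U_cb_cb by simp
  finally have R: "fps_X ^ (m + n) * (U * (2 * ?tot)) = ?t m * ?t n - U * S"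
    by (simp only: mult.left_commute)
  have S_high: "S $ k = 0" if "m + n < k" for k
    unfolding S_def using that assms by (auto simp: fps_X_power_mult_nth fps_numeral_fps_const)
  have "S $ (m + n) = 2 * G n $ m + 2 * G m $ n"
    unfolding S_def using assms by (auto simp: fps_X_power_mult_nth fps_numeral_fps_const)
  \<comment> \<open>Here the denominators cancel: the two coefficients carry the numerators
    \<open>m\<close> and \<open>n\<close> over the common \<open>m + n\<close>.\<close>
  also have "\<dots> = cb $ m * cb $ n"
  proof -
    define s where "s = (of_nat m + of_nat n :: rat)"
    have s: "s \<noteq> 0" unfolding s_def using assms by (metis add_is_0 not_gr0 of_nat_add of_nat_eq_0_iff)
    have "G n $ m = of_nat m * (cb $ m * cb $ n) / (2 * s)" "G m $ n = of_nat n * (cb $ m * cb $ n) / (2 * s)"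
      using G_nth[OF assms(1), of n] G_nth[OF assms(2), of m] by (simp_all add: s_def mult_ac add.commute)
    then have "2 * G n $ m = of_nat m * (cb $ m * cb $ n) / s" "2 * G m $ n = of_nat n * (cb $ m * cb $ n) / s"
      by simp_all
    then have "2 * G n $ m + 2 * G m $ n = (of_nat m + of_nat n) * (cb $ m * cb $ n) / s"
      by (simp only: add_divide_distrib distrib_right)
    then have "2 * G n $ m + 2 * G m $ n = s * (cb $ m * cb $ n) / s" unfolding s_def[symmetric] .
    then show ?thesis using s by simp
  qed
  finally have S_mid: "S $ (m + n) = cb $ m * cb $ n" .
  have "(U * (2 * ?tot)) $ k = (fps_const (4 * cb $ m * cb $ n) * fps_X) $ k" for k
  proof -
    consider "k = 0" | l where "k = Suc l" by (cases k) auto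
    then show ?thesis
    proof cases
      case 1
      then show ?thesis by (simp add: shift_def)
    next
      case 2
      have "(U * (2 * ?tot)) $ k = (fps_X ^ (m + n) * (U * (2 * ?tot))) $ (m + n + k)"
        by (simp add: fps_X_power_mult_nth)
      also have "\<dots> = (?t m * ?t n) $ (m + n + k) - (U * S) $ Suc (m + n + l)"
        unfolding R 2 by simp
      also have "(?t m * ?t n) $ (m + n + k) = 0" by (rule cutoff_mult_nth_eq_0) (use 2 in simp)
      also have "(U * S) $ Suc (m + n + l) = S $ Suc (m + n + l) - 4 * S $ (m + n + l)"
        by (rule U_mult_nth_Suc)
      also have "S $ Suc (m + n + l) = 0" by (rule S_high) simp
      also have "S $ (m + n + l) = (if l = 0 then cb $ m * cb $ n else 0)"
        using S_mid S_high[of "m + n + l"] by auto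
      finally show ?thesis using 2 by (auto simp: fps_X_nth)
    qed
  qed
  then have UW: "U * (2 * ?tot) = fps_const (4 * cb $ m * cb $ n) * fps_X" by (rule fps_ext)
  define W a where "W = ?tot" and "a = fps_const (2 * cb $ m * cb $ n)"
  have "fps_const (4 * cb $ m * cb $ n) = 2 * a"
    by (simp add: a_def fps_numeral_fps_const)
  with UW have W: "U * (2 * W) = 2 * a * fps_X" unfolding W_def by simp
  have "2 * (cb * W) = 2 * (cb * W * (U * (cb * cb)))" by (simp only: U_cb_cb mult_1_right)
  also have "\<dots> = (U * (2 * W)) * cb ^ 3" by (simp only: power3_eq_cube mult_ac)
  also have "\<dots> = 2 * (a * (fps_X * cb ^ 3))" unfolding W by (simp only: mult_ac)
  finally have "cb * W = a * (fps_X * cb ^ 3)" by simp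
  then show ?thesis unfolding W_def a_def .
qed

lemma theta_mult: "theta (F * H) = theta F * H + F * theta H"
  by (simp add: theta_def algebra_simps)

lemma theta_power: "theta (F ^ n) = of_nat n * F ^ (n - 1) * theta F"
  unfolding theta_def fps_deriv_power by (simp only: fps_of_nat mult_ac)

text \<open>\<open>theta\<close> removes the denominator \<open>k\<close> and turns the convolution
  into half the square of \<open>theta cb\<close>. Writing \<open>cb ^ 4\<close> as
  \<open>U * cb ^ 6\<close> shows that the right-hand side has the same image, and
  \<open>theta\<close> is injective on series without constant term.\<close>

lemma one_point_genus_one:
  "Abs_fps (\<lambda>k. \<Sum>a\<le>k. of_nat a * of_nat (k - a) * (cb $ a * cb $ (k - a) / (2 * of_nat k))) = fps_X ^ 2 * cb ^ 4"
  (is "?D = ?E")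
proof -
  have "theta ?D = fps_const (1 / 2) * (theta cb * theta cb)"
  proof (rule fps_ext)
    fix k
    show "theta ?D $ k = (fps_const (1 / 2) * (theta cb * theta cb)) $ k"
    proof (cases "k = 0")
      case False
      have "theta ?D $ k = (\<Sum>a\<le>k. of_nat k * (of_nat a * of_nat (k - a) * (cb $ a * cb $ (k - a) / (2 * of_nat k))))"
        by (simp add: theta_nth sum_distrib_left)
      also have "\<dots> = (\<Sum>a\<le>k. 1 / 2 * (theta cb $ a * theta cb $ (k - a)))"
        by (rule sum.cong) (use False in \<open>auto simp: theta_nth field_simps\<close>)
      also have "\<dots> = 1 / 2 * (theta cb * theta cb) $ k"
        by (simp only: fps_mult_nth sum_distrib_left atLeast0AtMost)
      finally show ?thesis by (simp only: fps_mult_left_const_nth)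
    qed (simp add: theta_nth)
  qed
  also have "\<dots> = (fps_const (1 / 2) * 2) * (2 * fps_X ^ 2 * (cb ^ 3 * cb ^ 3))"
    unfolding theta_cb by (simp only: power2_eq_square mult_ac)
  also have "fps_const (1 / 2) * 2 = (1 :: rat fps)" by (simp add: fps_numeral_fps_const)
  also have "1 * (2 * fps_X ^ 2 * (cb ^ 3 * cb ^ 3)) = 2 * fps_X ^ 2 * (U * (cb ^ 3 * cb ^ 3)) + 4 * fps_X ^ 2 * cb ^ 3 * (2 * fps_X * cb ^ 3)"
  proof -
    have four: "fps_const 4 = (4 :: rat fps)" by (simp add: fps_numeral_fps_const)
    show ?thesis unfolding U_def four by (simp add: algebra_simps)
  qed
  also have "U * (cb ^ 3 * cb ^ 3) = cb ^ 4" using U_power_cb[of 1 4] by (simp flip: power_add)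
  also have "2 * fps_X ^ 2 * cb ^ 4 + 4 * fps_X ^ 2 * cb ^ 3 * (2 * fps_X * cb ^ 3) = theta ?E"
  proof -
    have "theta (cb ^ 4) = of_nat 4 * cb ^ (4 - 1) * theta cb" by (rule theta_power)
    moreover have "theta (fps_X ^ 2) = of_nat 2 * fps_X ^ (2 - 1) * theta fps_X" by (rule theta_power)
    moreover have "theta fps_X = fps_X" by (simp add: theta_def)
    ultimately show ?thesis unfolding theta_mult theta_cb by (simp add: power2_eq_square algebra_simps)
  qed
  finally have th: "theta ?D = theta ?E" .
  show ?thesis
  proof (rule fps_ext)
    fix k
    show "?D $ k = ?E $ k"
    proof (cases "k = 0")
      case False
      then show ?thesis using arg_cong[OF th, of "\<lambda>F. F $ k"] unfolding theta_nth by simp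
    qed (simp add: fps_X_power_mult_nth)
  qed
qed

section \<open>Tensors of odd powers\<close>

text \<open>Elements of a tensor power of \<open>odd_span\<close>: the factors indexed by
  \<open>T\<close> are evaluated as coefficients at \<open>x i\<close>, the remaining factor stays a
  series.\<close>

inductive tens :: "'i set \<Rightarrow> (('i \<Rightarrow> nat) \<Rightarrow> rat fps) \<Rightarrow> bool" for T where
  tens_0: "tens T (\<lambda>x. 0)"
| tens_step: "tens T \<Phi> \<Longrightarrow> (\<And>i. i \<in> T \<Longrightarrow> v i \<in> odd_span) \<Longrightarrow> w \<in> odd_span \<Longrightarrow>
    tens T (\<lambda>x. fps_const (\<Prod>i\<in>T. v i $ x i) * w + \<Phi> x)"

lemma tens_single:
  "(\<And>i. i \<in> T \<Longrightarrow> v i \<in> odd_span) \<Longrightarrow> w \<in> odd_span \<Longrightarrow> tens T (\<lambda>x. fps_const (\<Prod>i\<in>T. v i $ x i) * w)"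
  using tens_step[OF tens_0, of T v w] by simp

lemma tens_add:
  assumes "tens T \<Phi>" "tens T \<Psi>"
  shows "tens T (\<lambda>x. \<Phi> x + \<Psi> x)"
  using assms(1)
proof induction
  case (tens_step \<Phi> v w)
  show ?case unfolding add.assoc by (rule tens.tens_step) (use tens_step in auto)
qed (simp add: assms(2))

lemma tens_sum: "(\<And>b. b \<in> B \<Longrightarrow> tens T (\<Phi> b)) \<Longrightarrow> tens T (\<lambda>x. \<Sum>b\<in>B. \<Phi> b x)"
  by (induction B rule: infinite_finite_induct) (auto intro: tens_0 tens_add)

lemma tens_sum_list: "(\<And>b. b \<in> set bs \<Longrightarrow> tens T (\<Phi> b)) \<Longrightarrow> tens T (\<lambda>x. \<Sum>b\<leftarrow>bs. \<Phi> b x)"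
  by (induction bs) (auto intro: tens_0 tens_add)

lemma tens_linear:
  assumes "tens T \<Phi>"
    and single: "\<And>v w. (\<And>i. i \<in> T \<Longrightarrow> v i \<in> odd_span) \<Longrightarrow> w \<in> odd_span \<Longrightarrow>
      tens T' (\<lambda>x. h x (\<lambda>y. fps_const (\<Prod>i\<in>T. v i $ y i) * w))"
    and add: "\<And>x \<Phi> \<Psi>. h x (\<lambda>y. \<Phi> y + \<Psi> y) = h x \<Phi> + h x \<Psi>" and zero: "\<And>x. h x (\<lambda>y. 0) = 0"
  shows "tens T' (\<lambda>x. h x \<Phi>)"
  using assms(1)
proof induction
  case (tens_step \<Phi> v w)
  show ?case unfolding add by (intro tens_add single tens_step)
qed (simp add: zero tens_0)

text \<open>The coefficient series from \<open>join_odd_span\<close> become the factors at the new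
  index \<open>i\<close>.\<close>

lemma tens_join:
  assumes "tens (T - {i}) \<Phi>" "i \<in> T" "finite T"
  shows "tens T (\<lambda>x. join (x i) (\<Phi> x))"
proof (rule tens_linear[OF assms(1), where h = "\<lambda>x \<Phi>. join (x i) (\<Phi> x)"])
  fix v w assume v: "\<And>j. j \<in> T - {i} \<Longrightarrow> v j \<in> odd_span" and w: "w \<in> odd_span"
  obtain cs where cs: "\<forall>(c, u)\<in>set cs. c \<in> odd_span \<and> u \<in> odd_span"
    "\<And>m. join m w = (\<Sum>(c, u)\<leftarrow>cs. fps_const (c $ m) * u)" using join_odd_span[OF w] by blast
  have "join (x i) (fps_const (\<Prod>j\<in>T - {i}. v j $ x j) * w)
    = (\<Sum>b\<leftarrow>cs. fps_const (\<Prod>j\<in>T. (v(i := fst b)) j $ x j) * snd b)" for x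
  proof -
    have eq: "fps_const (\<Prod>j\<in>T - {i}. v j $ x j) * (fps_const (fst b $ x i) * snd b)
      = fps_const (\<Prod>j\<in>T. (v(i := fst b)) j $ x j) * snd b" for b :: "rat fps \<times> rat fps"
    proof -
      have "(\<Prod>j\<in>T. (v(i := fst b)) j $ x j) = (v(i := fst b)) i $ x i * (\<Prod>j\<in>T - {i}. (v(i := fst b)) j $ x j)"
        using assms(2,3) by (rule prod.remove[rotated])
      also have "(\<Prod>j\<in>T - {i}. (v(i := fst b)) j $ x j) = (\<Prod>j\<in>T - {i}. v j $ x j)"
        by (rule prod.cong) auto
      finally show ?thesis by (simp add: mult_ac flip: fps_const_mult mult.assoc)
    qed
    show ?thesis
      unfolding join_const_mult cs(2) split_beta sum_list_const_mult[symmetric] eq ..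
  qed
  moreover have "tens T (\<lambda>x. \<Sum>b\<leftarrow>cs. fps_const (\<Prod>j\<in>T. (v(i := fst b)) j $ x j) * snd b)"
  proof (rule tens_sum_list)
    fix b assume b: "b \<in> set cs"
    then have "fst b \<in> odd_span" "snd b \<in> odd_span" using cs(1) by auto
    then show "tens T (\<lambda>x. fps_const (\<Prod>j\<in>T. (v(i := fst b)) j $ x j) * snd b)"
      by (intro tens_single) (use v in auto)
  qed
  ultimately show "tens T (\<lambda>x. join (x i) (fps_const (\<Prod>j\<in>T - {i}. v j $ x j) * w))" by simp
qed (auto simp: join_add)

lemma tens_mult:
  assumes "tens I \<Phi>" "tens J \<Psi>" "I \<inter> J = {}" "finite I" "finite J"
  shows "tens (I \<union> J) (\<lambda>x. cb * \<Phi> x * \<Psi> x)"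
proof (rule tens_linear[OF assms(1), where h = "\<lambda>x \<Phi>. cb * \<Phi> x * \<Psi> x"])
  fix v w assume v: "\<And>i. i \<in> I \<Longrightarrow> v i \<in> odd_span" "w \<in> odd_span"
  show "tens (I \<union> J) (\<lambda>x. cb * (fps_const (\<Prod>i\<in>I. v i $ x i) * w) * \<Psi> x)"
  proof (rule tens_linear[OF assms(2), where h = "\<lambda>x \<Psi>. cb * (fps_const (\<Prod>i\<in>I. v i $ x i) * w) * \<Psi> x"])
    fix v' w' assume v': "\<And>i. i \<in> J \<Longrightarrow> v' i \<in> odd_span" "w' \<in> odd_span"
    let ?v = "\<lambda>i. if i \<in> I then v i else v' i"
    have "cb * (fps_const (\<Prod>i\<in>I. v i $ x i) * w) * (fps_const (\<Prod>i\<in>J. v' i $ x i) * w')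
      = fps_const (\<Prod>i\<in>I \<union> J. ?v i $ x i) * (cb * w * w')" for x
    proof -
      have "(\<Prod>i\<in>I \<union> J. ?v i $ x i) = (\<Prod>i\<in>I. ?v i $ x i) * (\<Prod>i\<in>J. ?v i $ x i)"
        using assms by (intro prod.union_disjoint) auto
      also have "(\<Prod>i\<in>I. ?v i $ x i) = (\<Prod>i\<in>I. v i $ x i)" by (rule prod.cong) auto
      also have "(\<Prod>i\<in>J. ?v i $ x i) = (\<Prod>i\<in>J. v' i $ x i)" by (rule prod.cong) (use assms(3) in auto)
      finally show ?thesis by (simp only: fps_const_mult[symmetric] mult_ac)
    qed
    moreover have "tens (I \<union> J) (\<lambda>x. fps_const (\<Prod>i\<in>I \<union> J. ?v i $ x i) * (cb * w * w'))"
      by (rule tens_single) (use v v' odd_span_triple in auto)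
    ultimately show "tens (I \<union> J) (\<lambda>x. cb * (fps_const (\<Prod>i\<in>I. v i $ x i) * w) * (fps_const (\<Prod>i\<in>J. v' i $ x i) * w'))"
      by (simp only:)
  qed (simp_all add: algebra_simps)
qed (simp_all add: algebra_simps)

text \<open>The variable \<open>e\<close> is identified with the variable of the series, after
  applying the Euler operator in \<open>e\<close>. On a pure tensor this is the product of
  \<open>w\<close> and \<open>theta (v e)\<close>, up to the scalar from the other factors.\<close>

definition diag :: "'i \<Rightarrow> (('i \<Rightarrow> nat) \<Rightarrow> rat fps) \<Rightarrow> ('i \<Rightarrow> nat) \<Rightarrow> rat fps" where
  "diag e \<Phi> x = Abs_fps (\<lambda>k. \<Sum>a\<le>k. of_nat (k - a) * \<Phi> (x(e := k - a)) $ a)"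

lemma tens_diag:
  assumes "tens (insert e T) \<Phi>" "e \<notin> T" "finite T"
  shows "tens T (\<lambda>x. cb * diag e \<Phi> x)"
proof (rule tens_linear[OF assms(1), where h = "\<lambda>x \<Phi>. cb * diag e \<Phi> x"])
  fix v w assume v: "\<And>i. i \<in> insert e T \<Longrightarrow> v i \<in> odd_span" and w: "w \<in> odd_span"
  have "diag e (\<lambda>y. fps_const (\<Prod>i\<in>insert e T. v i $ y i) * w) x = fps_const (\<Prod>i\<in>T. v i $ x i) * (w * theta (v e))" for x
  proof (rule fps_ext)
    fix k
    have p: "(\<Prod>i\<in>insert e T. v i $ (x(e := b)) i) = v e $ b * (\<Prod>i\<in>T. v i $ x i)" for b
    proof -
      have "(\<Prod>i\<in>T. v i $ (x(e := b)) i) = (\<Prod>i\<in>T. v i $ x i)" by (rule prod.cong) (use assms(2) in auto)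
      then show ?thesis using assms(2,3) by simp
    qed
    show "diag e (\<lambda>y. fps_const (\<Prod>i\<in>insert e T. v i $ y i) * w) x $ k = (fps_const (\<Prod>i\<in>T. v i $ x i) * (w * theta (v e))) $ k"
      unfolding diag_def p fps_nth_Abs_fps fps_mult_left_const_nth
      unfolding fps_mult_nth theta_nth sum_distrib_left atLeast0AtMost by (simp only: mult_ac)
  qed
  moreover have "tens T (\<lambda>x. fps_const (\<Prod>i\<in>T. v i $ x i) * (cb * w * theta (v e)))"
    by (rule tens_single) (use v w odd_span_triple odd_span_theta in auto)
  ultimately show "tens T (\<lambda>x. cb * diag e (\<lambda>y. fps_const (\<Prod>i\<in>insert e T. v i $ y i) * w) x)"
    by (simp add: mult_ac)
next
  show "cb * diag e (\<lambda>y. \<Phi> y + \<Psi> y) x = cb * diag e \<Phi> x + cb * diag e \<Psi> x" for x \<Phi> \<Psi>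
  proof -
    have "diag e (\<lambda>y. \<Phi> y + \<Psi> y) x = diag e \<Phi> x + diag e \<Psi> x"
      by (rule fps_ext) (simp only: diag_def fps_nth_Abs_fps fps_add_nth distrib_left sum.distrib)
    then show ?thesis by (simp only: distrib_left)
  qed
  show "cb * diag e (\<lambda>y. 0) x = 0" for x
    by (simp add: diag_def fps_zero_def)
qed

section \<open>The recursion by genus\<close>

definition genus_count :: "nat \<Rightarrow> nat multiset \<Rightarrow> int" where
  "genus_count g M = cycle_count (2 * g + size M + \<Sum>\<^sub># M - 2) M"

lemma parts_insert:
  assumes "finite S" "e \<notin> S"
  shows "parts (x(e := b)) (insert e S) = add_mset b (parts x S)"
proof -
  have "parts (x(e := b)) S = parts x S" by (rule parts_cong) (use assms in auto)
  then show ?thesis using assms by simp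
qed

lemma size_parts: "size (add_mset k (parts x S)) = Suc (card S)"
  by simp

lemma sum_parts: "\<Sum>\<^sub># (add_mset k (parts x S)) = k + (\<Sum>i\<in>S. x i)"
  by (simp add: sum_unfold_sum_mset)

text \<open>The Riemann-Hurwitz formula with a nonnegative integral genus. It follows from the
  recursion: removing a letter keeps the genus in a join, lowers it by one in a cut that stays
  connected, and distributes it over the two parts in a split.\<close>

lemma cycle_count_nonzero:
  fixes S :: "nat set"
  assumes "finite S" "\<And>i. i \<in> S \<Longrightarrow> 0 < x i" "0 < k" "cycle_count r (add_mset k (parts x S)) \<noteq> 0"
  shows "\<exists>g. r + 2 = 2 * g + Suc (card S) + (k + (\<Sum>i\<in>S. x i))"
  using assms
proof (induction r arbitrary: k S x rule: less_induct)
  case (less r')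
  show ?case
  proof (cases r')
    case 0
    have "cycle_count 0 (add_mset k (parts x S)) = of_bool (k = 1 \<and> S = {})"
      by (rule cycle_count_0) (use less.prems in auto)
    then have "k = 1 \<and> S = {}" using 0 less.prems(4) by (auto simp: of_bool_def split: if_splits)
    then show ?thesis using 0 by (intro exI[of _ 0]) simp
  next
    case (Suc r)
    let ?J = "\<lambda>i. cycle_count r (add_mset (k + x i) (parts x (S - {i})))"
    let ?A = "\<lambda>a. cycle_count r (add_mset a (add_mset (k - a) (parts x S)))"
    let ?B = "\<lambda>a I q. cycle_count q (add_mset a (parts x I)) * cycle_count (r - q) (add_mset (k - a) (parts x (S - I)))"
    have "cycle_count (Suc r) (add_mset k (parts x S))
      = (\<Sum>i\<in>S. int (x i) * ?J i) + (\<Sum>a\<in>{1..<k}. ?A a + (\<Sum>I\<in>Pow S. \<Sum>q\<le>r. ?B a I q))"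
      by (rule cycle_count_Suc) (use less.prems in auto)
    with less.prems(4) Suc
    have nz: "(\<Sum>i\<in>S. int (x i) * ?J i) + (\<Sum>a\<in>{1..<k}. ?A a + (\<Sum>I\<in>Pow S. \<Sum>q\<le>r. ?B a I q)) \<noteq> 0"
      by argo
    have "(\<exists>i\<in>S. ?J i \<noteq> 0) \<or> (\<exists>a\<in>{1..<k}. ?A a \<noteq> 0) \<or> (\<exists>a\<in>{1..<k}. \<exists>I\<in>Pow S. \<exists>q\<le>r. ?B a I q \<noteq> 0)"
    proof (rule ccontr)
      assume "\<not> ?thesis"
      then have z: "\<And>i. i \<in> S \<Longrightarrow> ?J i = 0" "\<And>a. a \<in> {1..<k} \<Longrightarrow> ?A a = 0"
        "\<And>a I q. a \<in> {1..<k} \<Longrightarrow> I \<in> Pow S \<Longrightarrow> q \<le> r \<Longrightarrow> ?B a I q = 0" by blast+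
      have "(\<Sum>i\<in>S. int (x i) * ?J i) = 0" by (rule sum.neutral) (use z(1) in simp)
      moreover have "(\<Sum>I\<in>Pow S. \<Sum>q\<le>r. ?B a I q) = 0" if "a \<in> {1..<k}" for a
        by (intro sum.neutral ballI) (use z(3)[OF that] in simp)
      then have "(\<Sum>a\<in>{1..<k}. ?A a + (\<Sum>I\<in>Pow S. \<Sum>q\<le>r. ?B a I q)) = 0"
        by (intro sum.neutral ballI) (use z(2) in simp)
      ultimately show False using nz by linarith
    qed
    then consider (join) i where "i \<in> S" "?J i \<noteq> 0" | (cut) a where "a \<in> {1..<k}" "?A a \<noteq> 0"
      | (split) a I q where "a \<in> {1..<k}" "I \<in> Pow S" "q \<le> r" "?B a I q \<noteq> 0" by blast
    then show ?thesis
    proof cases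
      case join
      have "\<exists>g. r + 2 = 2 * g + Suc (card (S - {i})) + (k + x i + (\<Sum>i\<in>S - {i}. x i))"
        by (rule less.IH) (use less.prems join Suc in auto)
      then obtain g where "r + 2 = 2 * g + Suc (card (S - {i})) + (k + x i + (\<Sum>i\<in>S - {i}. x i))" by blast
      moreover have "card S = Suc (card (S - {i}))" by (rule card_Suc_Diff1[OF less.prems(1) join(1), symmetric])
      moreover have "(\<Sum>i\<in>S. x i) = x i + (\<Sum>i\<in>S - {i}. x i)" by (rule sum.remove[OF less.prems(1) join(1)])
      ultimately show ?thesis unfolding Suc by (intro exI[of _ g]) linarith
    next
      case cut
      obtain e where e: "e \<notin> S" using less.prems(1) by (metis ex_new_if_finite infinite_UNIV_nat)
      let ?x = "x(e := k - a)"
      have p: "parts ?x (insert e S) = add_mset (k - a) (parts x S)" by (rule parts_insert[OF less.prems(1) e])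
      have "\<exists>g. r + 2 = 2 * g + Suc (card (insert e S)) + (a + (\<Sum>i\<in>insert e S. ?x i))"
      proof (rule less.IH)
        show "cycle_count r (add_mset a (parts ?x (insert e S))) \<noteq> 0" unfolding p using cut by simp
      qed (use less.prems cut Suc in auto)
      then obtain g where g: "r + 2 = 2 * g + Suc (card (insert e S)) + (a + (\<Sum>i\<in>insert e S. ?x i))" by blast
      have "(\<Sum>i\<in>S. ?x i) = (\<Sum>i\<in>S. x i)" by (rule sum.cong) (use e in auto)
      then have s1: "(\<Sum>i\<in>insert e S. ?x i) = (k - a) + (\<Sum>i\<in>S. x i)" using e less.prems(1) by simp
      have s2: "card (insert e S) = Suc (card S)" using e less.prems(1) by simp
      have "Suc r + 2 = 2 * Suc g + Suc (card S) + (k + (\<Sum>i\<in>S. x i))"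
        using g cut(1) unfolding s1 s2 by simp
      then show ?thesis unfolding Suc by (rule exI[of _ "Suc g"])
    next
      case split
      have I: "I \<subseteq> S" "finite I" using split less.prems(1) by (auto intro: finite_subset)
      have "\<exists>g. q + 2 = 2 * g + Suc (card I) + (a + (\<Sum>i\<in>I. x i))"
        by (rule less.IH) (use less.prems split Suc I in auto)
      moreover have "\<exists>g. r - q + 2 = 2 * g + Suc (card (S - I)) + ((k - a) + (\<Sum>i\<in>S - I. x i))"
        by (rule less.IH) (use less.prems split Suc in auto)
      ultimately obtain g h where gh: "q + 2 = 2 * g + Suc (card I) + (a + (\<Sum>i\<in>I. x i))"
        "r - q + 2 = 2 * h + Suc (card (S - I)) + ((k - a) + (\<Sum>i\<in>S - I. x i))" by blast
      have "card S = card I + card (S - I)"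
        using I less.prems(1) by (simp add: card_Diff_subset card_mono)
      moreover have "(\<Sum>i\<in>S. x i) = (\<Sum>i\<in>S - I. x i) + (\<Sum>i\<in>I. x i)"
        by (rule sum.subset_diff[OF I(1) less.prems(1)])
      moreover obtain u v where uv: "r - q = u" "k - a = v" "k = a + v" "r = q + u"
        using split by (metis atLeastLessThan_iff le_add_diff_inverse less_imp_le)
      ultimately have "Suc r + 2 = 2 * (g + h) + Suc (card S) + (k + (\<Sum>i\<in>S. x i))"
        using gh unfolding uv(1,2) by simp
      then show ?thesis unfolding Suc by (rule exI[of _ "g + h"])
    qed
  qed
qed

lemma genus_count_eq:
  "finite S \<Longrightarrow> genus_count g (add_mset k (parts x S)) = cycle_count (2 * g + Suc (card S) + (k + (\<Sum>i\<in>S. x i)) - 2) (add_mset k (parts x S))"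
  unfolding genus_count_def size_parts sum_parts by simp

text \<open>A length \<open>q\<close> contributes only if both factors have a genus, by
  \<open>cycle_count_nonzero\<close>; then \<open>q\<close> is determined by \<open>h\<close>, and
  the convolution in lengths becomes one in genera.\<close>

lemma genus_count_convolution:
  fixes I J :: "nat set"
  assumes I: "finite I" "\<And>i. i \<in> I \<Longrightarrow> 0 < x i" "0 < a" and J: "finite J" "\<And>i. i \<in> J \<Longrightarrow> 0 < x i" "0 < b"
    and r: "r + 4 = 2 * g + (Suc (card I) + (a + (\<Sum>i\<in>I. x i))) + (Suc (card J) + (b + (\<Sum>i\<in>J. x i)))"
  shows "(\<Sum>q\<le>r. cycle_count q (add_mset a (parts x I)) * cycle_count (r - q) (add_mset b (parts x J)))
    = (\<Sum>h\<le>g. genus_count h (add_mset a (parts x I)) * genus_count (g - h) (add_mset b (parts x J)))"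
proof -
  define m n where "m = Suc (card I) + (a + (\<Sum>i\<in>I. x i))" and "n = Suc (card J) + (b + (\<Sum>i\<in>J. x i))"
  have mn: "2 \<le> m" "2 \<le> n" "r + 4 = 2 * g + m + n" using r I(3) J(3) by (auto simp: m_def n_def)
  let ?f = "\<lambda>h. 2 * h + m - 2"
  let ?t = "\<lambda>q. cycle_count q (add_mset a (parts x I)) * cycle_count (r - q) (add_mset b (parts x J))"
  have inj: "inj_on ?f {..g}" using mn by (auto intro!: inj_onI)
  have "(\<Sum>q\<le>r. ?t q) = (\<Sum>q\<in>?f ` {..g}. ?t q)"
  proof (rule sum.mono_neutral_right)
    show "?f ` {..g} \<subseteq> {..r}" using mn by auto
    show "\<forall>q\<in>{..r} - ?f ` {..g}. ?t q = 0"
    proof (intro ballI, rule ccontr)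
      fix q assume q: "q \<in> {..r} - ?f ` {..g}" "?t q \<noteq> 0"
      have "\<exists>h. q + 2 = 2 * h + Suc (card I) + (a + (\<Sum>i\<in>I. x i))"
        by (rule cycle_count_nonzero) (use I q in auto)
      moreover have "\<exists>h. r - q + 2 = 2 * h + Suc (card J) + (b + (\<Sum>i\<in>J. x i))"
        by (rule cycle_count_nonzero) (use J q in auto)
      ultimately obtain h h' where h: "q + 2 = 2 * h + m" "r - q + 2 = 2 * h' + n"
        unfolding m_def n_def by (metis add.assoc)
      then have "q = ?f h" "h \<le> g" using mn q by auto
      then show False using q by blast
    qed
  qed simp
  also have "\<dots> = (\<Sum>h\<le>g. ?t (?f h))" by (subst sum.reindex[OF inj]) simp
  also have "\<dots> = (\<Sum>h\<le>g. genus_count h (add_mset a (parts x I)) * genus_count (g - h) (add_mset b (parts x J)))"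
  proof (rule sum.cong[OF refl])
    fix h assume "h \<in> {..g}"
    then have "r - ?f h = 2 * (g - h) + n - 2" using mn by auto
    then show "?t (?f h) = genus_count h (add_mset a (parts x I)) * genus_count (g - h) (add_mset b (parts x J))"
      unfolding genus_count_eq[OF I(1)] genus_count_eq[OF J(1)] m_def n_def by (simp only: add.assoc)
  qed
  finally show ?thesis .
qed

lemma genus_count_rec:
  fixes S :: "nat set"
  assumes S: "finite S" "\<And>i. i \<in> S \<Longrightarrow> 0 < x i" and k: "0 < k"
  shows "genus_count g (add_mset k (parts x S)) = of_bool (g = 0 \<and> k = 1 \<and> S = {})
    + (\<Sum>i\<in>S. int (x i) * genus_count g (add_mset (k + x i) (parts x (S - {i}))))
    + (\<Sum>a\<in>{1..<k}. (if g = 0 then 0 else genus_count (g - 1) (add_mset a (add_mset (k - a) (parts x S))))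
       + (\<Sum>I\<in>Pow S. \<Sum>h\<le>g. genus_count h (add_mset a (parts x I)) * genus_count (g - h) (add_mset (k - a) (parts x (S - I)))))"
proof -
  define n where "n = Suc (card S) + (k + (\<Sum>i\<in>S. x i))"
  have gc: "genus_count g (add_mset k (parts x S)) = cycle_count (2 * g + n - 2) (add_mset k (parts x S))" for g
    unfolding genus_count_eq[OF S(1)] n_def by (simp only: add.assoc)
  show ?thesis
  proof (cases "2 * g + n - 2")
    case 0
    then have g: "g = 0" and z: "card S + k \<le> 1" using k by (auto simp: n_def)
    then have "card S = 0" "k = 1" using k by auto
    moreover have "cycle_count 0 (add_mset k (parts x S)) = of_bool (k = 1 \<and> S = {})"
      by (rule cycle_count_0) (use S k in auto)
    ultimately show ?thesis using g gc[of 0] 0 S(1) by simp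
  next
    case (Suc r)
    have nb: "\<not> (g = 0 \<and> k = 1 \<and> S = {})" using Suc by (auto simp: n_def)
    have r: "r + 3 = 2 * g + n" using Suc k by (auto simp: n_def)
    have join: "cycle_count r (add_mset (k + x i) (parts x (S - {i}))) = genus_count g (add_mset (k + x i) (parts x (S - {i})))"
      if i: "i \<in> S" for i
    proof -
      have "card S = Suc (card (S - {i}))" by (rule card_Suc_Diff1[OF S(1) i, symmetric])
      moreover have "(\<Sum>i\<in>S. x i) = x i + (\<Sum>i\<in>S - {i}. x i)" by (rule sum.remove[OF S(1) i])
      ultimately have "r = 2 * g + Suc (card (S - {i})) + (k + x i + (\<Sum>i\<in>S - {i}. x i)) - 2"
        using r k unfolding n_def by linarith
      then show ?thesis using genus_count_eq[of "S - {i}" g "k + x i" x] S(1) by simp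
    qed
    have cut: "cycle_count r (add_mset a (add_mset (k - a) (parts x S)))
      = (if g = 0 then 0 else genus_count (g - 1) (add_mset a (add_mset (k - a) (parts x S))))" if a: "a \<in> {1..<k}" for a
    proof -
      obtain e where e: "e \<notin> S" using S(1) by (metis ex_new_if_finite infinite_UNIV_nat)
      let ?x = "x(e := k - a)"
      have p: "parts ?x (insert e S) = add_mset (k - a) (parts x S)" by (rule parts_insert[OF S(1) e])
      have "(\<Sum>i\<in>S. ?x i) = (\<Sum>i\<in>S. x i)" by (rule sum.cong) (use e in auto)
      then have "(\<Sum>i\<in>insert e S. ?x i) = (k - a) + (\<Sum>i\<in>S. x i)" using e S(1) by simp
      moreover have "card (insert e S) = Suc (card S)" using e S(1) by simp
      moreover have "a + (k - a) = k" using a by simp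
      ultimately have size: "Suc (card (insert e S)) + (a + (\<Sum>i\<in>insert e S. ?x i)) = Suc n"
        unfolding n_def by linarith
      have fin: "finite (insert e S)" using S(1) by simp
      show ?thesis
      proof (cases "g = 0")
        case True
        \<comment> \<open>The remaining connected word would have genus -1.\<close>
        have "cycle_count r (add_mset a (parts ?x (insert e S))) = 0"
        proof (rule ccontr)
          assume nz: "cycle_count r (add_mset a (parts ?x (insert e S))) \<noteq> 0"
          have "\<exists>h. r + 2 = 2 * h + Suc (card (insert e S)) + (a + (\<Sum>i\<in>insert e S. ?x i))"
            by (rule cycle_count_nonzero[OF fin _ _ nz]) (use S a in auto)
          then show False using size r True by auto
        qed
        then show ?thesis unfolding p using True by simp
      next
        case False
        then have "r = 2 * (g - 1) + Suc (card (insert e S)) + (a + (\<Sum>i\<in>insert e S. ?x i)) - 2"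
          using size r by simp
        then show ?thesis using genus_count_eq[OF fin, of "g - 1" a ?x] p False by simp
      qed
    qed
    have split: "(\<Sum>q\<le>r. cycle_count q (add_mset a (parts x I)) * cycle_count (r - q) (add_mset (k - a) (parts x (S - I))))
      = (\<Sum>h\<le>g. genus_count h (add_mset a (parts x I)) * genus_count (g - h) (add_mset (k - a) (parts x (S - I))))"
      if a: "a \<in> {1..<k}" and I: "I \<in> Pow S" for a I
    proof (rule genus_count_convolution)
      have I': "I \<subseteq> S" "finite I" using I S(1) by (auto intro: finite_subset)
      show "finite I" by fact
      have "card S = card I + card (S - I)" using I' S(1) by (simp add: card_Diff_subset card_mono)
      moreover have "(\<Sum>i\<in>S. x i) = (\<Sum>i\<in>S - I. x i) + (\<Sum>i\<in>I. x i)"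
        by (rule sum.subset_diff[OF I'(1) S(1)])
      moreover have "a + (k - a) = k" using a by auto
      ultimately show "r + 4 = 2 * g + (Suc (card I) + (a + (\<Sum>i\<in>I. x i))) + (Suc (card (S - I)) + ((k - a) + (\<Sum>i\<in>S - I. x i)))"
        using r unfolding n_def by linarith
    qed (use S a I in auto)
    have "genus_count g (add_mset k (parts x S)) = cycle_count (Suc r) (add_mset k (parts x S))"
      unfolding gc Suc ..
    also have "\<dots> = (\<Sum>i\<in>S. int (x i) * cycle_count r (add_mset (k + x i) (parts x (S - {i}))))
    + (\<Sum>a\<in>{1..<k}. cycle_count r (add_mset a (add_mset (k - a) (parts x S)))
       + (\<Sum>I\<in>Pow S. \<Sum>q\<le>r. cycle_count q (add_mset a (parts x I)) * cycle_count (r - q) (add_mset (k - a) (parts x (S - I)))))"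
      by (rule cycle_count_Suc) (use S k in auto)
    also have "(\<Sum>i\<in>S. int (x i) * cycle_count r (add_mset (k + x i) (parts x (S - {i}))))
      = (\<Sum>i\<in>S. int (x i) * genus_count g (add_mset (k + x i) (parts x (S - {i}))))"
      by (rule sum.cong[OF refl]) (simp only: join)
    also have "(\<Sum>a\<in>{1..<k}. cycle_count r (add_mset a (add_mset (k - a) (parts x S)))
       + (\<Sum>I\<in>Pow S. \<Sum>q\<le>r. cycle_count q (add_mset a (parts x I)) * cycle_count (r - q) (add_mset (k - a) (parts x (S - I)))))
      = (\<Sum>a\<in>{1..<k}. (if g = 0 then 0 else genus_count (g - 1) (add_mset a (add_mset (k - a) (parts x S))))
       + (\<Sum>I\<in>Pow S. \<Sum>h\<le>g. genus_count h (add_mset a (parts x I)) * genus_count (g - h) (add_mset (k - a) (parts x (S - I)))))"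
      by (rule sum.cong[OF refl], rule arg_cong2[of _ _ _ _ "(+)"], erule cut, rule sum.cong[OF refl], erule split)
    finally show ?thesis using nb by simp
  qed
qed

text \<open>The coefficient of \<open>X\<^sup>k\<close> is \<open>k\<close> times the normalized count
  \<open>|Aut \<alpha>| / |\<alpha>|! * H\<^sub>g(\<alpha>)\<close> for the partition with the parts \<open>k\<close> and \<open>x i\<close>, \<open>i \<in> T\<close>.\<close>

definition gen :: "nat \<Rightarrow> nat set \<Rightarrow> (nat \<Rightarrow> nat) \<Rightarrow> rat fps" where
  "gen g T x = Abs_fps (\<lambda>k. if k = 0 then 0 else
     of_int (genus_count g (add_mset k (parts x T))) / (\<Prod>i\<in>T. of_nat (x i)))"

lemma gen_nth_0 [simp]: "gen g T x $ 0 = 0"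
  by (simp add: gen_def)

lemma gen_nth: "0 < k \<Longrightarrow> gen g T x $ k = of_int (genus_count g (add_mset k (parts x T))) / (\<Prod>i\<in>T. of_nat (x i))"
  by (simp add: gen_def)

text \<open>Dividing by the \<open>x i\<close> absorbs the number of entries of the joined cycle, so
  a join becomes a plain shift; not dividing by \<open>k\<close> makes a split a Cauchy product. In
  a cut, \<open>e\<close> is a placeholder for the second piece, and the weight \<open>k - a\<close>
  in \<open>diag\<close> undoes the division by that piece.\<close>

lemma gen_rec:
  assumes T: "finite T" "\<And>i. i \<in> T \<Longrightarrow> 0 < x i" and e: "e \<notin> T"
  shows "gen g T x = (if g = 0 \<and> T = {} then fps_X else 0) + (\<Sum>i\<in>T. shift (x i) (gen g (T - {i}) x))
    + (if g = 0 then 0 else diag e (gen (g - 1) (insert e T)) x)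
    + (\<Sum>I\<in>Pow T. \<Sum>h\<le>g. gen h I x * gen (g - h) (T - I) x)"
proof (rule fps_ext)
  fix k
  let ?p = "\<lambda>T. \<Prod>i\<in>T. of_nat (x i) :: rat"
  have p: "?p I \<noteq> 0" if "I \<subseteq> T" for I
    using that T by (subst prod_zero_iff) (auto intro: finite_subset)
  show "gen g T x $ k = ((if g = 0 \<and> T = {} then fps_X else 0) + (\<Sum>i\<in>T. shift (x i) (gen g (T - {i}) x))
    + (if g = 0 then 0 else diag e (gen (g - 1) (insert e T)) x)
    + (\<Sum>I\<in>Pow T. \<Sum>h\<le>g. gen h I x * gen (g - h) (T - I) x)) $ k"
  proof (cases "k = 0")
    case True
    have "diag e (gen (g - 1) (insert e T)) x $ 0 = 0" by (simp add: diag_def)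
    moreover have "(\<Sum>i\<in>T. shift (x i) (gen g (T - {i}) x)) $ 0 = 0" by (simp add: fps_sum_nth shift_def)
    moreover have "(\<Sum>I\<in>Pow T. \<Sum>h\<le>g. gen h I x * gen (g - h) (T - I) x) $ 0 = 0" by (simp add: fps_sum_nth)
    ultimately show ?thesis using True by simp
  next
    case False
    then have k: "0 < k" by simp
    let ?C = "\<lambda>g M. of_int (genus_count g M) :: rat"
    have a1: "(of_bool (g = 0 \<and> k = 1 \<and> T = {}) :: rat) / ?p T = (if g = 0 \<and> T = {} then fps_X else 0) $ k"
      by (auto simp: fps_X_nth)
    have a2: "of_nat (x i) * ?C g (add_mset (k + x i) (parts x (T - {i}))) / ?p T = shift (x i) (gen g (T - {i}) x) $ k"
      if i: "i \<in> T" for i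
    proof -
      have "?p T = of_nat (x i) * ?p (T - {i})" using i T(1) by (rule prod.remove[rotated])
      moreover have "of_nat (x i) \<noteq> (0 :: rat)" using T(2)[OF i] by simp
      ultimately show ?thesis using k by (simp add: shift_def gen_nth)
    qed
    have "(\<Sum>a\<in>{1..<k}. ?C (g - 1) (add_mset a (add_mset (k - a) (parts x T)))) / ?p T
      = (\<Sum>a\<in>{1..<k}. of_nat (k - a) * gen (g - 1) (insert e T) (x(e := k - a)) $ a)"
      unfolding sum_divide_distrib
    proof (rule sum.cong[OF refl])
      fix a assume a: "a \<in> {1..<k}"
      have "(\<Prod>i\<in>T. of_nat ((x(e := k - a)) i)) = ?p T" by (rule prod.cong) (use e in auto)
      then have "(\<Prod>i\<in>insert e T. of_nat ((x(e := k - a)) i)) = of_nat (k - a) * ?p T" using e T(1) by simp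
      moreover have "of_nat (k - a) \<noteq> (0 :: rat)" using a by simp
      ultimately show "?C (g - 1) (add_mset a (add_mset (k - a) (parts x T))) / ?p T
        = of_nat (k - a) * gen (g - 1) (insert e T) (x(e := k - a)) $ a"
        using a gen_nth[of a "g - 1" "insert e T" "x(e := k - a)"] parts_insert[OF T(1) e, of x "k - a"]
        by (simp del: of_nat_diff)
    qed
    also have "\<dots> = (\<Sum>a\<le>k. of_nat (k - a) * gen (g - 1) (insert e T) (x(e := k - a)) $ a)"
    proof (rule sum.mono_neutral_left)
      show "\<forall>a\<in>{..k} - {1..<k}. of_nat (k - a) * gen (g - 1) (insert e T) (x(e := k - a)) $ a = 0"
      proof
        fix a assume "a \<in> {..k} - {1..<k}"
        then have "a = 0 \<or> a = k" by auto
        then show "of_nat (k - a) * gen (g - 1) (insert e T) (x(e := k - a)) $ a = 0" by auto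
      qed
    qed auto
    finally have a3: "(\<Sum>a\<in>{1..<k}. ?C (g - 1) (add_mset a (add_mset (k - a) (parts x T)))) / ?p T
      = diag e (gen (g - 1) (insert e T)) x $ k" unfolding diag_def by simp
    have a4: "(\<Sum>a\<in>{1..<k}. ?C h (add_mset a (parts x I)) * ?C h' (add_mset (k - a) (parts x (T - I)))) / ?p T
      = (gen h I x * gen h' (T - I) x) $ k" if I: "I \<in> Pow T" for h h' I
    proof -
      have pI: "?p T = ?p (T - I) * ?p I" by (rule prod.subset_diff) (use I T(1) in auto)
      have "(\<Sum>a\<in>{1..<k}. ?C h (add_mset a (parts x I)) * ?C h' (add_mset (k - a) (parts x (T - I)))) / ?p T
        = (\<Sum>a\<in>{1..<k}. gen h I x $ a * gen h' (T - I) x $ (k - a))"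
        unfolding sum_divide_distrib by (rule sum.cong[OF refl]) (simp add: gen_nth pI)
      also have "\<dots> = (\<Sum>a\<in>{0..k}. gen h I x $ a * gen h' (T - I) x $ (k - a))"
      proof (rule sum.mono_neutral_left)
        show "\<forall>a\<in>{0..k} - {1..<k}. gen h I x $ a * gen h' (T - I) x $ (k - a) = 0"
        proof
          fix a assume "a \<in> {0..k} - {1..<k}"
          then have "a = 0 \<or> a = k" by auto
          then show "gen h I x $ a * gen h' (T - I) x $ (k - a) = 0" by auto
        qed
      qed auto
      finally show ?thesis by (simp only: fps_mult_nth)
    qed
    have "gen g T x $ k = ?C g (add_mset k (parts x T)) / ?p T" by (rule gen_nth[OF k])
    also have "?C g (add_mset k (parts x T)) = of_bool (g = 0 \<and> k = 1 \<and> T = {})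
      + (\<Sum>i\<in>T. of_nat (x i) * ?C g (add_mset (k + x i) (parts x (T - {i}))))
      + (if g = 0 then 0 else (\<Sum>a\<in>{1..<k}. ?C (g - 1) (add_mset a (add_mset (k - a) (parts x T)))))
      + (\<Sum>I\<in>Pow T. \<Sum>h\<le>g. \<Sum>a\<in>{1..<k}. ?C h (add_mset a (parts x I)) * ?C (g - h) (add_mset (k - a) (parts x (T - I))))"
    proof -
      have sw: "(\<Sum>a\<in>{1..<k}. \<Sum>I\<in>Pow T. \<Sum>h\<le>g. F a I h) = (\<Sum>I\<in>Pow T. \<Sum>h\<le>g. \<Sum>a\<in>{1..<k}. F a I h)" for F :: "nat \<Rightarrow> nat set \<Rightarrow> nat \<Rightarrow> rat"
      proof -
        have "(\<Sum>a\<in>{1..<k}. \<Sum>I\<in>Pow T. \<Sum>h\<le>g. F a I h) = (\<Sum>I\<in>Pow T. \<Sum>a\<in>{1..<k}. \<Sum>h\<le>g. F a I h)" by (rule sum.swap)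
        also have "\<dots> = (\<Sum>I\<in>Pow T. \<Sum>h\<le>g. \<Sum>a\<in>{1..<k}. F a I h)" by (rule sum.cong[OF refl], rule sum.swap)
        finally show ?thesis .
      qed
      have "genus_count g (add_mset k (parts x T)) = of_bool (g = 0 \<and> k = 1 \<and> T = {})
        + (\<Sum>i\<in>T. int (x i) * genus_count g (add_mset (k + x i) (parts x (T - {i}))))
        + (\<Sum>a\<in>{1..<k}. (if g = 0 then 0 else genus_count (g - 1) (add_mset a (add_mset (k - a) (parts x T))))
           + (\<Sum>I\<in>Pow T. \<Sum>h\<le>g. genus_count h (add_mset a (parts x I)) * genus_count (g - h) (add_mset (k - a) (parts x (T - I)))))"
        by (rule genus_count_rec) (use T k in auto)
      then show ?thesis unfolding sw[symmetric] by (simp add: sum.distrib)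
    qed
    also have "\<dots> / ?p T = (if g = 0 \<and> T = {} then fps_X else 0) $ k + (\<Sum>i\<in>T. shift (x i) (gen g (T - {i}) x) $ k)
      + (if g = 0 then 0 else diag e (gen (g - 1) (insert e T)) x $ k)
      + (\<Sum>I\<in>Pow T. \<Sum>h\<le>g. (gen h I x * gen (g - h) (T - I) x) $ k)"
    proof -
      have b2: "(\<Sum>i\<in>T. of_nat (x i) * ?C g (add_mset (k + x i) (parts x (T - {i})))) / ?p T
        = (\<Sum>i\<in>T. shift (x i) (gen g (T - {i}) x) $ k)"
        unfolding sum_divide_distrib by (rule sum.cong[OF refl a2])
      have b4: "(\<Sum>I\<in>Pow T. \<Sum>h\<le>g. \<Sum>a\<in>{1..<k}. ?C h (add_mset a (parts x I)) * ?C (g - h) (add_mset (k - a) (parts x (T - I)))) / ?p T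
        = (\<Sum>I\<in>Pow T. \<Sum>h\<le>g. (gen h I x * gen (g - h) (T - I) x) $ k)"
        unfolding sum_divide_distrib[of _ "Pow T"] sum_divide_distrib[of _ "{..g}"]
        by (intro sum.cong[OF refl]) (rule a4)
      show ?thesis unfolding add_divide_distrib a1 b2 b4 using a3 by simp
    qed
    finally show ?thesis by (simp add: fps_sum_nth)
  qed
qed

section \<open>The generating series are tensors\<close>

text \<open>Completing the square gives \<open>1 - 2 F\<close> as plus or minus the square root
  \<open>U * cb\<close>; the constant coefficient 0 decides the sign.\<close>

lemma cat_unique:
  assumes "F = fps_X + F * F" "F $ 0 = 0"
  shows "F = cat"
proof -
  have four: "fps_const 4 = (4 :: rat fps)" by (simp add: fps_numeral_fps_const)
  have "(1 - 2 * F) * (1 - 2 * F) = 1 - 4 * (F - F * F)" by (simp add: algebra_simps)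
  also have "F - F * F = fps_X" using assms(1) by (metis add_diff_cancel_right')
  also have "1 - 4 * fps_X = U" by (simp add: U_def four)
  also have "U = (U * cb) * (U * cb)" using U_cb_cb by (simp add: algebra_simps)
  finally have "(1 - 2 * F - U * cb) * (1 - 2 * F + U * cb) = 0" by (simp add: algebra_simps)
  moreover have "(1 - 2 * F + U * cb) $ 0 = 2" using assms(2) by (simp add: fps_numeral_fps_const)
  then have "1 - 2 * F + U * cb \<noteq> 0" by (metis fps_zero_nth zero_neq_numeral)
  ultimately have "1 - 2 * F - U * cb = 0" by simp
  then have "2 * F = 1 - U * cb" by (simp add: algebra_simps)
  also have "\<dots> = 2 * cat" by (simp add: cat_def fps_numeral_fps_const flip: mult.assoc)
  finally show ?thesis by simp
qed

text \<open>The coefficient of \<open>W\<close> on the left-hand side becomes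
  \<open>1 - 2 * cat = U * cb\<close>, which has the inverse \<open>cb\<close>.\<close>

lemma cat_solve: "W = A + 2 * cat * W \<Longrightarrow> W = cb * A"
proof -
  assume W: "W = A + 2 * cat * W"
  have c: "2 * cat = 1 - U * cb" by (simp add: cat_def fps_numeral_fps_const flip: mult.assoc)
  have "A = W - 2 * cat * W" using W by (metis add_diff_cancel_right')
  also have "\<dots> = (U * cb) * W" unfolding c by (simp add: algebra_simps)
  finally have "cb * A = (U * (cb * cb)) * W" by (simp add: mult_ac)
  then show ?thesis unfolding U_cb_cb by simp
qed

lemma gen_0_empty: "gen 0 {} x = cat"
proof (rule cat_unique)
  show "gen 0 {} x = fps_X + gen 0 {} x * gen 0 {} x"
    by (subst gen_rec[of _ _ undefined]) auto
qed simp

lemma gen_0_singleton: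
  assumes "0 < x i"
  shows "gen 0 {i} x = G (x i)"
proof -
  have "gen 0 {i} x = shift (x i) (gen 0 ({i} - {i}) x) + (\<Sum>I\<in>Pow {i}. gen 0 I x * gen 0 ({i} - I) x)"
    by (subst gen_rec[of _ _ "Suc i"]) (use assms in auto)
  also have "\<dots> = shift (x i) cat + 2 * cat * gen 0 {i} x"
    by (simp add: Pow_insert gen_0_empty)
  finally have "gen 0 {i} x = shift (x i) cat + 2 * cat * gen 0 {i} x" .
  from cat_solve[OF this] show ?thesis by (simp add: G_def)
qed

lemma gen_1_empty: "gen 1 {} x = fps_X ^ 2 * cb ^ 5"
proof -
  have "gen 1 {} x = diag 0 (gen 0 {0}) x + (\<Sum>h\<le>1. gen h {} x * gen (1 - h) {} x)"
    by (subst gen_rec[of _ _ 0]) auto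
  also have "\<dots> = diag 0 (gen 0 {0}) x + 2 * cat * gen 1 {} x"
    by (simp add: gen_0_empty)
  finally have "gen 1 {} x = cb * diag 0 (gen 0 {0}) x" by (rule cat_solve)
  also have "diag 0 (gen 0 {0}) x = fps_X ^ 2 * cb ^ 4"
    unfolding one_point_genus_one[symmetric] diag_def
  proof (rule fps_ext, unfold fps_nth_Abs_fps, rule sum.cong[OF refl])
    fix k a :: nat assume a: "a \<in> {..k}"
    show "of_nat (k - a) * gen 0 {0} (x(0 := k - a)) $ a = of_nat a * of_nat (k - a) * (cb $ a * cb $ (k - a) / (2 * of_nat k))"
    proof (cases "a = 0 \<or> k - a = 0")
      case False
      then have "gen 0 {0} (x(0 := k - a)) = G (k - a)" by (subst gen_0_singleton) auto
      then have "gen 0 {0} (x(0 := k - a)) $ a = of_nat a * cb $ a * cb $ (k - a) / (2 * of_nat (a + (k - a)))"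
        using G_nth[of a "k - a"] False by simp
      also have "a + (k - a) = k" using a by simp
      finally have eq: "gen 0 {0} (x(0 := k - a)) $ a = of_nat a * cb $ a * cb $ (k - a) / (2 * of_nat k)" .
      show ?thesis unfolding eq by (simp only: times_divide_eq_right mult_ac)
    qed auto
  qed
  finally show ?thesis by (simp add: eval_nat_numeral mult_ac)
qed

text \<open>The products for the subsets \<open>{i}\<close> and \<open>{j}\<close> together with the
  two shifts form the sum in \<open>three_point\<close>; those for the empty and the full subset are
  taken care of by \<open>cat_solve\<close>.\<close>

lemma gen_0_pair:
  assumes "0 < x i" "0 < x j" "i \<noteq> j"
  shows "gen 0 {i, j} x = fps_const (2 * cb $ x i * cb $ x j) * (fps_X * cb ^ 3)"
proof -
  have d: "{i, j} - {i} = {j}" "{i, j} - {j} = {i}" using assms(3) by auto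
  have rec: "gen 0 {i, j} x = (\<Sum>l\<in>{i, j}. shift (x l) (gen 0 ({i, j} - {l}) x)) + (\<Sum>I\<in>Pow {i, j}. gen 0 I x * gen 0 ({i, j} - I) x)"
    by (subst gen_rec[of _ _ "Suc (i + j)"]) (use assms in auto)
  have sh: "(\<Sum>l\<in>{i, j}. shift (x l) (gen 0 ({i, j} - {l}) x)) = shift (x i) (G (x j)) + shift (x j) (G (x i))"
    using assms(3) d gen_0_singleton[of x i] gen_0_singleton[of x j] assms by simp
  have P: "Pow {i, j} = {{}, {i}, {j}, {i, j}}" by auto
  have "(\<Sum>I\<in>Pow {i, j}. gen 0 I x * gen 0 ({i, j} - I) x)
    = cat * gen 0 {i, j} x + (G (x i) * G (x j) + (G (x j) * G (x i) + gen 0 {i, j} x * cat))"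
    unfolding P using assms d gen_0_singleton[of x i] gen_0_singleton[of x j] by (simp add: gen_0_empty doubleton_eq_iff)
  also have "\<dots> = 2 * G (x i) * G (x j) + 2 * cat * gen 0 {i, j} x"
    by (simp add: algebra_simps)
  finally have "gen 0 {i, j} x = (shift (x i) (G (x j)) + shift (x j) (G (x i)) + 2 * G (x i) * G (x j)) + 2 * cat * gen 0 {i, j} x"
    using rec unfolding sh by (simp only: add.assoc)
  from cat_solve[OF this] show ?thesis unfolding three_point[OF assms(1,2)] .
qed

text \<open>In the recursion, the two factors with \<open>(h, I) = (0, {})\<close> are moved to the left-hand side, and
  those with \<open>(h, I) = (0, {i})\<close> turn the shifts into join operators; the other factors are stable,
  that is, they satisfy \<open>2 \<le> 2 h + card I\<close>.\<close>

lemma gen_stable_rec: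
  assumes T: "finite T" "\<And>i. i \<in> T \<Longrightarrow> 0 < x i" and e: "e \<notin> T" and n: "3 \<le> 2 * g + card T"
  shows "gen g T x = (\<Sum>i\<in>T. join (x i) (gen g (T - {i}) x))
    + (if g = 0 then 0 else cb * diag e (gen (g - 1) (insert e T)) x)
    + (\<Sum>(I, h)\<in>{(I, h) \<in> Pow T \<times> {..g}. 2 \<le> 2 * h + card I \<and> 2 * h + card I + 2 \<le> 2 * g + card T}.
         cb * gen h I x * gen (g - h) (T - I) x)"
proof -
  define n where "n = 2 * g + card T"
  define P where "P = Pow T \<times> {..g}"
  define ht :: "nat set \<times> nat \<Rightarrow> nat" where "ht p = 2 * snd p + card (fst p)" for p
  define \<phi> where "\<phi> p = gen (snd p) (fst p) x * gen (g - snd p) (T - fst p) x" for p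
  \<comment> \<open>The involution that exchanges the two factors of a product; the heights
    \<open>ht\<close> of two partners add up to \<open>n\<close>.\<close>
  define \<sigma> where "\<sigma> p = (T - fst p, g - snd p)" for p
  have n3: "3 \<le> n" using n by (simp add: n_def)
  have finP: "finite P" using T(1) by (simp add: P_def)
  have \<sigma>P: "\<sigma> p \<in> P" "\<sigma> (\<sigma> p) = p" "\<phi> (\<sigma> p) = \<phi> p" "ht (\<sigma> p) + ht p = n" if p: "p \<in> P" for p
  proof -
    have s: "fst p \<subseteq> T" "snd p \<le> g" using p by (auto simp: P_def)
    then have tt: "T - (T - fst p) = fst p" by blast
    show "\<sigma> p \<in> P" using s by (simp add: \<sigma>_def P_def)
    show "\<sigma> (\<sigma> p) = p" using s tt by (simp add: \<sigma>_def prod_eq_iff)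
    show "\<phi> (\<sigma> p) = \<phi> p" using s tt by (simp add: \<sigma>_def \<phi>_def mult.commute)
    have "card (T - fst p) + card (fst p) = card T"
      using s T(1) by (metis card_Diff_subset card_mono finite_subset le_add_diff_inverse2)
    then show "ht (\<sigma> p) + ht p = n" using s by (simp add: ht_def \<sigma>_def n_def)
  qed
  let ?S = "\<lambda>Q. \<Sum>p\<in>{p \<in> P. Q (ht p)}. \<phi> p"
  have refl_sum: "?S Q = ?S (\<lambda>k. Q (n - k))" for Q
  proof (rule sum.reindex_bij_witness[of _ \<sigma> \<sigma>])
    fix p assume p: "p \<in> {p \<in> P. Q (ht p)}"
    then have "n - ht (\<sigma> p) = ht p" using \<sigma>P(4)[of p] by auto
    then show "\<sigma> p \<in> {p \<in> P. Q (n - ht p)}" using p \<sigma>P(1) by auto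
    show "\<sigma> (\<sigma> p) = p" "\<phi> (\<sigma> p) = \<phi> p" using p \<sigma>P by auto
  next
    fix p assume p: "p \<in> {p \<in> P. Q (n - ht p)}"
    then have "n - ht p = ht (\<sigma> p)" using \<sigma>P(4)[of p] by auto
    then show "\<sigma> p \<in> {p \<in> P. Q (ht p)}" using p \<sigma>P(1) by auto
    show "\<sigma> (\<sigma> p) = p" using p \<sigma>P by auto
  qed
  have le: "ht p \<le> n" if "p \<in> P" for p using \<sigma>P(4)[OF that] by simp
  \<comment> \<open>Because of \<open>3 \<le> n\<close> the heights 0, 1, \<open>n - 1\<close> and
    \<open>n\<close> are distinct, so these five classes partition \<open>P\<close>. By the
    involution the upper two unstable classes repeat the lower two, whence the factors 2 in
    \<open>cat_solve\<close> and \<open>join\<close>.\<close>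
  have "(\<Sum>p\<in>P. \<phi> p) = ?S (\<lambda>k. k = 0) + ?S (\<lambda>k. k = 1) + ?S (\<lambda>k. k + 1 = n) + ?S (\<lambda>k. k = n) + ?S (\<lambda>k. 2 \<le> k \<and> k + 2 \<le> n)"
  proof -
    have ind: "?S Q = (\<Sum>p\<in>P. if Q (ht p) then \<phi> p else 0)" for Q
      by (rule sum.inter_filter[OF finP])
    show ?thesis
      unfolding ind[of "\<lambda>k. k = 0"] ind[of "\<lambda>k. k = 1"] ind[of "\<lambda>k. k + 1 = n"] ind[of "\<lambda>k. k = n"]
        ind[of "\<lambda>k. 2 \<le> k \<and> k + 2 \<le> n"] sum.distrib[symmetric]
    proof (rule sum.cong[OF refl])
      fix p assume "p \<in> P"
      then have "ht p \<le> n" by (rule le)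
      then consider "ht p = 0" | "ht p = 1" | "ht p + 1 = n" | "ht p = n" | "2 \<le> ht p" "ht p + 2 \<le> n" by linarith
      then show "\<phi> p = (if ht p = 0 then \<phi> p else 0) + (if ht p = 1 then \<phi> p else 0) + (if ht p + 1 = n then \<phi> p else 0)
        + (if ht p = n then \<phi> p else 0) + (if 2 \<le> ht p \<and> ht p + 2 \<le> n then \<phi> p else 0)"
        by cases (use n3 in auto)
    qed
  qed
  moreover have "?S (\<lambda>k. k = n) = ?S (\<lambda>k. k = 0)"
  proof -
    have "?S (\<lambda>k. k = n) = ?S (\<lambda>k. n - k = n)" by (rule refl_sum)
    also have "{p \<in> P. n - ht p = n} = {p \<in> P. ht p = 0}" using n3 by auto
    finally show ?thesis .
  qed
  moreover have "?S (\<lambda>k. k + 1 = n) = ?S (\<lambda>k. k = 1)"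
  proof -
    have "?S (\<lambda>k. k + 1 = n) = ?S (\<lambda>k. n - k + 1 = n)" by (rule refl_sum)
    also have "{p \<in> P. n - ht p + 1 = n} = {p \<in> P. ht p = 1}"
    proof -
      have "n - ht p + 1 = n \<longleftrightarrow> ht p = 1" if "p \<in> P" for p using le[OF that] n3 by arith
      then show ?thesis by blast
    qed
    finally show ?thesis .
  qed
  moreover have "?S (\<lambda>k. k = 0) = cat * gen g T x"
  proof -
    have "{p \<in> P. ht p = 0} = {({}, 0)}"
    proof (intro Set.set_eqI iffI)
      fix p assume "p \<in> {p \<in> P. ht p = 0}"
      then have "card (fst p) = 0" "snd p = 0" "finite (fst p)" using finite_subset[OF _ T(1)] by (auto simp: P_def ht_def)
      then show "p \<in> {({}, 0)}" by (simp add: prod_eq_iff)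
    qed (auto simp: P_def ht_def)
    then show ?thesis by (simp add: \<phi>_def gen_0_empty)
  qed
  moreover have "?S (\<lambda>k. k = 1) = (\<Sum>i\<in>T. G (x i) * gen g (T - {i}) x)"
  proof -
    have "{p \<in> P. ht p = 1} = (\<lambda>i. ({i}, 0)) ` T"
    proof (intro Set.set_eqI iffI)
      fix p assume p: "p \<in> {p \<in> P. ht p = 1}"
      then have "2 * snd p + card (fst p) = 1" by (simp add: ht_def)
      then have "card (fst p) = 1" "snd p = 0" by arith+
      then obtain i where "fst p = {i}" by (metis card_1_singletonE)
      then show "p \<in> (\<lambda>i. ({i}, 0)) ` T" using p \<open>snd p = 0\<close> by (intro image_eqI[of _ _ i]) (auto simp: P_def prod_eq_iff)
    qed (auto simp: P_def ht_def)
    moreover have "inj_on (\<lambda>i. ({i}, 0 :: nat)) T" by (auto intro: inj_onI)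
    ultimately have "?S (\<lambda>k. k = 1) = (\<Sum>i\<in>T. \<phi> ({i}, 0))" by (simp add: sum.reindex)
    also have "\<dots> = (\<Sum>i\<in>T. G (x i) * gen g (T - {i}) x)"
      by (rule sum.cong[OF refl]) (simp add: \<phi>_def gen_0_singleton T(2))
    finally show ?thesis .
  qed
  moreover have "(\<Sum>I\<in>Pow T. \<Sum>h\<le>g. gen h I x * gen (g - h) (T - I) x) = (\<Sum>p\<in>P. \<phi> p)"
    unfolding P_def \<phi>_def by (simp add: sum.cartesian_product split_beta)
  moreover define M where "M = ?S (\<lambda>k. 2 \<le> k \<and> k + 2 \<le> n)"
  moreover define Q where "Q = (if g = 0 then 0 else diag e (gen (g - 1) (insert e T)) x)"
  moreover have "gen g T x = (if g = 0 \<and> T = {} then fps_X else 0) + (\<Sum>i\<in>T. shift (x i) (gen g (T - {i}) x))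
    + Q + (\<Sum>I\<in>Pow T. \<Sum>h\<le>g. gen h I x * gen (g - h) (T - I) x)"
    unfolding Q_def by (rule gen_rec) (use T e in auto)
  moreover have "\<not> (g = 0 \<and> T = {})" using n by auto
  ultimately have "gen g T x = (\<Sum>i\<in>T. shift (x i) (gen g (T - {i}) x)) + Q + (cat * gen g T x
      + (\<Sum>i\<in>T. G (x i) * gen g (T - {i}) x) + (\<Sum>i\<in>T. G (x i) * gen g (T - {i}) x) + cat * gen g T x + M)"
    by simp
  moreover have "a + q + (c * w + b + b + c * w + M) = (a + q + 2 * b + M) + 2 * c * w" for a q c w b :: "rat fps"
    by (simp add: algebra_simps)
  ultimately have "gen g T x = ((\<Sum>i\<in>T. shift (x i) (gen g (T - {i}) x)) + Q
      + 2 * (\<Sum>i\<in>T. G (x i) * gen g (T - {i}) x) + M) + 2 * cat * gen g T x"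
    by (simp only:)
  from cat_solve[OF this]
  have "gen g T x = cb * ((\<Sum>i\<in>T. shift (x i) (gen g (T - {i}) x)) + Q
      + 2 * (\<Sum>i\<in>T. G (x i) * gen g (T - {i}) x) + M)" .
  also have "\<dots> = cb * ((\<Sum>i\<in>T. shift (x i) (gen g (T - {i}) x)) + 2 * (\<Sum>i\<in>T. G (x i) * gen g (T - {i}) x)) + cb * Q + cb * M"
    by (simp only: distrib_left ac_simps)
  also have "cb * ((\<Sum>i\<in>T. shift (x i) (gen g (T - {i}) x)) + 2 * (\<Sum>i\<in>T. G (x i) * gen g (T - {i}) x))
    = (\<Sum>i\<in>T. join (x i) (gen g (T - {i}) x))"
    unfolding join_def by (simp add: sum_distrib_left sum.distrib[symmetric] distrib_left mult.assoc)
  also have "cb * Q = (if g = 0 then 0 else cb * diag e (gen (g - 1) (insert e T)) x)"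
    by (simp add: Q_def)
  also have "cb * M = (\<Sum>(I, h)\<in>{(I, h) \<in> Pow T \<times> {..g}. 2 \<le> 2 * h + card I \<and> 2 * h + card I + 2 \<le> 2 * g + card T}.
         cb * gen h I x * gen (g - h) (T - I) x)"
  proof -
    have "{p \<in> P. 2 \<le> ht p \<and> ht p + 2 \<le> n}
      = {(I, h) \<in> Pow T \<times> {..g}. 2 \<le> 2 * h + card I \<and> 2 * h + card I + 2 \<le> 2 * g + card T}"
      unfolding P_def ht_def n_def by (rule Set.set_eqI) (auto simp: split_beta mem_Times_iff)
    then show ?thesis
      unfolding M_def sum_distrib_left by (rule sum.cong) (simp only: \<phi>_def split_beta mult.assoc)
  qed
  finally show ?thesis .
qed

text \<open>Join and cut lower \<open>2 * g + card T\<close> by one. In a product the values of the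
  two factors add up to it and both are at least 2, so each of them is smaller.\<close>

theorem gen_tens:
  fixes T :: "nat set"
  assumes "finite T" "2 \<le> 2 * g + card T"
  shows "\<exists>\<Phi>. tens T \<Phi> \<and> (\<forall>x. (\<forall>i\<in>T. 0 < x i) \<longrightarrow> gen g T x = \<Phi> x)"
  using assms
proof (induction "2 * g + card T" arbitrary: g T rule: less_induct)
  case less
  show ?case
  proof (cases "2 * g + card T = 2")
    case True
    then consider "g = 1" "card T = 0" | "g = 0" "card T = 2" by (cases g) auto
    then show ?thesis
    proof cases
      case 1
      then have T: "T = {}" using less.prems by simp
      have "fps_X ^ 2 * cb ^ (2 * 2 + 1) \<in> odd_span" by (rule odd_span_X_power) simp
      then have "tens T (\<lambda>x. fps_const (\<Prod>i\<in>T. 0 $ x i) * (fps_X ^ 2 * cb ^ 5))"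
        by (intro tens_single) (simp_all add: T eval_nat_numeral)
      then show ?thesis using gen_1_empty 1 T by (intro exI) auto
    next
      case 2
      then obtain i j where ij: "T = {i, j}" "i \<noteq> j" by (meson card_2_iff)
      have "fps_const 2 * (fps_X ^ 1 * cb ^ (2 * 1 + 1)) \<in> odd_span" by (intro odd_span_scale odd_span_X_power) simp
      moreover have "cb \<in> odd_span" using odd_span_power[of 0] by simp
      ultimately have "tens T (\<lambda>x. fps_const (\<Prod>i\<in>T. cb $ x i) * (fps_const 2 * (fps_X * cb ^ 3)))"
        by (intro tens_single) (simp_all add: eval_nat_numeral)
      moreover have "gen g T x = fps_const (\<Prod>i\<in>T. cb $ x i) * (fps_const 2 * (fps_X * cb ^ 3))" if "\<forall>i\<in>T. 0 < x i" for x
      proof -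
        have p: "(\<Prod>i\<in>T. cb $ x i) = cb $ x i * cb $ x j" using ij by simp
        have "fps_const (2 * cb $ x i * cb $ x j) = fps_const (cb $ x i * cb $ x j) * fps_const 2"
          by (simp add: mult_ac)
        moreover have "gen g T x = fps_const (2 * cb $ x i * cb $ x j) * (fps_X * cb ^ 3)"
          using gen_0_pair[of x i j] that 2 ij by simp
        ultimately show ?thesis unfolding p by (simp only: mult.assoc)
      qed
      ultimately show ?thesis by blast
    qed
  next
    case False
    with less.prems have n: "3 \<le> 2 * g + card T" by simp
    obtain e where e: "e \<notin> T" using less.prems(1) by (metis ex_new_if_finite infinite_UNIV_nat)
    \<comment> \<open>A single function is fixed for each pair \<open>(h, I)\<close>, since
      \<open>diag\<close> evaluates it at varying points.\<close>
    define \<Psi> where "\<Psi> h I = (SOME \<Phi>. tens I \<Phi> \<and> (\<forall>x. (\<forall>i\<in>I. 0 < x i) \<longrightarrow> gen h I x = \<Phi> x))" for h and I :: "nat set"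
    have \<Psi>: "tens I (\<Psi> h I) \<and> (\<forall>x. (\<forall>i\<in>I. 0 < x i) \<longrightarrow> gen h I x = \<Psi> h I x)"
      if "finite I" "2 \<le> 2 * h + card I" "2 * h + card I < 2 * g + card T" for h I
      unfolding \<Psi>_def by (rule someI_ex[OF less.hyps]) (use that in auto)
    let ?M = "{(I, h) \<in> Pow T \<times> {..g}. 2 \<le> 2 * h + card I \<and> 2 * h + card I + 2 \<le> 2 * g + card T}"
    define \<Phi> where "\<Phi> x = (\<Sum>i\<in>T. join (x i) (\<Psi> g (T - {i}) x))
      + (if g = 0 then 0 else cb * diag e (\<Psi> (g - 1) (insert e T)) x)
      + (\<Sum>p\<in>?M. cb * \<Psi> (snd p) (fst p) x * \<Psi> (g - snd p) (T - fst p) x)" for x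
    have c1: "finite (T - {i}) \<and> 2 \<le> 2 * g + card (T - {i}) \<and> 2 * g + card (T - {i}) < 2 * g + card T" if "i \<in> T" for i
    proof -
      have "Suc (card (T - {i})) = card T" by (rule card_Suc_Diff1[OF less.prems(1) that])
      then show ?thesis using n less.prems(1) by auto
    qed
    have c2: "finite (insert e T) \<and> 2 \<le> 2 * (g - 1) + card (insert e T) \<and> 2 * (g - 1) + card (insert e T) < 2 * g + card T" if "g \<noteq> 0"
      using that n less.prems(1) e by auto
    have c3: "finite (fst p) \<and> 2 \<le> 2 * snd p + card (fst p) \<and> 2 * snd p + card (fst p) < 2 * g + card T
      \<and> finite (T - fst p) \<and> 2 \<le> 2 * (g - snd p) + card (T - fst p) \<and> 2 * (g - snd p) + card (T - fst p) < 2 * g + card T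
      \<and> fst p \<subseteq> T" if p: "p \<in> ?M" for p
    proof -
      have p': "fst p \<subseteq> T" "snd p \<le> g" "2 \<le> 2 * snd p + card (fst p)" "2 * snd p + card (fst p) + 2 \<le> 2 * g + card T"
        using p by auto
      have fin: "finite (fst p)" using p'(1) less.prems(1) by (rule finite_subset)
      have "card (T - fst p) + card (fst p) = card T"
        using p'(1) fin less.prems(1) by (metis card_Diff_subset card_mono le_add_diff_inverse2)
      then show ?thesis using p' fin less.prems(1) by auto
    qed
    have "tens T \<Phi>"
      unfolding \<Phi>_def
    proof (intro tens_add)
      show "tens T (\<lambda>x. \<Sum>i\<in>T. join (x i) (\<Psi> g (T - {i}) x))"
      proof (rule tens_sum)
        fix i assume i: "i \<in> T"
        show "tens T (\<lambda>x. join (x i) (\<Psi> g (T - {i}) x))"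
          by (rule tens_join[OF _ i less.prems(1)]) (use \<Psi> c1[OF i] in blast)
      qed
      show "tens T (\<lambda>x. if g = 0 then 0 else cb * diag e (\<Psi> (g - 1) (insert e T)) x)"
      proof (cases "g = 0")
        case False
        have "tens T (\<lambda>x. cb * diag e (\<Psi> (g - 1) (insert e T)) x)"
          by (rule tens_diag[OF _ e less.prems(1)]) (use \<Psi> c2[OF False] in blast)
        then show ?thesis using False by simp
      qed (simp add: tens_0)
      show "tens T (\<lambda>x. \<Sum>p\<in>?M. cb * \<Psi> (snd p) (fst p) x * \<Psi> (g - snd p) (T - fst p) x)"
      proof (rule tens_sum)
        fix p assume p: "p \<in> ?M"
        have "tens (fst p) (\<Psi> (snd p) (fst p))" "tens (T - fst p) (\<Psi> (g - snd p) (T - fst p))"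
          using \<Psi> c3[OF p] by blast+
        then have "tens (fst p \<union> (T - fst p)) (\<lambda>x. cb * \<Psi> (snd p) (fst p) x * \<Psi> (g - snd p) (T - fst p) x)"
          using c3[OF p] by (intro tens_mult) auto
        moreover have "fst p \<union> (T - fst p) = T" using c3[OF p] by blast
        ultimately show "tens T (\<lambda>x. cb * \<Psi> (snd p) (fst p) x * \<Psi> (g - snd p) (T - fst p) x)" by simp
      qed
    qed
    moreover have "gen g T x = \<Phi> x" if x: "\<forall>i\<in>T. 0 < x i" for x
    proof -
      have "gen g T x = (\<Sum>i\<in>T. join (x i) (gen g (T - {i}) x))
        + (if g = 0 then 0 else cb * diag e (gen (g - 1) (insert e T)) x)
        + (\<Sum>p\<in>?M. cb * gen (snd p) (fst p) x * gen (g - snd p) (T - fst p) x)"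
        using gen_stable_rec[OF less.prems(1) _ e n, of x] x by (simp add: split_beta)
      also have "(\<Sum>i\<in>T. join (x i) (gen g (T - {i}) x)) = (\<Sum>i\<in>T. join (x i) (\<Psi> g (T - {i}) x))"
      proof (rule sum.cong[OF refl])
        fix i assume i: "i \<in> T"
        have "gen g (T - {i}) x = \<Psi> g (T - {i}) x" using \<Psi>[of "T - {i}" g] c1[OF i] x by simp
        then show "join (x i) (gen g (T - {i}) x) = join (x i) (\<Psi> g (T - {i}) x)" by simp
      qed
      also have "(if g = 0 then 0 else cb * diag e (gen (g - 1) (insert e T)) x)
        = (if g = 0 then 0 else cb * diag e (\<Psi> (g - 1) (insert e T)) x)"
      proof (cases "g = 0")
        case False
        have "diag e (gen (g - 1) (insert e T)) x = diag e (\<Psi> (g - 1) (insert e T)) x"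
          unfolding diag_def
        proof (rule fps_ext, unfold fps_nth_Abs_fps, rule sum.cong[OF refl])
          fix k a :: nat assume "a \<in> {..k}"
          show "of_nat (k - a) * gen (g - 1) (insert e T) (x(e := k - a)) $ a
            = of_nat (k - a) * \<Psi> (g - 1) (insert e T) (x(e := k - a)) $ a"
          \<comment> \<open>At argument 0 the tensor need not agree with \<open>gen\<close>; there
            the weight \<open>k - a\<close> removes the term.\<close>
          proof (cases "k - a = 0")
            case False
            have pos: "\<forall>i\<in>insert e T. 0 < (x(e := k - a)) i" using x False by auto
            have "gen (g - 1) (insert e T) (x(e := k - a)) = \<Psi> (g - 1) (insert e T) (x(e := k - a))"
            proof -
              have "\<forall>y. (\<forall>i\<in>insert e T. 0 < y i) \<longrightarrow> gen (g - 1) (insert e T) y = \<Psi> (g - 1) (insert e T) y"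
                using \<Psi> c2[OF \<open>g \<noteq> 0\<close>] by blast
              from spec[OF this, of "x(e := k - a)"] pos show ?thesis by (rule mp)
            qed
            then show ?thesis by simp
          qed simp
        qed
        then show ?thesis by simp
      qed simp
      also have "(\<Sum>p\<in>?M. cb * gen (snd p) (fst p) x * gen (g - snd p) (T - fst p) x)
        = (\<Sum>p\<in>?M. cb * \<Psi> (snd p) (fst p) x * \<Psi> (g - snd p) (T - fst p) x)"
      proof (rule sum.cong[OF refl])
        fix p assume p: "p \<in> ?M"
        have "\<forall>i\<in>fst p. 0 < x i" "\<forall>i\<in>T - fst p. 0 < x i" using x c3[OF p] by auto
        then have "gen (snd p) (fst p) x = \<Psi> (snd p) (fst p) x" "gen (g - snd p) (T - fst p) x = \<Psi> (g - snd p) (T - fst p) x"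
          using \<Psi>[of "fst p" "snd p"] \<Psi>[of "T - fst p" "g - snd p"] c3[OF p] by blast+
        then show "cb * gen (snd p) (fst p) x * gen (g - snd p) (T - fst p) x
          = cb * \<Psi> (snd p) (fst p) x * \<Psi> (g - snd p) (T - fst p) x" by simp
      qed
      finally show ?thesis unfolding \<Phi>_def .
    qed
    ultimately show ?thesis by blast
  qed
qed

section \<open>Extracting the polynomial\<close>

type_synonym rat_mpoly = "(nat \<Rightarrow>\<^sub>0 nat) \<Rightarrow>\<^sub>0 rat"

lemma poly_eval_superset:
  assumes "finite K" "Poly_Mapping.keys P \<subseteq> K"
  shows "poly_eval P x = (\<Sum>k\<in>K. Poly_Mapping.lookup P k * (\<Prod>i\<in>Poly_Mapping.keys k. x i ^ Poly_Mapping.lookup k i))"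
  unfolding poly_eval_def
  by (rule sum.mono_neutral_left) (use assms in \<open>auto simp: in_keys_iff\<close>)

lemma poly_eval_add: "poly_eval (P + Q) x = poly_eval P x + poly_eval Q x"
proof -
  let ?K = "Poly_Mapping.keys P \<union> Poly_Mapping.keys Q"
  have K: "finite ?K" "Poly_Mapping.keys P \<subseteq> ?K" "Poly_Mapping.keys Q \<subseteq> ?K" "Poly_Mapping.keys (P + Q) \<subseteq> ?K"
    by (auto simp: Poly_Mapping.keys_add)
  show ?thesis
    unfolding poly_eval_superset[OF K(1,2)] poly_eval_superset[OF K(1,3)] poly_eval_superset[OF K(1,4)]
    by (simp add: lookup_add distrib_right sum.distrib)
qed

lemma poly_vars_add: "poly_vars (P + Q) \<subseteq> poly_vars P \<union> poly_vars Q"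
  unfolding poly_vars_def using Poly_Mapping.keys_add[of P Q] by blast

lemma poly_eval_0 [simp]: "poly_eval 0 x = 0"
  by (simp add: poly_eval_def)

lemma poly_vars_0 [simp]: "poly_vars 0 = {}"
  by (simp add: poly_vars_def)

lemma ex_poly_sum:
  assumes "finite A" "\<And>a. a \<in> A \<Longrightarrow> \<exists>P :: rat_mpoly. poly_vars P \<subseteq> J \<and> (\<forall>x. poly_eval P x = f a x)"
  shows "\<exists>P :: rat_mpoly. poly_vars P \<subseteq> J \<and> (\<forall>x. poly_eval P x = (\<Sum>a\<in>A. f a x))"
  using assms
proof (induction A rule: finite_induct)
  case empty
  show ?case by (intro exI[of _ 0]) simp
next
  case (insert a A)
  obtain P :: rat_mpoly where P: "poly_vars P \<subseteq> J" "\<forall>x. poly_eval P x = f a x" using insert.prems by blast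
  obtain Q :: rat_mpoly where Q: "poly_vars Q \<subseteq> J" "\<forall>x. poly_eval Q x = (\<Sum>a\<in>A. f a x)"
    using insert.IH insert.prems by blast
  have "poly_vars (P + Q) \<subseteq> J" using poly_vars_add[of P Q] P(1) Q(1) by blast
  moreover have "\<forall>x. poly_eval (P + Q) x = (\<Sum>a\<in>insert a A. f a x)"
    using P(2) Q(2) insert.hyps by (simp add: poly_eval_add)
  ultimately show ?case by blast
qed

lemma ex_poly_monomial:
  assumes "finite J"
  shows "\<exists>P :: rat_mpoly. poly_vars P \<subseteq> J \<and> (\<forall>x. poly_eval P x = c * (\<Prod>i\<in>J. x i ^ e i))"
proof -
  define m where "m = Abs_poly_mapping (\<lambda>i. if i \<in> J then e i else 0)"
  have "finite {i. (if i \<in> J then e i else 0) \<noteq> 0}" by (rule finite_subset[OF _ assms]) auto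
  then have m: "Poly_Mapping.lookup m i = (if i \<in> J then e i else 0)" for i
    by (simp add: m_def Abs_poly_mapping_inverse)
  have km: "Poly_Mapping.keys m \<subseteq> J" by (auto simp: in_keys_iff m split: if_splits)
  have "(\<Prod>i\<in>Poly_Mapping.keys m. x i ^ Poly_Mapping.lookup m i) = (\<Prod>i\<in>J. x i ^ Poly_Mapping.lookup m i)" for x :: "nat \<Rightarrow> rat"
    by (rule prod.mono_neutral_left) (use assms km in \<open>auto simp: in_keys_iff\<close>)
  also have "(\<Prod>i\<in>J. x i ^ Poly_Mapping.lookup m i) = (\<Prod>i\<in>J. x i ^ e i)" for x :: "nat \<Rightarrow> rat"
    by (rule prod.cong) (auto simp: m)
  finally have mon: "(\<Prod>i\<in>Poly_Mapping.keys m. x i ^ Poly_Mapping.lookup m i) = (\<Prod>i\<in>J. x i ^ e i)" for x :: "nat \<Rightarrow> rat" .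
  have "poly_eval (Poly_Mapping.single m c) x = c * (\<Prod>i\<in>J. x i ^ e i)" for x
    using poly_eval_superset[of "{m}" "Poly_Mapping.single m c" x] mon[of x] by (simp add: lookup_single)
  moreover have "poly_vars (Poly_Mapping.single m c) \<subseteq> J"
    using km by (auto simp: poly_vars_def split: if_splits)
  ultimately show ?thesis by blast
qed

text \<open>The product of sums is expanded into monomials, one for each choice \<open>e\<close> of
  exponents.\<close>

lemma ex_poly_prod:
  fixes p :: "nat \<Rightarrow> rat poly"
  assumes "finite J"
  shows "\<exists>P :: rat_mpoly. poly_vars P \<subseteq> J \<and> (\<forall>x. poly_eval P x = (\<Prod>i\<in>J. poly (p i) (x i)))"
proof -
  let ?E = "\<lambda>i. {..degree (p i)}"
  have "(\<Prod>i\<in>J. poly (p i) (x i)) = (\<Sum>e\<in>Pi\<^sub>E J ?E. (\<Prod>i\<in>J. coeff (p i) (e i)) * (\<Prod>i\<in>J. x i ^ e i))" for x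
  proof -
    have "(\<Prod>i\<in>J. poly (p i) (x i)) = (\<Prod>i\<in>J. \<Sum>j\<in>?E i. coeff (p i) j * x i ^ j)"
      by (simp add: poly_altdef)
    also have "\<dots> = (\<Sum>e\<in>Pi\<^sub>E J ?E. \<Prod>i\<in>J. coeff (p i) (e i) * x i ^ e i)"
      by (rule prod_sum_PiE) (use assms in auto)
    finally show ?thesis by (simp add: prod.distrib)
  qed
  moreover have "\<exists>P :: rat_mpoly. poly_vars P \<subseteq> J \<and> (\<forall>x. poly_eval P x = (\<Sum>e\<in>Pi\<^sub>E J ?E. (\<Prod>i\<in>J. coeff (p i) (e i)) * (\<Prod>i\<in>J. x i ^ e i)))"
    by (rule ex_poly_sum) (use assms ex_poly_monomial in \<open>auto intro!: finite_PiE\<close>)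
  ultimately show ?thesis by simp
qed

text \<open>Subtracting a multiple of the constant coefficient makes the coefficient polynomials in the
  exponent divisible by that exponent.\<close>

lemma tens_poly:
  fixes T :: "nat set"
  assumes "tens T \<Phi>" "finite T" "e \<notin> T"
  shows "\<exists>P :: rat_mpoly. poly_vars P \<subseteq> insert e T \<and> (\<forall>x. \<Phi> x $ x e - cb $ x e * \<Phi> x $ 0
    = of_nat (x e) * (\<Prod>i\<in>insert e T. cb $ x i) * poly_eval P (\<lambda>i. of_nat (x i)))"
  using assms(1)
proof induction
  case tens_0
  show ?case by (intro exI[of _ 0]) simp
next
  case (tens_step \<Phi> v w)
  obtain P :: rat_mpoly where P: "poly_vars P \<subseteq> insert e T" "\<forall>x. \<Phi> x $ x e - cb $ x e * \<Phi> x $ 0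
    = of_nat (x e) * (\<Prod>i\<in>insert e T. cb $ x i) * poly_eval P (\<lambda>i. of_nat (x i))"
    using tens_step.IH by blast
  have "\<forall>i\<in>T. \<exists>p :: rat poly. \<forall>n. v i $ n = cb $ n * poly p (of_nat n)"
    using tens_step(2) odd_span_nth by blast
  then obtain p :: "nat \<Rightarrow> rat poly" where p: "\<And>i n. i \<in> T \<Longrightarrow> v i $ n = cb $ n * poly (p i) (of_nat n)"
    by metis
  obtain q' :: "rat poly" where q': "\<And>n. w $ n = cb $ n * poly q' (of_nat n)" using odd_span_nth[OF tens_step(3)] by blast
  \<comment> \<open>Here \<open>a = w $ 0\<close> because \<open>cb $ 0 = 1\<close>, so subtracting
    \<open>cb $ n * w $ 0\<close> from \<open>w $ n\<close> leaves \<open>n * cb $ n\<close> times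
    the value of \<open>q\<close> at \<open>n\<close>.\<close>
  obtain a q where q: "q' = pCons a q" by (cases q') auto
  \<comment> \<open>The polynomial of the series factor takes its place among those of
    \<open>T\<close> under the index \<open>e\<close>.\<close>
  define r where "r = p(e := q)"
  obtain Q :: rat_mpoly where Q: "poly_vars Q \<subseteq> insert e T" "\<forall>x. poly_eval Q x = (\<Prod>i\<in>insert e T. poly (r i) (x i))"
    using ex_poly_prod[of "insert e T" r] assms(2) by blast
  have "poly_vars (Q + P) \<subseteq> insert e T" using poly_vars_add[of Q P] P(1) Q(1) by blast
  moreover have "(fps_const (\<Prod>i\<in>T. v i $ x i) * w + \<Phi> x) $ x e - cb $ x e * (fps_const (\<Prod>i\<in>T. v i $ x i) * w + \<Phi> x) $ 0
    = of_nat (x e) * (\<Prod>i\<in>insert e T. cb $ x i) * poly_eval (Q + P) (\<lambda>i. of_nat (x i))" for x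
  proof -
    let ?V = "\<Prod>i\<in>T. v i $ x i"
    have w: "w $ x e - cb $ x e * w $ 0 = of_nat (x e) * (cb $ x e * poly q (of_nat (x e)))"
      unfolding q' q by (simp add: algebra_simps)
    have "?V = (\<Prod>i\<in>T. cb $ x i * poly (r i) (of_nat (x i)))"
      by (rule prod.cong) (use p assms(3) in \<open>auto simp: r_def\<close>)
    then have V: "?V * (cb $ x e * poly q (of_nat (x e)))
      = (\<Prod>i\<in>insert e T. cb $ x i) * (\<Prod>i\<in>insert e T. poly (r i) (of_nat (x i)))"
      using assms(2,3) by (simp add: prod.distrib r_def mult_ac)
    have "(fps_const ?V * w + \<Phi> x) $ x e - cb $ x e * (fps_const ?V * w + \<Phi> x) $ 0
      = ?V * (w $ x e - cb $ x e * w $ 0) + (\<Phi> x $ x e - cb $ x e * \<Phi> x $ 0)"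
      by (simp add: algebra_simps)
    also have "?V * (w $ x e - cb $ x e * w $ 0)
      = of_nat (x e) * ((\<Prod>i\<in>insert e T. cb $ x i) * (\<Prod>i\<in>insert e T. poly (r i) (of_nat (x i))))"
      unfolding w V[symmetric] by (simp only: mult_ac)
    finally show ?thesis
      using P(2) Q(2) by (simp only: poly_eval_add distrib_left mult.assoc)
  qed
  ultimately show ?case by blast
qed

theorem theorem0p6:
  fixes g m :: nat
  assumes "m \<ge> 1" and "(g, m) \<notin> {(0, 1), (0, 2)}"
  shows "\<exists>P :: (nat \<Rightarrow>\<^sub>0 nat) \<Rightarrow>\<^sub>0 rat.
           poly_vars P \<subseteq> {..<m} \<and>
           (\<forall>\<alpha>. is_partition \<alpha> \<and> length \<alpha> = m \<longrightarrow>
              of_nat (aut_card \<alpha>) / fact (sum_list \<alpha>) * of_nat (monotone_hurwitz g \<alpha>) =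
              (\<Prod>i<m. of_nat ((2 * \<alpha> ! i) choose (\<alpha> ! i))) * poly_eval P (\<lambda>i. of_nat (\<alpha> ! i)))"
proof -
  \<comment> \<open>Part 0 is the exponent of the series variable; the remaining parts index the
    tensor factors.\<close>
  let ?T = "{1..<m}"
  have T: "{..<m} = insert 0 ?T" "0 \<notin> ?T" "finite ?T" using assms(1) by auto
  have "2 \<le> 2 * g + card ?T"
  proof (cases g)
    case 0
    then have "m \<noteq> 1" "m \<noteq> 2" using assms(2) by auto
    then show ?thesis using assms(1) by simp
  qed simp
  then obtain \<Phi> where \<Phi>: "tens ?T \<Phi>" "\<forall>x. (\<forall>i\<in>?T. 0 < x i) \<longrightarrow> gen g ?T x = \<Phi> x"
    using gen_tens[of ?T g] by auto
  obtain P :: rat_mpoly where P: "poly_vars P \<subseteq> insert 0 ?T" "\<forall>x. \<Phi> x $ x 0 - cb $ x 0 * \<Phi> x $ 0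
    = of_nat (x 0) * (\<Prod>i\<in>insert 0 ?T. cb $ x i) * poly_eval P (\<lambda>i. of_nat (x i))"
    using tens_poly[OF \<Phi>(1) T(3,2)] by blast
  have "of_nat (aut_card \<alpha>) / fact (sum_list \<alpha>) * of_nat (monotone_hurwitz g \<alpha>) =
      (\<Prod>i<m. of_nat ((2 * \<alpha> ! i) choose (\<alpha> ! i))) * poly_eval P (\<lambda>i. of_nat (\<alpha> ! i))"
    if \<alpha>: "is_partition \<alpha>" "length \<alpha> = m" for \<alpha>
  proof -
    let ?x = "\<lambda>i. \<alpha> ! i"
    have pos: "0 < ?x i" if "i < m" for i
      using \<alpha> that by (auto simp: is_partition_def Ball_def in_set_conv_nth)
    have "0 \<notin> set \<alpha>" using \<alpha>(1) by (auto simp: is_partition_def)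
    have ms: "mset \<alpha> = add_mset (?x 0) (parts ?x ?T)"
    proof -
      have "mset \<alpha> = mset (map ?x [0..<m])" using \<alpha>(2) map_nth[of \<alpha>] by simp
      also have "\<dots> = parts ?x {..<m}" by (simp add: lessThan_atLeast0)
      finally show ?thesis using T by simp
    qed
    have prod: "(of_nat (prod_list \<alpha>) :: rat) = of_nat (?x 0) * (\<Prod>i\<in>?T. of_nat (?x i))"
    proof -
      have "prod_list \<alpha> = prod_mset (mset \<alpha>)" by (simp add: prod_mset_prod_list)
      also have "\<dots> = ?x 0 * (\<Prod>i\<in>?T. ?x i)" unfolding ms by (simp add: prod_unfold_prod_mset)
      finally show ?thesis by simp
    qed
    have pnz: "(of_nat (prod_list \<alpha>) :: rat) \<noteq> 0" using \<open>0 \<notin> set \<alpha>\<close> by (simp add: prod_list_zero_iff)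
    have x0: "0 < ?x 0" using pos assms(1) by simp
    have C: "genus_count g (mset \<alpha>) = cycle_count (2 * g + length \<alpha> + sum_list \<alpha> - 2) (mset \<alpha>)"
      unfolding genus_count_def by (simp add: sum_mset_sum_list)
    have "(of_int (int (monotone_hurwitz g \<alpha>) * int (aut_card \<alpha> * prod_list \<alpha>)) :: rat)
      = of_int (fact (sum_list \<alpha>) * genus_count g (mset \<alpha>))"
      unfolding C monotone_hurwitz_cycle_count[OF \<open>0 \<notin> set \<alpha>\<close>] ..
    then have "of_nat (monotone_hurwitz g \<alpha>) * of_nat (aut_card \<alpha>) * of_nat (prod_list \<alpha>)
      = fact (sum_list \<alpha>) * (of_int (genus_count g (mset \<alpha>)) :: rat)"
      by (simp add: mult.assoc)
    then have "of_nat (aut_card \<alpha>) / fact (sum_list \<alpha>) * of_nat (monotone_hurwitz g \<alpha>)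
      = of_int (genus_count g (mset \<alpha>)) / (of_nat (prod_list \<alpha>) :: rat)"
      using pnz by (simp add: field_simps)
    also have "\<dots> = gen g ?T ?x $ ?x 0 / of_nat (?x 0)"
      unfolding gen_nth[OF x0] ms prod by (simp add: mult.commute)
    \<comment> \<open>The constant coefficient of \<open>gen\<close> is 0, even though those of
      single terms of the tensor need not be. Subtracting it puts the coefficient in the form of
      \<open>tens_poly\<close>, whose factor \<open>x 0\<close> cancels the remaining
      denominator.\<close>
    also have "gen g ?T ?x $ ?x 0 = gen g ?T ?x $ ?x 0 - cb $ ?x 0 * gen g ?T ?x $ 0" by simp
    also have "gen g ?T ?x = \<Phi> ?x" using \<Phi>(2) pos by simp
    also have "\<Phi> ?x $ ?x 0 - cb $ ?x 0 * \<Phi> ?x $ 0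
      = of_nat (?x 0) * (\<Prod>i\<in>insert 0 ?T. cb $ ?x i) * poly_eval P (\<lambda>i. of_nat (?x i))"
      using P(2) by blast
    finally show ?thesis using x0 unfolding T(1) by (simp add: cb_nth)
  qed
  then show ?thesis using P(1) unfolding T(1) by blast
qed

end
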